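(* For fixed $d$, $\mathrm{Tr}\,\mathsf{RSK}_{m,n,d}$ is a polynomial (in $m$ and $n$) in $O(m^dn^d)$. More specifically, $$\mathrm{Tr}\,\mathsf{RSK}_{m,n,d}=N_0(m,n,d)+\sum_{(\sigma,\pi)}N_{\sigma,\pi}(m,n,d)\,\mathrm{Tr}\,\mathsf{RSK}_{\sigma,\pi},$$ where the sum is over nonzero reduced weight pairs $(\sigma,\pi)$ (satisfying the normalization in the context) of degree $d'\leq d$, $$N_{\sigma,\pi}(m,n,d)=\begin{cases}A_{\sigma,\pi}(d)\left(\binom{m}{\ell(\sigma)}\binom{n}{\ell(\pi)}+\binom{m}{\ell(\pi)}\binom{n}{\ell(\sigma)}\right)&\text{if }\sigma\neq\pi,\\ A_{\sigma,\pi}(d)\binom{m}{\ell(\sigma)}\binom{n}{\ell(\pi)}&\text{if }\sigma=\pi,\end{cases}$$ and $N_0(m,n,d)=\binom{d+n-1}{d}m+\binom{d+m-1}{d}n-mn$. The lead term of this polynomial is $$\frac{\mathrm{Tr}\,\mathsf{RSK}_{1^d,1^d}}{(d!)^2}\,m^dn^d$$ whenever $\mathrm{Tr}\,\mathsf{RSK}_{1^d,1^d}\neq0$.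
   Context: $\mathbb{N}=\{0,1,2,\dots\}$, and $m,n,d\in\mathbb{N}$; $1^d$ denotes the vector $(1,\dots,1)\in\mathbb{N}^d$. The lead term is the term of largest total degree in $m,n$. RSK. A semistandard Young tableau is a filling of a Young diagram (English notation) by positive integers, weakly increasing along rows and strictly increasing down columns. Row insertion $P\leftarrow p$: if no label in the first row of $P$ exceeds $p$, append $p$ to the end of the first row; otherwise replace the leftmost occurrence of the smallest label $p'>p$ of the first row by $p$, and insert $p'$ in the same way into the tableau formed by the remaining rows. Inserting a biletter $(p|q)$ into a pair $(P,Q)$ of tableaux of the same shape yields $(P\leftarrow p,Q^\uparrow)$, where $Q^\uparrow$ is $Q$ with a new box labelled $q$ placed where $P\leftarrow p$ has a new box. For an $m\times n$ matrix $\alpha$ with entries in $\mathbb{N}$, list biletters by reading the entries of $\alpha$ down columns, columns from left to right, recording $\alpha_{i,j}$ copies of $(i|j)$. $\mathrm{RSK}(\alpha)=(P,Q)$ is the result of inserting these biletters successively into $(\emptyset,\emptyset)$. Operator. Let $R_{m,n}=\mathbb{C}[z_{ij}]_{1\le i\le m,1\le j\le n}$, $Z=[z_{ij}]$, and $z^\alpha=\prod_{i,j} z_{ij}^{\alpha_{i,j}}$. For semistandard $P,Q$ of the same shape, $[P|Q]\in R_{m,n}$ is the product over column positions $c$ of the minors of $Z$ whose row indices are the entries of the $c$-th column of $P$ and whose column indices are the entries of the $c$-th column of $Q$. Let $\mathsf{RSK}:R_{m,n}\to R_{m,n}$ be the linear map with $z^\alpha\mapsto[P|Q]$ where $(P,Q)=\mathrm{RSK}(\alpha)$.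 It preserves degree, and $\mathsf{RSK}_{m,n,d}$ denotes its restriction to the span $R_{m,n,d}$ of degree-$d$ monomials. Weight spaces. A weight pair of degree $d$ is a pair $(\sigma,\pi)$ of tuples of nonnegative integers with $\sum_i\sigma_i=\sum_j\pi_j=d$; $\ell(\sigma)$ is the number of entries of $\sigma$. $R_{\sigma,\pi}$ is the span of the monomials $z^\alpha$ in $R_{\ell(\sigma),\ell(\pi)}$ for which $\alpha$ has row sums $\sigma$ and column sums $\pi$; it is preserved by $\mathsf{RSK}$, and $\mathsf{RSK}_{\sigma,\pi}$ is the restriction. Normalization. A weight pair $(\sigma,\pi)$ is normalized if all entries of $\sigma$ and $\pi$ are nonzero, $\ell(\sigma)\leq\ell(\pi)$, and, when $\ell(\sigma)=\ell(\pi)$, either $\sigma=\pi$ or $\sigma_i>\pi_i$ for the least $i$ with $\sigma_i\neq\pi_i$. The weight pairs indexing the sum are normalized. Reduction. Let $\vec e_k$ denote a standard basis vector. Let $\mathcal{P}$ be the poset on weight pairs, graded by degree, with covering relations $(\sigma,\pi)\prec(\sigma+\vec e_k,\pi+\vec e_l)$ whenever $\sigma_k+\pi_l\geq d$, where $d$ is the degree of $(\sigma,\pi)$. A weight pair of degree $d$ is reduced if $\max_i\sigma_i+\max_j\pi_j\leq d$, equivalently if it is a minimal element of $\mathcal{P}$. The connected component of any weight pair in $\mathcal{P}$ contains a unique minimal element, called its reduction; a weight pair is said to reduce to its reduction. The numbers $A_{\sigma,\pi}(d)$. For a nonzero reduced pair $(\sigma,\pi)$ of degree $d'\leq d$, $A_{\sigma,\pi}(d)$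 denotes the number of normalized degree-$d$ weight pairs that reduce to $(\sigma,\pi)$.
   Formalization: A_{σ,π}(d) counts all degree-d weight pairs with nonzero entries reducing to (σ,π), not only normalized ones (the literal count gives 23, not the true 24, at m=n=2, d=5); the trace formula is stated for d≥1 only, as it fails at d=0, m=n=2 (trace 1, N_0=0). *)

theory Defs
  imports
    "HOL-Library.Poly_Mapping"
    "HOL-Library.Landau_Symbols"
    "HOL-Computational_Algebra.Polynomial"
    "Jordan_Normal_Form.Determinant"
begin

section \<open>Trace of an endomorphism of a finite-dimensional subspace\<close>

text \<open>
  The sum of the diagonal entries of the matrix of \<open>f\<close> in a basis of \<open>V\<close>, where \<open>scale\<close> is the
  scalar multiplication.  It is meaningful when \<open>V\<close> is a finite-dimensional subspace and the linear
  map \<open>f\<close> sends \<open>V\<close> to \<open>V\<close>; the lemma \<open>trace_on_eq\<close> says that the choice of the basis is then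
  immaterial.
\<close>

definition trace_on ::
  "('a::field \<Rightarrow> 'b::ab_group_add \<Rightarrow> 'b) \<Rightarrow> 'b set \<Rightarrow> ('b \<Rightarrow> 'b) \<Rightarrow> 'a" where
  "trace_on scale V f =
     (let B = (SOME B. \<not> module.dependent scale B \<and> module.span scale B = V)
      in \<Sum>b\<in>B. module.representation scale B (f b) b)"

context vector_space
begin

lemma representation_trace_eq:
  assumes f: "module_hom scale scale f" and fV: "f ` V \<subseteq> V"
    and B: "independent B" "span B = V" "finite B"
    and C: "independent C" "span C = V" "finite C"
  shows "(\<Sum>b\<in>B. representation B (f b) b) = (\<Sum>c\<in>C. representation C (f c) c)"
proof -
  interpret f: module_hom scale scale f by (rule f)
  have inV: "b \<in> V" if "b \<in> B" for b using that B(2) span_base by blast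
  have inV': "c \<in> V" if "c \<in> C" for c using that C(2) span_base by blast
  have fb: "f b = (\<Sum>c\<in>C. representation C b c *s f c)" if "b \<in> B" for b
  proof -
    have "b = (\<Sum>c\<in>C. representation C b c *s c)"
      using sum_representation_eq[OF C(1), of b C] inV[OF that] C by auto
    hence "f b = f (\<Sum>c\<in>C. representation C b c *s c)" by simp
    thus ?thesis by (simp add: f.sum f.scale)
  qed
  have fc: "f c = (\<Sum>b\<in>B. representation B (f c) b *s b)" if "c \<in> C" for c
    using sum_representation_eq[OF B(1), of "f c" B] inV'[OF that] fV B by auto
  have "(\<Sum>b\<in>B. representation B (f b) b)
      = (\<Sum>b\<in>B. \<Sum>c\<in>C. representation C b c * representation B (f c) b)"
  proof (rule sum.cong[OF refl])
    fix b assume b: "b \<in> B"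
    have "representation B (f b) = (\<lambda>x. \<Sum>c\<in>C. representation B (representation C b c *s f c) x)"
      unfolding fb[OF b] by (rule representation_sum[OF B(1)])
        (use inV' fV B(2) in \<open>auto intro!: span_scale\<close>)
    moreover have "representation B (representation C b c *s f c) b
        = representation C b c * representation B (f c) b" if "c \<in> C" for c
      using inV'[OF that] fV B(2) by (subst representation_scale[OF B(1)]) auto
    ultimately show "representation B (f b) b
        = (\<Sum>c\<in>C. representation C b c * representation B (f c) b)" by simp
  qed
  also have "\<dots> = (\<Sum>c\<in>C. \<Sum>b\<in>B. representation C b c * representation B (f c) b)"
    by (rule sum.swap)
  also have "\<dots> = (\<Sum>c\<in>C. representation C (f c) c)"
  proof (rule sum.cong[OF refl])
    fix c assume c: "c \<in> C"
    have "representation C (f c) = (\<lambda>x. \<Sum>b\<in>B. representation C (representation B (f c) b *s b) x)"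
      by (subst fc[OF c], rule representation_sum[OF C(1)])
        (use inV C(2) in \<open>auto intro!: span_scale\<close>)
    moreover have "representation C (representation B (f c) b *s b) c
        = representation B (f c) b * representation C b c" if "b \<in> B" for b
      using inV[OF that] C(2) by (subst representation_scale[OF C(1)]) auto
    ultimately show "(\<Sum>b\<in>B. representation C b c * representation B (f c) b)
        = representation C (f c) c" by (simp add: mult.commute)
  qed
  finally show ?thesis .
qed

lemma trace_on_eq:
  assumes f: "module_hom scale scale f" and fV: "f ` V \<subseteq> V"
    and C: "independent C" "span C = V" "finite C"
  shows "trace_on scale V f = (\<Sum>c\<in>C. representation C (f c) c)"
proof -
  define B where "B = (SOME B. independent B \<and> span B = V)"
  have B: "independent B \<and> span B = V"
    unfolding B_def by (rule someI[of _ C]) (use C in auto)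
  have "finite B"
    using independent_span_bound[OF C(3), of B] B C(2) span_superset by blast
  thus ?thesis
    using representation_trace_eq[OF f fV _ _ _ C, of B] B
    by (simp add: trace_on_def B_def)
qed

end

section \<open>The polynomial ring\<close>

text \<open>
  An exponent matrix is a finitely supported function on the positions \<open>(i, j)\<close>; rows and columns
  are numbered from 1.  Polynomials in all the variables \<open>z\<^sub>i\<^sub>j\<close> form one type; the ring
  \<open>R\<^sub>m\<^sub>,\<^sub>n\<close> and its pieces are subspaces.
\<close>

type_synonym expmat = "nat \<times> nat \<Rightarrow>\<^sub>0 nat"
type_synonym zpoly = "expmat \<Rightarrow>\<^sub>0 complex"

definition zmonom :: "expmat \<Rightarrow> zpoly" where
  "zmonom \<alpha> = Poly_Mapping.single \<alpha> 1"

definition zvar :: "nat \<Rightarrow> nat \<Rightarrow> zpoly" where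
  "zvar i j = zmonom (Poly_Mapping.single (i, j) 1)"

definition zscale :: "complex \<Rightarrow> zpoly \<Rightarrow> zpoly" where
  "zscale c f = Poly_Mapping.single 0 c * f"

global_interpretation zpoly: vector_space zscale
  by unfold_locales
    (simp_all add: zscale_def algebra_simps single_add mult_single flip: mult.assoc)

definition expmats :: "nat \<Rightarrow> nat \<Rightarrow> expmat set" where
  "expmats m n = {\<alpha>. Poly_Mapping.keys \<alpha> \<subseteq> {1..m} \<times> {1..n}}"

definition R_deg :: "nat \<Rightarrow> nat \<Rightarrow> nat \<Rightarrow> zpoly set" where
  "R_deg m n d = zpoly.span (zmonom `
     {\<alpha> \<in> expmats m n. (\<Sum>i=1..m. \<Sum>j=1..n. Poly_Mapping.lookup \<alpha> (i, j)) = d})"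

text \<open>List positions start at 0, hence the shift between \<open>\<sigma> ! (i - 1)\<close> and row \<open>i\<close>.\<close>

definition R_weight :: "nat list \<Rightarrow> nat list \<Rightarrow> zpoly set" where
  "R_weight \<sigma> \<pi> = zpoly.span (zmonom `
     {\<alpha> \<in> expmats (length \<sigma>) (length \<pi>).
        (\<forall>i\<in>{1..length \<sigma>}. (\<Sum>j=1..length \<pi>. Poly_Mapping.lookup \<alpha> (i, j)) = \<sigma> ! (i - 1)) \<and>
        (\<forall>j\<in>{1..length \<pi>}. (\<Sum>i=1..length \<sigma>. Poly_Mapping.lookup \<alpha> (i, j)) = \<pi> ! (j - 1))})"

section \<open>The Robinson--Schensted--Knuth correspondence\<close>

text \<open>A tableau is the list of its rows, from top to bottom.\<close>

type_synonym tableau = "nat list list"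

fun row_insert :: "tableau \<Rightarrow> nat \<Rightarrow> tableau" where
  "row_insert [] p = [[p]]"
| "row_insert (r # P) p =
     (if \<forall>x\<in>set r. x \<le> p then (r @ [p]) # P
      else let p' = Min {x \<in> set r. p < x}; k = (LEAST k. k < length r \<and> r ! k = p')
           in r[k := p] # row_insert P p')"

text \<open>
  In \<open>add_box P' Q q\<close> the shape of \<open>P'\<close> is that of \<open>Q\<close> with one box added; the result is \<open>Q\<close> with
  \<open>q\<close> written in that box.
\<close>

fun add_box :: "tableau \<Rightarrow> tableau \<Rightarrow> nat \<Rightarrow> tableau" where
  "add_box [] Q q = Q"
| "add_box (r # P') [] q = [[q]]"
| "add_box (r # P') (s # Q) q =
     (if length s < length r then (s @ [q]) # Q else s # add_box P' Q q)"

fun insert_biletter :: "tableau \<times> tableau \<Rightarrow> nat \<times> nat \<Rightarrow> tableau \<times> tableau" where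
  "insert_biletter (P, Q) (p, q) = (row_insert P p, add_box (row_insert P p) Q q)"

definition biword :: "nat \<Rightarrow> nat \<Rightarrow> expmat \<Rightarrow> (nat \<times> nat) list" where
  "biword m n \<alpha> = concat (map (\<lambda>j. concat (map (\<lambda>i.
     replicate (Poly_Mapping.lookup \<alpha> (i, j)) (i, j)) [1..<m+1])) [1..<n+1])"

definition RSK :: "nat \<Rightarrow> nat \<Rightarrow> expmat \<Rightarrow> tableau \<times> tableau" where
  "RSK m n \<alpha> = foldl insert_biletter ([], []) (biword m n \<alpha>)"

section \<open>The linear operator\<close>

definition zminor :: "nat list \<Rightarrow> nat list \<Rightarrow> zpoly" where
  "zminor rs cs = det (mat (length rs) (length rs) (\<lambda>(a, b). zvar (rs ! a) (cs ! b)))"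

definition tab_column :: "tableau \<Rightarrow> nat \<Rightarrow> nat list" where
  "tab_column T c = map (\<lambda>r. r ! c) (filter (\<lambda>r. c < length r) T)"

definition num_columns :: "tableau \<Rightarrow> nat" where
  "num_columns T = (case T of [] \<Rightarrow> 0 | r # _ \<Rightarrow> length r)"

definition bitableau :: "tableau \<Rightarrow> tableau \<Rightarrow> zpoly" where
  "bitableau P Q = (\<Prod>c<num_columns P. zminor (tab_column P c) (tab_column Q c))"

definition RSK_op :: "nat \<Rightarrow> nat \<Rightarrow> zpoly \<Rightarrow> zpoly" where
  "RSK_op m n f = (\<Sum>\<alpha>\<in>Poly_Mapping.keys f.
     zscale (Poly_Mapping.lookup f \<alpha>) (case RSK m n \<alpha> of (P, Q) \<Rightarrow> bitableau P Q))"

lemma RSK_op_superset: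
  assumes "finite A" "Poly_Mapping.keys f \<subseteq> A"
  shows "RSK_op m n f = (\<Sum>\<alpha>\<in>A.
     zscale (Poly_Mapping.lookup f \<alpha>) (case RSK m n \<alpha> of (P, Q) \<Rightarrow> bitableau P Q))"
  unfolding RSK_op_def using assms
  by (intro sum.mono_neutral_left) (auto simp: in_keys_iff)

lemma RSK_op_zmonom: "RSK_op m n (zmonom \<alpha>) = (case RSK m n \<alpha> of (P, Q) \<Rightarrow> bitableau P Q)"
  by (simp add: RSK_op_def zmonom_def)

lemma lookup_zscale: "Poly_Mapping.lookup (zscale c f) \<alpha> = c * Poly_Mapping.lookup f \<alpha>"
proof -
  have "zscale c f = Poly_Mapping.map ((*) c) f"
    by (simp add: zscale_def mult_map_scale_conv_mult)
  thus ?thesis by (simp add: map.rep_eq when_def)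
qed

lemma RSK_op_linear: "module_hom zscale zscale (RSK_op m n)"
proof
  fix f g :: zpoly
  let ?A = "Poly_Mapping.keys f \<union> Poly_Mapping.keys g"
  have "Poly_Mapping.keys (f + g) \<subseteq> ?A" by (rule keys_add)
  thus "RSK_op m n (f + g) = RSK_op m n f + RSK_op m n g"
    by (subst (1 2 3) RSK_op_superset[of ?A])
      (auto simp: lookup_add zpoly.scale_left_distrib sum.distrib)
next
  fix c and f :: zpoly
  have "Poly_Mapping.keys (zscale c f) \<subseteq> Poly_Mapping.keys f"
    by (auto simp: in_keys_iff lookup_zscale)
  thus "RSK_op m n (zscale c f) = zscale c (RSK_op m n f)"
    by (subst (1 2) RSK_op_superset[of "Poly_Mapping.keys f"])
      (auto simp: lookup_zscale zpoly.scale_sum_right)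
qed

definition Tr_RSK :: "nat \<Rightarrow> nat \<Rightarrow> nat \<Rightarrow> complex" where
  "Tr_RSK m n d = trace_on zscale (R_deg m n d) (RSK_op m n)"

definition Tr_RSK_weight :: "nat list \<Rightarrow> nat list \<Rightarrow> complex" where
  "Tr_RSK_weight \<sigma> \<pi> = trace_on zscale (R_weight \<sigma> \<pi>) (RSK_op (length \<sigma>) (length \<pi>))"

section \<open>Weight pairs and their reduction\<close>

type_synonym wpair = "nat list \<times> nat list"

definition weight_pair :: "nat \<Rightarrow> wpair \<Rightarrow> bool" where
  "weight_pair d = (\<lambda>(\<sigma>, \<pi>). sum_list \<sigma> = d \<and> sum_list \<pi> = d)"

definition nonzero_entries :: "wpair \<Rightarrow> bool" where
  "nonzero_entries = (\<lambda>(\<sigma>, \<pi>). 0 \<notin> set \<sigma> \<and> 0 \<notin> set \<pi>)"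

definition normalized :: "wpair \<Rightarrow> bool" where
  "normalized = (\<lambda>(\<sigma>, \<pi>). nonzero_entries (\<sigma>, \<pi>) \<and> length \<sigma> \<le> length \<pi> \<and>
     (length \<sigma> = length \<pi> \<longrightarrow>
        \<sigma> = \<pi> \<or> (\<exists>i<length \<sigma>. \<sigma> ! i > \<pi> ! i \<and> (\<forall>j<i. \<sigma> ! j = \<pi> ! j))))"

definition wp_covers :: "wpair \<Rightarrow> wpair \<Rightarrow> bool" where
  "wp_covers = (\<lambda>(\<sigma>, \<pi>) (\<sigma>', \<pi>'). \<exists>d k l. weight_pair d (\<sigma>, \<pi>) \<and>
     k < length \<sigma> \<and> l < length \<pi> \<and> \<sigma> ! k + \<pi> ! l \<ge> d \<and>
     \<sigma>' = \<sigma>[k := \<sigma> ! k + 1] \<and> \<pi>' = \<pi>[l := \<pi> ! l + 1])"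

definition wp_le :: "wpair \<Rightarrow> wpair \<Rightarrow> bool" where
  "wp_le = wp_covers\<^sup>*\<^sup>*"

definition reduces_to :: "wpair \<Rightarrow> wpair \<Rightarrow> bool" where
  "reduces_to v w \<longleftrightarrow> equivclp wp_covers v w \<and> (\<forall>u. wp_le u w \<longrightarrow> u = w)"

text \<open>Used only in degree \<open>d > 0\<close>, where both lists are nonempty and the maxima are proper.\<close>

definition reduced :: "nat \<Rightarrow> wpair \<Rightarrow> bool" where
  "reduced d = (\<lambda>(\<sigma>, \<pi>). weight_pair d (\<sigma>, \<pi>) \<and> Max (set \<sigma>) + Max (set \<pi>) \<le> d)"

definition reduced_index :: "nat \<Rightarrow> wpair set" where
  "reduced_index d = {w. normalized w \<and> (\<exists>d'. 0 < d' \<and> d' \<le> d \<and> reduced d' w)}"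

text \<open>
  All pairs with nonzero entries are counted, not only those for which in addition \<open>\<sigma>\<close> and \<open>\<pi>\<close> are
  in the order required by \<^const>\<open>normalized\<close>.  That order is not compatible with reduction: both
  \<open>((3,2),(2,3))\<close> and \<open>((2,3),(3,2))\<close> reduce to \<open>((2,2),(2,2))\<close>.  Counting only the normalized one
  would make the trace formula fail, for example for \<open>m = n = 2\<close>, \<open>d = 5\<close> (23 instead of 24).
\<close>

definition A_num :: "wpair \<Rightarrow> nat \<Rightarrow> nat" where
  "A_num w d = card {v. weight_pair d v \<and> nonzero_entries v \<and> reduces_to v w}"

definition N_num :: "wpair \<Rightarrow> nat \<Rightarrow> nat \<Rightarrow> nat \<Rightarrow> nat" where
  "N_num = (\<lambda>(\<sigma>, \<pi>) m n d.
     if \<sigma> \<noteq> \<pi>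
     then A_num (\<sigma>, \<pi>) d *
       ((m choose length \<sigma>) * (n choose length \<pi>) + (m choose length \<pi>) * (n choose length \<sigma>))
     else A_num (\<sigma>, \<pi>) d * ((m choose length \<sigma>) * (n choose length \<pi>)))"

definition N_zero :: "nat \<Rightarrow> nat \<Rightarrow> nat \<Rightarrow> int" where
  "N_zero m n d = int (((d + n - 1) choose d) * m) + int (((d + m - 1) choose d) * n) - int (m * n)"

section \<open>Polynomials in \<open>m\<close> and \<open>n\<close>\<close>

text \<open>\<open>coeff (coeff p i) j\<close> is the coefficient of \<open>m\<^sup>i n\<^sup>j\<close>.\<close>

definition eval2 :: "complex poly poly \<Rightarrow> nat \<Rightarrow> nat \<Rightarrow> complex" where
  "eval2 p m n = poly (poly p [:of_nat m:]) (of_nat n)"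

text \<open>The lead term is the unique term of largest total degree.\<close>

definition lead_term :: "complex poly poly \<Rightarrow> complex \<Rightarrow> nat \<Rightarrow> nat \<Rightarrow> bool" where
  "lead_term p c i j \<longleftrightarrow> c \<noteq> 0 \<and> coeff (coeff p i) j = c \<and>
     (\<forall>i' j'. coeff (coeff p i') j' \<noteq> 0 \<and> (i', j') \<noteq> (i, j) \<longrightarrow> i' + j' < i + j)"

end

theory Submission
  imports Defs "HOL-Library.Confluence"
begin

text \<open>
  Row \<open>r\<close> of \<open>P\<close> has \<open>lpp (bump\<^sup>r \<alpha>) i n\<close> entries \<open>\<le> i\<close>, and row \<open>r\<close> of \<open>Q\<close> has
  \<open>lpp (bump\<^sup>r \<alpha>) m j\<close> entries \<open>\<le> j\<close>, where \<open>lpp b i j\<close> is the last passage time of the matrix \<open>b\<close>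
  and \<open>bump b\<close> is the matrix of letters bumped into the next row: inserting a
  weakly increasing word with \<open>b i\<close> letters \<open>i\<close> into a row with \<open>F i\<close> entries \<open>\<le> i\<close> gives a row with
  \<open>F' i = max (F i) (F' (i - 1)) + b i\<close>.  This recursion is invariant under transposition, hence so
  is the correspondence, and traces are unchanged when \<open>\<sigma>\<close> and \<open>\<pi>\<close> are exchanged or zeros are
  deleted.

  If the entry of \<open>\<alpha>\<close> at \<open>(k, l)\<close> is at least the sum of the entries outside row \<open>k\<close> and column
  \<open>l\<close>, increasing it by 1 increases the passage times to the positions weakly below and to the right
  of \<open>(k, l)\<close> by 1 and leaves \<open>bump\<close> unchanged.  The bitableau is then multiplied by \<open>z\<^sub>k\<^sub>l\<close>, so the
  trace is constant along the covering relations of the poset.  Downward covering steps have the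
  diamond property, which makes reductions unique.  Grouping the weight pairs by their nonzero
  entries and then by their reduction gives the formula; the pairs that reduce to degree 0 are those
  with a single part on one side, they have trace 1 and contribute \<open>N\<^sub>0\<close>.
\<close>

section \<open>Row insertion\<close>

text \<open>A row of a tableau enters the proof only through its numbers \<open>cnt\<close> of
  entries at most i, which determine a sorted list. In these numbers insertion becomes a max-plus
  recursion in which the rows and columns of the matrix have equal standing, and this makes the
  symmetry visible. The recording tableau is brought to the same form by reading its counts as row
  lengths of insertion tableaux of prefixes. The algebraic obstacle is that a unit added to the
  matrix must multiply the whole bitableau by one variable. For this the new letters of P and Q must
  share a column, and that column must have length 1; the covering condition of the poset leaves
  room for such a column. Reduction does not respect the order of normalized pairs. It is therefore
  carried out on pairs in both orders, and the sum is folded to normalized pairs only at the end.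
  The polynomial, its lead term and the growth bound come from the sum over pairs of compositions,
  before any reduction.\<close>

definition cnt :: "nat list \<Rightarrow> nat \<Rightarrow> nat" where
  "cnt xs i = length (filter (\<lambda>x. x \<le> i) xs)"

lemma cnt_simps [simp]:
  "cnt [] i = 0"
  "cnt (x # xs) i = (if x \<le> i then 1 else 0) + cnt xs i"
  "cnt (xs @ ys) i = cnt xs i + cnt ys i"
  by (simp_all add: cnt_def)

lemma cnt_mono: "i \<le> j \<Longrightarrow> cnt xs i \<le> cnt xs j"
  by (induction xs) auto

lemma cnt_le_length: "cnt xs i \<le> length xs"
  by (simp add: cnt_def)

lemma cnt_all: "\<forall>x\<in>set xs. x \<le> i \<Longrightarrow> cnt xs i = length xs"
  by (induction xs) auto

lemma cnt_none: "\<forall>x\<in>set xs. i < x \<Longrightarrow> cnt xs i = 0"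
  by (induction xs) auto

lemma cnt_Suc: "cnt xs (Suc i) = cnt xs i + count_list xs (Suc i)"
  by (induction xs) auto

lemma cnt_0: "0 \<notin> set xs \<Longrightarrow> cnt xs 0 = 0"
  by (induction xs) auto

text \<open>Differences of consecutive counts are multiplicities, and a sorted list is determined by
  its multiset. Equality of tableau rows is always proved this way below.\<close>

lemma sorted_eq_of_cnt:
  assumes "sorted xs" "sorted ys" "\<And>i. cnt xs i = cnt ys i"
  shows "xs = ys"
proof -
  have "count (mset xs) i = count (mset ys) i" for i
  proof (cases i)
    case 0
    have "count_list zs 0 = cnt zs 0" for zs by (induction zs) auto
    thus ?thesis using assms(3)[of 0] by (simp add: count_mset 0)
  next
    case (Suc k)
    thus ?thesis using assms(3)[of k] assms(3)[of i] by (simp add: count_mset cnt_Suc)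
  qed
  hence "mset xs = mset ys" by (rule multiset_eqI)
  thus ?thesis using assms by (metis properties_for_sort)
qed

text \<open>The bumped letter is returned as a list of length at most 1, so that the outputs of
  successive insertions concatenate to the word that enters the next row.\<close>

definition row_bump :: "nat list \<Rightarrow> nat \<Rightarrow> nat list \<times> nat list" where
  "row_bump r p =
     (if \<forall>x\<in>set r. x \<le> p then (r @ [p], [])
      else let p' = Min {x \<in> set r. p < x}; k = (LEAST k. k < length r \<and> r ! k = p')
           in (r[k := p], [p']))"

text \<open>In a sorted row the leftmost smallest entry above p separates the entries at most p from
  those at least p'. This trades \<open>Min\<close> and \<open>LEAST\<close> for a splitting of the
  list.\<close>

lemma row_bump_cases:
  assumes "sorted r"
  obtains (append) "\<forall>x\<in>set r. x \<le> p" "row_bump r p = (r @ [p], [])"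
  | (replace) xs p' ys where "r = xs @ p' # ys" "\<forall>x\<in>set xs. x \<le> p" "p < p'"
      "\<forall>y\<in>set ys. p' \<le> y" "row_bump r p = (xs @ p # ys, [p'])"
proof (cases "\<forall>x\<in>set r. x \<le> p")
  case True
  thus ?thesis using append by (simp add: row_bump_def)
next
  case False
  define S where "S = {x \<in> set r. p < x}"
  define p' where "p' = Min S"
  define k where "k = (LEAST k. k < length r \<and> r ! k = p')"
  have S: "finite S" "S \<noteq> {}" using False by (auto simp: S_def not_le)
  hence p': "p' \<in> S" unfolding p'_def by (rule Min_in)
  hence "\<exists>k. k < length r \<and> r ! k = p'" by (auto simp: S_def in_set_conv_nth)
  hence k: "k < length r" "r ! k = p'" unfolding k_def
    by (rule LeastI2_ex, blast)+
  have before: "x \<le> p" if x: "x \<in> set (take k r)" for x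
  proof (rule ccontr)
    assume "\<not> x \<le> p"
    obtain j where j: "j < k" "x = r ! j" using x k by (auto simp: in_set_conv_nth)
    have "x \<in> S" using \<open>\<not> x \<le> p\<close> j k by (auto simp: S_def)
    hence "p' \<le> x" using S by (simp add: p'_def)
    moreover have "x \<le> p'" using assms j k by (auto intro: sorted_nth_mono)
    ultimately have "j < length r \<and> r ! j = p'" using j k by auto
    hence "k \<le> j" unfolding k_def by (rule Least_le)
    thus False using j by simp
  qed
  have after: "p' \<le> y" if y: "y \<in> set (drop (Suc k) r)" for y
  proof -
    obtain j where "j < length r - Suc k" "y = r ! (Suc k + j)"
      using y by (auto simp: in_set_conv_nth)
    thus ?thesis using assms k by (auto intro: sorted_nth_mono)
  qed
  have "r = take k r @ p' # drop (Suc k) r" using k id_take_nth_drop by blast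
  moreover have "row_bump r p = (take k r @ p # drop (Suc k) r, [p'])"
    using False k upd_conv_take_nth_drop[of k r p]
    by (auto simp: row_bump_def Let_def S_def[symmetric] p'_def[symmetric] k_def[symmetric])
  ultimately show ?thesis using replace before after p' by (auto simp: S_def)
qed

lemma sorted_row_bump:
  assumes "sorted r"
  shows "sorted (fst (row_bump r p))"
  using assms
proof (cases rule: row_bump_cases[where p = p])
  case append
  thus ?thesis using assms by (auto simp: sorted_append)
next
  case (replace xs p' ys)
  thus ?thesis using assms by (fastforce simp: sorted_append)
qed

lemma mset_row_bump:
  "sorted r \<Longrightarrow> mset (fst (row_bump r p)) + mset (snd (row_bump r p)) = add_mset p (mset r)"
  by (erule row_bump_cases[where p = p]) auto

text \<open>No entry lies strictly between p and the bumped p', so for i from p to below p' the old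
  count is \<open>cnt r p\<close> and grows by 1. From p' on the old count is at least
  \<open>cnt r p + 1\<close>, and replacing p' by p leaves it unchanged.\<close>

lemma cnt_row_bump:
  assumes "sorted r"
  shows "cnt (fst (row_bump r p)) i = (if i < p then cnt r i else max (cnt r i) (cnt r p + 1))"
  using assms
proof (cases rule: row_bump_cases[where p = p])
  case append
  have "cnt r i = length r" if "p \<le> i" using append that by (auto intro!: cnt_all)
  thus ?thesis using append cnt_all[of r p] by auto
next
  case (replace xs p' ys)
  have "cnt ys p = 0" "i < p' \<Longrightarrow> cnt ys i = 0" using replace by (auto intro!: cnt_none)
  moreover have "cnt xs p = length xs" "p \<le> i \<Longrightarrow> cnt xs i = length xs"
    using replace by (auto intro!: cnt_all)
  ultimately show ?thesis using replace by auto
qed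

text \<open>In terms of counts, the bumped letter is the next entry after p: some entry lies above p
  and at most z, and none lies above p and below z.\<close>

lemma row_bump_out:
  assumes "sorted r" "z \<in> set (snd (row_bump r p))"
  shows "cnt r p < cnt r z" "i < z \<Longrightarrow> cnt r i \<le> cnt r p"
proof -
  have "cnt r p < cnt r z \<and> (i < z \<longrightarrow> cnt r i \<le> cnt r p)"
    using assms(1)
  proof (cases rule: row_bump_cases[where p = p])
    case append
    thus ?thesis using assms by auto
  next
    case (replace xs p' ys)
    hence [simp]: "z = p'" using assms by auto
    have "cnt ys p = 0" "i < p' \<Longrightarrow> cnt ys i = 0" using replace by (auto intro!: cnt_none)
    moreover have "cnt xs p = length xs" "cnt xs p' = length xs" "cnt xs i \<le> length xs"
      using replace by (auto intro!: cnt_all cnt_le_length)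
    ultimately show ?thesis using replace by auto
  qed
  thus "cnt r p < cnt r z" "i < z \<Longrightarrow> cnt r i \<le> cnt r p" by auto
qed

lemma length_snd_row_bump: "length (snd (row_bump r p)) \<le> 1"
  by (simp add: row_bump_def Let_def)

section \<open>Inserting a whole word into one row\<close>

definition row_after :: "nat list \<Rightarrow> nat list \<Rightarrow> nat list" where
  "row_after = foldl (\<lambda>r p. fst (row_bump r p))"

fun row_out :: "nat list \<Rightarrow> nat list \<Rightarrow> nat list" where
  "row_out r [] = []"
| "row_out r (p # u) = snd (row_bump r p) @ row_out (fst (row_bump r p)) u"

lemma row_after_simps [simp]:
  "row_after r [] = r"
  "row_after r (p # u) = row_after (fst (row_bump r p)) u"
  "row_after r (u @ v) = row_after (row_after r u) v"
  by (simp_all add: row_after_def)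

lemma row_out_append [simp]: "row_out r (u @ v) = row_out r u @ row_out (row_after r u) v"
  by (induction u arbitrary: r) auto

lemma sorted_row_after: "sorted r \<Longrightarrow> sorted (row_after r u)"
  by (induction u arbitrary: r) (auto simp: sorted_row_bump)

lemma mset_row_after:
  "sorted r \<Longrightarrow> mset (row_after r u) + mset (row_out r u) = mset r + mset u"
proof (induction u arbitrary: r)
  case (Cons p u)
  thus ?case using Cons.IH[OF sorted_row_bump[OF Cons.prems, of p]] mset_row_bump[OF Cons.prems, of p]
    by (simp add: ac_simps)
qed auto

section \<open>Tableaux as sequences of rows\<close>

definition trow :: "'a list list \<Rightarrow> nat \<Rightarrow> 'a list" where
  "trow T r = (if r < length T then T ! r else [])"

lemma trow_simps [simp]: "trow [] r = []" "trow (x # T) 0 = x" "trow (x # T) (Suc r) = trow T r"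
  by (auto simp: trow_def)

text \<open>Trailing empty rows are invisible to \<open>trow\<close>, whence the nonemptiness
  hypotheses.\<close>

lemma trow_eqI:
  assumes "[] \<notin> set S" "[] \<notin> set T" "\<And>r. trow S r = trow T r"
  shows "S = T"
  using assms
proof (induction S arbitrary: T)
  case Nil
  show ?case using Nil(2) Nil(3)[of 0] by (cases T) auto
next
  case (Cons x S)
  show ?case
  proof (cases T)
    case Nil
    thus ?thesis using Cons.prems(1) Cons.prems(3)[of 0] by auto
  next
    case (Cons y T')
    show ?thesis using Cons.IH[of T'] Cons.prems Cons.prems(3)[of 0] Cons.prems(3)[of "Suc r" for r]
      by (auto simp: Cons)
  qed
qed

lemma row_insert_Cons:
  "row_insert (r # P) p = (case row_bump r p of (r', v) \<Rightarrow> r' # foldl row_insert P v)"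
  by (simp add: row_bump_def Let_def)

text \<open>The lower rows depend only on the sequence of letters bumped from the first row. A
  tableau can thus be computed row by row instead of letter by letter, which makes induction over
  rows possible.\<close>

lemma foldl_row_insert_Cons:
  "foldl row_insert (r # P) u = row_after r u # foldl row_insert P (row_out r u)"
  by (induction u arbitrary: r P) (auto simp: row_insert_Cons split: prod.splits simp del: row_insert.simps(2))

lemma trow_foldl_row_insert:
  "trow (foldl row_insert [] u) 0 = row_after [] u"
  "trow (foldl row_insert [] u) (Suc r) = trow (foldl row_insert [] (row_out [] u)) r"
proof -
  \<comment> \<open>The first letter creates the first row, just as if an empty row had been
    present.\<close>
  have *: "foldl row_insert [] u = foldl row_insert [[]] u" if "u \<noteq> []"
    using that by (cases u) auto
  show "trow (foldl row_insert [] u) 0 = row_after [] u"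
    "trow (foldl row_insert [] u) (Suc r) = trow (foldl row_insert [] (row_out [] u)) r"
    using * by (cases "u = []"; simp add: foldl_row_insert_Cons)+
qed

section \<open>Last passage percolation\<close>

text \<open>Last passage time: the maximal sum of entries along a path from (1, 1) to (i, j) with
  steps down and to the right. Index 0 is the boundary.\<close>

fun lpp :: "(nat \<Rightarrow> nat \<Rightarrow> nat) \<Rightarrow> nat \<Rightarrow> nat \<Rightarrow> nat" where
  "lpp b 0 j = 0"
| "lpp b (Suc i) 0 = 0"
| "lpp b (Suc i) (Suc j) = max (lpp b i (Suc j)) (lpp b (Suc i) j) + b (Suc i) (Suc j)"

text \<open>Number of letters i bumped from the first row while column j is inserted, written with
  passage times only, so that the symmetry in i and j is apparent;
  \<open>row_out_column_words\<close> justifies the formula.\<close>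

fun bump :: "(nat \<Rightarrow> nat \<Rightarrow> nat) \<Rightarrow> nat \<Rightarrow> nat \<Rightarrow> nat" where
  "bump b (Suc i) (Suc j) = min (lpp b i (Suc j)) (lpp b (Suc i) j) - lpp b i j"
| "bump b i j = 0"

lemma lpp_0 [simp]: "lpp b i 0 = 0"
  by (cases i) auto

lemma lpp_mono1: "lpp b i j \<le> lpp b (Suc i) j"
  by (cases j) auto

lemma lpp_mono2: "lpp b i j \<le> lpp b i (Suc j)"
  by (cases i) auto

lemma lpp_mono: "i \<le> i' \<Longrightarrow> j \<le> j' \<Longrightarrow> lpp b i j \<le> lpp b i' j'"
  by (meson lift_Suc_mono_le lpp_mono1 lpp_mono2 order_trans)

lemma lpp_transpose: "lpp (\<lambda>i j. b j i) j i = lpp b i j"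
proof -
  define c where "c = (\<lambda>i j. b j i)"
  have c: "c j i = b i j" for i j by (simp add: c_def)
  have "lpp c j i = lpp b i j"
  proof (induction "i + j" arbitrary: i j rule: less_induct)
    case less
    show ?case
      using less[of "i - 1" j] less[of i "j - 1"] by (cases i; cases j) (auto simp: c max.commute)
  qed
  thus ?thesis by (simp only: c_def)
qed

lemma bump_transpose: "bump (\<lambda>i j. b j i) j i = bump b i j"
proof (cases i; cases j)
  fix i' j' assume ij: "i = Suc i'" "j = Suc j'"
  show ?thesis unfolding ij bump.simps lpp_transpose[of b] by (rule arg_cong2[of _ _ _ _ "(-)"]) auto
qed auto

lemma bump_pow_transpose: "(bump ^^ r) (\<lambda>i j. b j i) = (\<lambda>i j. (bump ^^ r) b j i)"
proof (induction r)
  case (Suc r)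
  show ?case unfolding funpow.simps o_apply Suc.IH
    by (intro ext) (rule bump_transpose)
qed auto

text \<open>By induction both neighbouring passage times of \<open>bump b\<close> are at most
  \<open>lpp b i j\<close>, and the entry of \<open>bump b\<close> is precisely the difference from
  there to the minimum. It is used to see that the first row of a tableau is the longest.\<close>

lemma lpp_bump_le: "lpp (bump b) (Suc i) (Suc j) \<le> min (lpp b i (Suc j)) (lpp b (Suc i) j)"
proof (induction "i + j" arbitrary: i j rule: less_induct)
  case less
  have 1: "lpp (bump b) i (Suc j) \<le> lpp b i j"
    using less[of "i - 1" j] by (cases i) auto
  have 2: "lpp (bump b) (Suc i) j \<le> lpp b i j"
    using less[of i "j - 1"] by (cases j) auto
  show ?case using 1 2 lpp_mono1[of b i j] lpp_mono2[of b i j] by (simp; linarith)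
qed

lemma lpp_bump_le_lpp: "lpp (bump b) i j \<le> lpp b i j"
  using lpp_bump_le[of b "i - 1" "j - 1"] lpp_mono1[of b "i - 1" j]
  by (cases i; cases j) auto

text \<open>Induction on the last letter p, the largest of the word. For i + 1 below p nothing
  changes, for i + 1 = p both sides grow by 1, and beyond p the letter i + 1 does not occur in the
  word, so that \<open>cnt_row_bump\<close> gives the maximum.\<close>

lemma row_after_sorted_word:
  assumes "sorted r" "sorted u" "0 \<notin> set r" "0 \<notin> set u"
  shows "cnt (row_after r u) (Suc i)
    = max (cnt r (Suc i)) (cnt (row_after r u) i) + count_list u (Suc i)"
  using assms(2,4)
proof (induction u arbitrary: i rule: rev_induct)
  case Nil
  thus ?case using cnt_mono[of i "Suc i" r] by simp
next
  case (snoc p u)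
  let ?s = "row_after r u"
  have s: "sorted ?s" using assms by (intro sorted_row_after)
  have IH: "cnt ?s (Suc i) = max (cnt r (Suc i)) (cnt ?s i) + count_list u (Suc i)"
    using snoc by (auto simp: sorted_append)
  have le: "x \<le> p" if "x \<in> set u" for x using snoc.prems that by (auto simp: sorted_append)
  have 0: "count_list u (Suc i) = 0" if "Suc i > p"
    using le[of "Suc i"] that by (auto simp: count_list_0_iff)
  consider "Suc i < p" | "Suc i = p" | "p < Suc i" by linarith
  thus ?case
  proof cases
    case 1 thus ?thesis using IH by (simp add: cnt_row_bump[OF s])
  next
    case 2 thus ?thesis using IH cnt_mono[of i "Suc i" ?s] by (simp add: cnt_row_bump[OF s])
  next
    case 3 thus ?thesis using IH 0 by (simp add: cnt_row_bump[OF s])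
  qed
qed

text \<open>The induction carries an invariant: for every letter z bumped so far, the current row
  has no entry strictly between the last inserted letter and z. The next letter p is no smaller than
  the last one, so what it bumps is at least z.\<close>

lemma sorted_row_out:
  assumes "sorted r" "sorted u"
  shows "sorted (row_out r u)"
proof -
  have "sorted (row_out r u) \<and>
    (\<forall>z\<in>set (row_out r u). u \<noteq> [] \<and> (\<forall>i<z. cnt (row_after r u) i \<le> cnt (row_after r u) (last u)))"
    using assms(2)
  proof (induction u rule: rev_induct)
    case (snoc p u)
    let ?s = "row_after r u"
    have s: "sorted ?s" using assms by (intro sorted_row_after)
    have IH: "sorted (row_out r u)"
      "\<And>z i. z \<in> set (row_out r u) \<Longrightarrow> i < z \<Longrightarrow> cnt ?s i \<le> cnt ?s (last u)"
      "row_out r u \<noteq> [] \<Longrightarrow> u \<noteq> []"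
      using snoc by (auto simp: sorted_append)
    have lastp: "cnt ?s (last u) \<le> cnt ?s p" if "row_out r u \<noteq> []"
      using that IH(3) snoc.prems by (intro cnt_mono) (auto simp: sorted_append)
    have old: "cnt ?s i \<le> cnt ?s p" if "z \<in> set (row_out r u)" "i < z" for z i
      using IH(2)[OF that] lastp that by fastforce
    have new: "cnt ?s i \<le> cnt ?s p" "cnt ?s p < cnt ?s z" if "z \<in> set (snd (row_bump ?s p))" "i < z" for z i
      using row_bump_out[OF s that(1)] that by auto
    have "z \<le> z'" if "z \<in> set (row_out r u)" "z' \<in> set (snd (row_bump ?s p))" for z z'
      using old[OF that(1), of z'] row_bump_out(1)[OF s that(2)] by (meson leD leI)
    moreover have "sorted (snd (row_bump ?s p))"
      using length_snd_row_bump[of ?s p] by (cases "snd (row_bump ?s p)") auto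
    ultimately have "sorted (row_out r (u @ [p]))" using IH by (auto simp: sorted_append)
    moreover have "cnt (fst (row_bump ?s p)) i \<le> cnt (fst (row_bump ?s p)) p" if "cnt ?s i \<le> cnt ?s p" for i
      using that by (auto simp: cnt_row_bump[OF s])
    ultimately show ?case using old new(1) by auto
  qed auto
  thus ?thesis by simp
qed

text \<open>An abstraction of the columns of a matrix: the words bumped into the next row satisfy it
  again, with \<open>bump b\<close> in place of \<open>b\<close>.\<close>

definition column_words :: "(nat \<Rightarrow> nat list) \<Rightarrow> (nat \<Rightarrow> nat \<Rightarrow> nat) \<Rightarrow> nat \<Rightarrow> bool" where
  "column_words w b n \<longleftrightarrow> (\<forall>j\<in>{1..n}. sorted (w j) \<and> 0 \<notin> set (w j) \<and>
     (\<forall>i. count_list (w j) (Suc i) = b (Suc i) j))"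

definition word_upto :: "(nat \<Rightarrow> nat list) \<Rightarrow> nat \<Rightarrow> nat list" where
  "word_upto w n = concat (map w [1..<n+1])"

lemma word_upto_simps [simp]: "word_upto w 0 = []" "word_upto w (Suc n) = word_upto w n @ w (Suc n)"
  by (simp_all add: word_upto_def)

lemma set_row: "sorted r \<Longrightarrow> set (row_after r u) \<union> set (row_out r u) = set r \<union> set u"
  using mset_row_after[of r u] by (metis set_mset_mset set_mset_union)

text \<open>With n columns inserted, the old count in \<open>row_after_sorted_word\<close> is the
  passage time to the left neighbour and the new count at i the one to the upper neighbour, so its
  recursion is that of \<open>lpp\<close>.\<close>

lemma row_after_column_words:
  assumes "column_words w b n"
  shows "cnt (row_after [] (word_upto w n)) i = lpp b i n"
  using assms
proof (induction n arbitrary: i)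
  case 0
  show ?case by simp
next
  case (Suc n)
  let ?s = "row_after [] (word_upto w n)"
  have prev: "column_words w b n" using Suc.prems by (auto simp: column_words_def)
  have IH: "cnt ?s i = lpp b i n" for i using Suc.IH[OF prev] .
  have "0 \<notin> set (word_upto w n)" using prev by (auto simp: column_words_def word_upto_def)
  hence s: "sorted ?s" "0 \<notin> set ?s"
    using sorted_row_after[of "[]"] set_row[of "[]" "word_upto w n"] by auto
  have w: "sorted (w (Suc n))" "0 \<notin> set (w (Suc n))" "\<And>i. count_list (w (Suc n)) (Suc i) = b (Suc i) (Suc n)"
    using Suc.prems by (auto simp: column_words_def)
  show ?case
  proof (induction i)
    case 0
    have "0 \<notin> set (row_after ?s (w (Suc n)))" using s w set_row[of ?s "w (Suc n)"] by auto
    thus ?case by (simp add: cnt_0)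
  next
    case (Suc i)
    thus ?case using row_after_sorted_word[OF s(1) w(1) s(2) w(2), of i] w(3)
      by (simp add: IH max.commute)
  qed
qed

text \<open>Letters are conserved: those bumped in column j are the ones present before it, plus the
  new ones, minus the ones present after it. Insertion of the passage times and
  \<open>max + min = sum\<close> give \<open>bump\<close>.\<close>

lemma row_out_column_words:
  assumes "column_words w b n"
  obtains w' where "column_words w' (bump b) n" "row_out [] (word_upto w n) = word_upto w' n"
proof -
  define w' where "w' j = row_out (row_after [] (word_upto w (j - 1))) (w j)" for j
  have "row_out [] (word_upto w k) = word_upto w' k" for k
    by (induction k) (auto simp: w'_def)
  moreover have "column_words w' (bump b) n"
    unfolding column_words_def
  proof safe
    fix j assume "j \<in> {1..n}"
    then obtain k where j: "j = Suc k" "k < n" by (cases j) auto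
    let ?s = "row_after [] (word_upto w k)" and ?s' = "row_after [] (word_upto w (Suc k))"
    have c: "column_words w b k" "column_words w b (Suc k)" using assms j by (auto simp: column_words_def)
    have s: "sorted ?s" using sorted_row_after[of "[]"] by auto
    have 0: "0 \<notin> set (word_upto w k)" using c by (auto simp: column_words_def word_upto_def)
    have w: "sorted (w j)" "0 \<notin> set (w j)" "\<And>i. count_list (w j) (Suc i) = b (Suc i) j"
      using c by (auto simp: column_words_def j)
    show "sorted (w' j)" using sorted_row_out[OF s w(1)] by (simp add: w'_def j)
    show False if "0 \<in> set (w' j)"
      using that set_row[OF s, of "w j"] set_row[of "[]" "word_upto w k"] 0 w(2)
      by (auto simp: w'_def j)
    fix i
    have "mset ?s' + mset (w' j) = mset ?s + mset (w j)"
      using mset_row_after[OF s, of "w j"] by (simp add: w'_def j)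
    hence "count_list ?s' (Suc i) + count_list (w' j) (Suc i)
        = count_list ?s (Suc i) + count_list (w j) (Suc i)"
      by (metis count_mset count_union)
    moreover have "cnt ?s' x = lpp b x (Suc k)" "cnt ?s x = lpp b x k" for x
      using row_after_column_words[OF c(2)] row_after_column_words[OF c(1)] by auto
    ultimately show "count_list (w' j) (Suc i) = bump b (Suc i) j"
      using cnt_Suc[of ?s i] cnt_Suc[of ?s' i] w(3)[of i] lpp_mono1[of b i k] lpp_mono2[of b i k]
      by (auto simp: j)
  qed
  ultimately show ?thesis using that by blast
qed

lemma insertion_counts:
  assumes "column_words w b n"
  shows "cnt (trow (foldl row_insert [] (word_upto w n)) r) i = lpp ((bump ^^ r) b) i n"
  using assms
proof (induction r arbitrary: w b)
  case 0
  thus ?case using row_after_column_words by (simp add: trow_foldl_row_insert)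
next
  case (Suc r)
  obtain w' where w': "column_words w' (bump b) n" "row_out [] (word_upto w n) = word_upto w' n"
    using row_out_column_words[OF Suc.prems] .
  show ?case using Suc.IH[OF w'(1)] by (simp add: trow_foldl_row_insert w'(2) funpow_swap1)
qed

section \<open>The recording tableau\<close>

lemma row_insert_rows:
  assumes "\<forall>r\<in>set P. sorted r" "[] \<notin> set P"
  shows "(\<forall>r\<in>set (row_insert P p). sorted r) \<and> [] \<notin> set (row_insert P p) \<and>
    mset (concat (row_insert P p)) = add_mset p (mset (concat P))"
  using assms
proof (induction P arbitrary: p)
  case (Cons r P)
  have r: "sorted r" using Cons.prems by simp
  thus ?case
  proof (cases rule: row_bump_cases[where p = p])
    case append
    thus ?thesis using Cons.prems by (auto simp: row_insert_Cons sorted_append simp del: row_insert.simps(2))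
  next
    case (replace xs p' ys)
    have "row_insert (r # P) p = (xs @ p # ys) # row_insert P p'"
      using replace by (simp add: row_insert_Cons del: row_insert.simps(2))
    thus ?thesis using Cons.IH[of p'] Cons.prems sorted_row_bump[OF r, of p] replace by auto
  qed
qed auto

lemma insertion_tableau_rows:
  "(\<forall>r\<in>set (foldl row_insert [] u). sorted r) \<and> [] \<notin> set (foldl row_insert [] u) \<and>
    mset (concat (foldl row_insert [] u)) = mset u"
  by (induction u rule: rev_induct) (auto simp: row_insert_rows)

lemma foldl_insert_biletter_fst:
  "fst (foldl insert_biletter S bw) = foldl row_insert (fst S) (map fst bw)"
proof (induction bw arbitrary: S)
  case (Cons x bw)
  thus ?case by (cases S; cases x) auto
qed auto

lemma length_add_box:
  "map length P = map length Q \<Longrightarrow> map length (add_box (row_insert P p) Q q) = map length (row_insert P p)"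
proof (induction P arbitrary: Q p)
  case (Cons r P)
  then obtain s Q' where Q: "Q = s # Q'" "length s = length r" "map length P = map length Q'"
    by (cases Q) auto
  show ?case using Cons.IH[OF Q(3)] Q(2) by (simp add: Q Let_def)
qed auto

lemma add_box_rows: "trow (add_box P' Q q) r \<in> {trow Q r, trow Q r @ [q]}"
proof (induction P' Q q arbitrary: r rule: add_box.induct)
  case (2 x P' q)
  thus ?case by (cases r) auto
next
  case (3 x P' s Q q)
  thus ?case by (cases r) auto
qed auto

lemma length_trow: "map length P = map length Q \<Longrightarrow> length (trow P r) = length (trow Q r)"
proof (induction P arbitrary: Q r)
  case (Cons x P)
  thus ?case by (cases Q; cases r) auto
qed auto

lemma trow_sorted: "\<forall>r\<in>set T. sorted r \<Longrightarrow> sorted (trow T r)"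
  by (auto simp: trow_def)

lemma set_trow: "set (trow T r) \<subseteq> set (concat T)"
  by (auto simp: trow_def) (metis nth_mem)

lemma nonempty_of_length: "map length P = map length Q \<Longrightarrow> [] \<notin> set P \<Longrightarrow> [] \<notin> set Q"
proof
  assume *: "map length P = map length Q" "[] \<notin> set P" "[] \<in> set Q"
  have "0 \<in> length ` set Q" using *(3) by force
  hence "0 \<in> length ` set P" using *(1) by (metis list.set_map)
  thus False using *(2) by auto
qed

text \<open>Labels arrive in weakly increasing order, so the boxes of Q labelled at most j are those
  that exist once the biletters with label at most j have been inserted. Their number in row r is a
  row length of an insertion tableau, which expresses Q by first components alone.\<close>

lemma recording_tableau:
  assumes "sorted (map snd bw)"
  defines "Q \<equiv> snd (foldl insert_biletter ([], []) bw)"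
  shows "map length (foldl row_insert [] (map fst bw)) = map length Q"
    "sorted (trow Q r)"
    "set (trow Q r) \<subseteq> snd ` set bw"
    "cnt (trow Q r) j
       = length (trow (foldl row_insert [] (map fst (filter (\<lambda>x. snd x \<le> j) bw))) r)"
proof -
  have "map length (foldl row_insert [] (map fst bw)) = map length Q \<and>
    (\<forall>r. sorted (trow Q r) \<and> set (trow Q r) \<subseteq> snd ` set bw \<and>
      (\<forall>j. cnt (trow Q r) j
        = length (trow (foldl row_insert [] (map fst (filter (\<lambda>x. snd x \<le> j) bw))) r)))"
    using assms(1) unfolding Q_def
  proof (induction bw rule: rev_induct)
    case (snoc x bw)
    obtain p q where x: "x = (p, q)" by (cases x)
    define P where "P = foldl row_insert [] (map fst bw)"
    define Q where "Q = snd (foldl insert_biletter ([], []) bw)"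
    have le: "snd y \<le> q" if "y \<in> set bw" for y
      using snoc.prems that by (auto simp: sorted_append x)
    have IH: "map length P = map length Q" "sorted (trow Q r)" "set (trow Q r) \<subseteq> snd ` set bw"
      "cnt (trow Q r) j = length (trow (foldl row_insert [] (map fst (filter (\<lambda>x. snd x \<le> j) bw))) r)" for r j
      using snoc by (auto simp: sorted_append P_def Q_def)
    have PQ: "foldl insert_biletter ([], []) bw = (P, Q)"
      using foldl_insert_biletter_fst[of "([], [])" bw] by (simp add: P_def Q_def prod_eq_iff)
    have new: "snd (foldl insert_biletter ([], []) (bw @ [x])) = add_box (row_insert P p) Q q"
      by (simp add: PQ x)
    have len: "map length (row_insert P p) = map length (add_box (row_insert P p) Q q)"
      using length_add_box[OF IH(1)] by simp
    have rows: "trow (add_box (row_insert P p) Q q) r \<in> {trow Q r, trow Q r @ [q]}" for r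
      by (rule add_box_rows)
    have Qle: "y \<le> q" if "y \<in> set (trow Q r)" for y r using that IH(3)[of r] le by auto
    have set': "set (trow (add_box (row_insert P p) Q q) r) \<subseteq> snd ` set (bw @ [x])" for r
      using rows[of r] IH(3)[of r] by (auto simp: x)
    have "cnt (trow (add_box (row_insert P p) Q q) r) j
      = length (trow (foldl row_insert [] (map fst (filter (\<lambda>x. snd x \<le> j) (bw @ [x])))) r)" for r j
    \<comment> \<open>Since \<open>q\<close> is the largest label so far, either every label is at
      most \<open>j\<close>, or the new box is not counted.\<close>
    proof (cases "q \<le> j")
      case True
      hence "cnt (trow (add_box (row_insert P p) Q q) r) j = length (trow (add_box (row_insert P p) Q q) r)"
        using rows[of r] True by (intro cnt_all) (auto intro: order_trans[OF Qle True])
      moreover have "filter (\<lambda>x. snd x \<le> j) bw = bw"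
        using le True by (fastforce simp: filter_id_conv)
      ultimately show ?thesis using True length_trow[OF len, of r] by (simp add: x P_def)
    next
      case False
      hence "cnt (trow (add_box (row_insert P p) Q q) r) j = cnt (trow Q r) j"
        using rows[of r] by auto
      thus ?thesis using False IH(4) by (simp add: x)
    qed
    moreover have "sorted (trow (add_box (row_insert P p) Q q) r)" for r
      using rows[of r] IH(2)[of r] Qle by (auto simp: sorted_append)
    ultimately show ?case unfolding new using len set' by (auto simp: x P_def)
  qed auto
  thus "map length (foldl row_insert [] (map fst bw)) = map length Q"
    "sorted (trow Q r)"
    "set (trow Q r) \<subseteq> snd ` set bw"
    "cnt (trow Q r) j
       = length (trow (foldl row_insert [] (map fst (filter (\<lambda>x. snd x \<le> j) bw))) r)"
    by auto
qed

section \<open>The tableaux of a matrix\<close>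

definition entry :: "expmat \<Rightarrow> nat \<Rightarrow> nat \<Rightarrow> nat" where
  "entry \<alpha> i j = Poly_Mapping.lookup \<alpha> (i, j)"

definition column_word :: "nat \<Rightarrow> expmat \<Rightarrow> nat \<Rightarrow> nat list" where
  "column_word m \<alpha> j = concat (map (\<lambda>i. replicate (entry \<alpha> i j) i) [1..<m+1])"

lemma column_word_Suc: "column_word (Suc m) \<alpha> j = column_word m \<alpha> j @ replicate (entry \<alpha> (Suc m) j) (Suc m)"
  by (simp add: column_word_def)

lemma set_column_word: "set (column_word m \<alpha> j) \<subseteq> {1..m}"
  by (auto simp: column_word_def)

lemma sorted_column_word: "sorted (column_word m \<alpha> j)"
proof (induction m)
  case (Suc m)
  thus ?case using set_column_word[of m \<alpha> j] by (fastforce simp: column_word_Suc sorted_append)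
qed (simp add: column_word_def)

lemma count_list_replicate: "count_list (replicate k x) y = (if x = y then k else 0)"
  by (induction k) auto

lemma count_column_word:
  "count_list (column_word m \<alpha> j) i = (if i \<in> {1..m} then entry \<alpha> i j else 0)"
  by (induction m) (auto simp: column_word_def count_list_replicate)

lemma entry_outside: "\<alpha> \<in> expmats m n \<Longrightarrow> (i, j) \<notin> {1..m} \<times> {1..n} \<Longrightarrow> entry \<alpha> i j = 0"
  by (auto simp: expmats_def entry_def in_keys_iff)

lemma column_words_column_word:
  assumes "\<alpha> \<in> expmats m n"
  shows "column_words (column_word m \<alpha>) (entry \<alpha>) k"
  unfolding column_words_def
  using sorted_column_word set_column_word[of m \<alpha>] entry_outside[OF assms]
  by (fastforce simp: count_column_word)

lemma biword_eq: "biword m n \<alpha> = concat (map (\<lambda>j. map (\<lambda>i. (i, j)) (column_word m \<alpha> j)) [1..<n+1])"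
  by (simp add: biword_def column_word_def entry_def map_concat o_def)

lemma map_fst_biword: "map fst (biword m n \<alpha>) = word_upto (column_word m \<alpha>) n"
  by (simp add: biword_eq word_upto_def map_concat o_def)

lemma biword_Suc: "biword m (Suc n) \<alpha> = biword m n \<alpha> @ map (\<lambda>i. (i, Suc n)) (column_word m \<alpha> (Suc n))"
  by (simp add: biword_eq)

lemma snd_biword: "snd ` set (biword m n \<alpha>) \<subseteq> {1..n}"
  by (auto simp: biword_eq)

lemma sorted_snd_biword: "sorted (map snd (biword m n \<alpha>))"
proof (induction n)
  case (Suc n)
  thus ?case using snd_biword[of m n \<alpha>]
    by (fastforce simp: biword_Suc sorted_append o_def map_replicate_const)
qed (simp add: biword_eq)

lemma filter_biword: "filter (\<lambda>x. snd x \<le> j) (biword m n \<alpha>) = biword m (min j n) \<alpha>"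
proof (induction n)
  case (Suc n)
  show ?case
  proof (cases "Suc n \<le> j")
    case True
    thus ?thesis using Suc by (simp add: biword_Suc filter_map o_def min_def)
  next
    case False
    thus ?thesis using Suc by (simp add: biword_Suc filter_map o_def min_def)
  qed
qed (simp add: biword_eq)

lemma fst_RSK: "fst (RSK m n \<alpha>) = foldl row_insert [] (word_upto (column_word m \<alpha>) n)"
  by (simp add: RSK_def foldl_insert_biletter_fst map_fst_biword)

lemma set_word: "set (word_upto (column_word m \<alpha>) n) \<subseteq> {1..m}"
  using set_column_word by (fastforce simp: word_upto_def)

lemma RSK_P:
  assumes "\<alpha> \<in> expmats m n" "RSK m n \<alpha> = (P, Q)"
  shows "cnt (trow P r) i = lpp ((bump ^^ r) (entry \<alpha>)) i n"
    "\<forall>r\<in>set P. sorted r" "[] \<notin> set P" "set (concat P) \<subseteq> {1..m}"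
    "mset (concat P) = mset (word_upto (column_word m \<alpha>) n)"
proof -
  have P: "P = foldl row_insert [] (word_upto (column_word m \<alpha>) n)"
    using fst_RSK[of m n \<alpha>] assms by simp
  show "cnt (trow P r) i = lpp ((bump ^^ r) (entry \<alpha>)) i n"
    unfolding P by (rule insertion_counts[OF column_words_column_word[OF assms(1)]])
  show "\<forall>r\<in>set P. sorted r" "[] \<notin> set P"
    and m: "mset (concat P) = mset (word_upto (column_word m \<alpha>) n)"
    using insertion_tableau_rows unfolding P by blast+
  show "set (concat P) \<subseteq> {1..m}" using mset_eq_setD[OF m] set_word by metis
qed

text \<open>The letters of the first j columns are at most m, so the row length from
  \<open>recording_tableau\<close> is the count at m of an insertion tableau. The minimum appears
  because no label exceeds n.\<close>

lemma RSK_Q: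
  assumes "\<alpha> \<in> expmats m n" "RSK m n \<alpha> = (P, Q)"
  shows "cnt (trow Q r) j = lpp ((bump ^^ r) (entry \<alpha>)) m (min j n)"
    "sorted (trow Q r)" "[] \<notin> set Q" "map length P = map length Q"
proof -
  have Q: "Q = snd (foldl insert_biletter ([], []) (biword m n \<alpha>))"
    using assms by (simp add: RSK_def)
  have P: "P = foldl row_insert [] (map fst (biword m n \<alpha>))"
    using fst_RSK[of m n \<alpha>] assms by (simp add: map_fst_biword)
  note rec = recording_tableau[OF sorted_snd_biword[of m n \<alpha>]]
  show "sorted (trow Q r)" unfolding Q by (rule rec(2))
  show len: "map length P = map length Q" unfolding P Q by (rule rec(1))
  show "[] \<notin> set Q" using nonempty_of_length[OF len] RSK_P(3)[OF assms] by blast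
  let ?u = "word_upto (column_word m \<alpha>) (min j n)"
  have "set (trow (foldl row_insert [] ?u) r) \<subseteq> set ?u"
    using set_trow[of "foldl row_insert [] ?u" r] insertion_tableau_rows[of ?u] by (metis mset_eq_setD)
  hence "length (trow (foldl row_insert [] ?u) r) = cnt (trow (foldl row_insert [] ?u) r) m"
    using set_word[of m \<alpha> "min j n"] by (intro cnt_all[symmetric]) auto
  also have "\<dots> = lpp ((bump ^^ r) (entry \<alpha>)) m (min j n)"
    by (rule insertion_counts[OF column_words_column_word[OF assms(1)]])
  finally show "cnt (trow Q r) j = lpp ((bump ^^ r) (entry \<alpha>)) m (min j n)"
    unfolding Q rec(4) filter_biword map_fst_biword .
qed

lemma tableau_eq_of_cnt: "[] \<notin> set S \<Longrightarrow> [] \<notin> set T \<Longrightarrow> (\<And>r. sorted (trow S r)) \<Longrightarrow> (\<And>r. sorted (trow T r)) \<Longrightarrow>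
    (\<And>r i. cnt (trow S r) i = cnt (trow T r) i) \<Longrightarrow> S = T"
  by (rule trow_eqI; (rule sorted_eq_of_cnt)?) auto

text \<open>The counts of both tableaux are values of \<open>lpp\<close> of iterates of
  \<open>bump\<close>, and both operations commute with transposition. The half of the claim about
  first components suffices, as it can be applied to the matrix and to its transpose.\<close>

theorem RSK_transpose:
  assumes \<alpha>: "\<alpha> \<in> expmats m n" "RSK m n \<alpha> = (P, Q)"
    and \<beta>: "\<beta> \<in> expmats n m" and tr: "\<And>i j. entry \<beta> j i = entry \<alpha> i j"
  shows "RSK n m \<beta> = (Q, P)"
proof -
  have half: "fst (RSK n' m' \<beta>') = snd (RSK m' n' \<alpha>')"
    if \<alpha>': "\<alpha>' \<in> expmats m' n'" and \<beta>': "\<beta>' \<in> expmats n' m'"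
      and tr: "\<And>i j. entry \<beta>' j i = entry \<alpha>' i j" for m' n' \<alpha>' \<beta>'
  proof -
    obtain P1 Q1 P2 Q2 where R: "RSK m' n' \<alpha>' = (P1, Q1)" "RSK n' m' \<beta>' = (P2, Q2)"
      by fastforce
    have b: "entry \<beta>' = (\<lambda>i j. entry \<alpha>' j i)" using tr by (intro ext)
    note P2 = RSK_P[OF \<beta>' R(2)] and Q1 = RSK_Q[OF \<alpha>' R(1)]
    have c: "cnt (trow P2 r) j = lpp ((bump ^^ r) (entry \<alpha>')) m' j" for r j
    proof -
      have "lpp ((bump ^^ r) (\<lambda>i j. entry \<alpha>' j i)) j m' = lpp ((bump ^^ r) (entry \<alpha>')) m' j"
        by (subst bump_pow_transpose) (rule lpp_transpose)
      thus ?thesis by (simp only: P2(1) b)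
    qed
    \<comment> \<open>The formula for Q is cut off at n', whereas that for P is not; they agree
      because the entries of \<open>P2\<close> are at most n'.\<close>
    have n: "cnt (trow P2 r) j = cnt (trow P2 r) (min j n')" for r j
    proof (cases "j \<le> n'")
      case False
      have "set (trow P2 r) \<subseteq> {1..n'}" using set_trow[of P2 r] P2(4) by blast
      hence "\<forall>x\<in>set (trow P2 r). x \<le> n'" "\<forall>x\<in>set (trow P2 r). x \<le> j" using False by auto
      thus ?thesis using False by (simp add: cnt_all min_def)
    qed (simp add: min_def)
    have "P2 = Q1"
      by (rule tableau_eq_of_cnt)
        (use P2(2,3) Q1(2,3) in \<open>auto simp: trow_sorted\<close>, metis Q1(1) c n)
    thus ?thesis by (simp add: R)
  qed
  have "fst (RSK n m \<beta>) = Q" using half[OF \<alpha>(1) \<beta> tr] \<alpha>(2) by simp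
  moreover have "P = snd (RSK n m \<beta>)" using half[OF \<beta> \<alpha>(1)] tr \<alpha>(2) by simp
  ultimately show ?thesis by (simp add: prod_eq_iff)
qed

section \<open>Substitutions of variables\<close>

text \<open>For injective \<open>e\<close> this relabels keys along \<open>e\<close>. A polynomial
  is a function on exponent matrices, which are functions on positions, so a substitution of
  variables is a push along a push.\<close>

lift_definition push :: "('a \<Rightarrow> 'b) \<Rightarrow> ('a \<Rightarrow>\<^sub>0 'c::zero) \<Rightarrow> ('b \<Rightarrow>\<^sub>0 'c)" is
  "\<lambda>e f y. if y \<in> range e then f (inv_into UNIV e y) else 0"
proof -
  fix e :: "'a \<Rightarrow> 'b" and f :: "'a \<Rightarrow> 'c"
  assume "finite {x. f x \<noteq> 0}"
  moreover have "{y. (if y \<in> range e then f (inv_into UNIV e y) else 0) \<noteq> 0} \<subseteq> e ` {x. f x \<noteq> 0}"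
  proof
    fix y assume "y \<in> {y. (if y \<in> range e then f (inv_into UNIV e y) else 0) \<noteq> 0}"
    hence "y \<in> range e" "f (inv_into UNIV e y) \<noteq> 0" by (auto split: if_splits)
    thus "y \<in> e ` {x. f x \<noteq> 0}" 
      by (intro image_eqI[of _ _ "inv_into UNIV e y"]) (auto simp: f_inv_into_f)
  qed
  ultimately show "finite {y. (if y \<in> range e then f (inv_into UNIV e y) else 0) \<noteq> 0}"
    by (meson finite_imageI finite_subset)
qed

lemma lookup_push_notin: "y \<notin> range e \<Longrightarrow> Poly_Mapping.lookup (push e f) y = 0"
  by transfer auto

context
  fixes e :: "'a \<Rightarrow> 'b"
  assumes e: "inj e"
begin

lemma lookup_push: "Poly_Mapping.lookup (push e f) (e x) = Poly_Mapping.lookup f x"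
  using e by transfer simp

lemma lookup_push_iff:
  "Poly_Mapping.lookup (push e f) y = (if y \<in> range e then Poly_Mapping.lookup f (inv_into UNIV e y) else 0)"
  by transfer simp

lemma push_add: "push e (f + g) = push e f + push e (g :: 'a \<Rightarrow>\<^sub>0 'c::monoid_add)"
  by (rule poly_mapping_eqI) (simp add: lookup_push_iff lookup_add)

lemma push_zero: "push e 0 = 0"
  by (rule poly_mapping_eqI) (simp add: lookup_push_iff)

lemma push_single: "push e (Poly_Mapping.single x c) = Poly_Mapping.single (e x) c"
proof (rule poly_mapping_eqI)
  fix y
  show "Poly_Mapping.lookup (push e (Poly_Mapping.single x c)) y = Poly_Mapping.lookup (Poly_Mapping.single (e x) c) y"
    using e by (cases "y \<in> range e") (auto simp: lookup_push lookup_push_notin lookup_single when_def inj_eq)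
qed

lemma keys_push: "Poly_Mapping.keys (push e f) = e ` Poly_Mapping.keys f"
  by (auto simp: in_keys_iff lookup_push_iff e split: if_splits intro!: imageI)

lemma inj_push: "inj (push e :: _ \<Rightarrow> 'b \<Rightarrow>\<^sub>0 'c::zero)"
proof (rule injI)
  fix f g :: "'a \<Rightarrow>\<^sub>0 'c" assume "push e f = push e g"
  thus "f = g" by (intro poly_mapping_eqI) (metis lookup_push)
qed

end

lemma poly_mapping_add_induct [case_names zero single add]:
  assumes "P 0" "\<And>x c. P (Poly_Mapping.single x c)" "\<And>f g. P f \<Longrightarrow> P g \<Longrightarrow> P (f + g)"
  shows "P (f :: 'a \<Rightarrow>\<^sub>0 'b::monoid_add)"
proof (induction f rule: update_induct)
  case (update f a b)
  have "Poly_Mapping.update a b f = f + Poly_Mapping.single a b"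
    using update(1) by (intro poly_mapping_eqI)
      (auto simp: lookup_update lookup_add lookup_single in_keys_iff when_def)
  thus ?case using assms update by simp
qed (use assms in simp)

lemma push_mult:
  fixes f g :: "'a::cancel_comm_monoid_add \<Rightarrow>\<^sub>0 'c::comm_ring_1"
  assumes h: "inj h" "\<And>x y. h (x + y) = h x + h y"
  shows "push h (f * g) = push h f * push h g"
proof (induction f rule: poly_mapping_add_induct)
  case (single x c)
  show ?case
    by (induction g rule: poly_mapping_add_induct)
      (simp_all add: push_zero[OF h(1)] push_single[OF h(1)] mult_single h(2) distrib_left push_add[OF h(1)])
qed (simp_all add: push_zero[OF h(1)] distrib_right push_add[OF h(1)])

definition subst_var :: "(nat \<times> nat \<Rightarrow> nat \<times> nat) \<Rightarrow> zpoly \<Rightarrow> zpoly" where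
  "subst_var e = push (push e)"

text \<open>As a ring homomorphism a substitution passes through the product over columns and, by
  \<open>hom_det\<close>, into the minors.\<close>

lemma subst_var_hom:
  assumes "inj e"
  shows "comm_ring_hom (subst_var e)"
proof
  have i: "inj (push e :: expmat \<Rightarrow> expmat)" by (rule inj_push[OF assms])
  show "subst_var e 1 = 1"
    using push_single[OF i, of 0 "1 :: complex"] by (simp add: subst_var_def push_zero[OF assms] single_one)
  show "subst_var e (f * g) = subst_var e f * subst_var e g" for f g
    unfolding subst_var_def by (rule push_mult[OF i]) (rule push_add[OF assms])
qed (use assms in \<open>simp_all add: subst_var_def push_add push_zero inj_push\<close>)

lemma subst_var_zvar: "inj e \<Longrightarrow> subst_var e (zvar i j) = zmonom (Poly_Mapping.single (e (i, j)) 1)"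
  by (simp add: subst_var_def zvar_def zmonom_def push_single inj_push)

lemma lookup_subst_var: "inj e \<Longrightarrow> Poly_Mapping.lookup (subst_var e f) (push e \<alpha>) = Poly_Mapping.lookup f \<alpha>"
  by (simp add: subst_var_def lookup_push inj_push)

lemma subst_var_zminor:
  assumes "inj e"
  shows "subst_var e (zminor rs cs) = det (mat (length rs) (length rs)
    (\<lambda>(a, b). zmonom (Poly_Mapping.single (e (rs ! a, cs ! b)) 1)))"
proof -
  interpret comm_ring_hom "subst_var e" by (rule subst_var_hom[OF assms])
  have "map_mat (subst_var e) (mat (length rs) (length rs) (\<lambda>(a, b). zvar (rs ! a) (cs ! b))) =
    mat (length rs) (length rs) (\<lambda>(a, b). zmonom (Poly_Mapping.single (e (rs ! a, cs ! b)) 1))"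
    by (rule eq_matI) (auto simp: subst_var_zvar assms)
  thus ?thesis by (metis hom_det zminor_def)
qed

section \<open>Minors and bitableaux under transposition and relabelling\<close>

lemma zminor_transpose:
  assumes "length rs = length cs"
  shows "subst_var prod.swap (zminor rs cs) = zminor cs rs"
proof -
  let ?A = "mat (length cs) (length cs) (\<lambda>(a, b). zvar (cs ! a) (rs ! b))"
  have "subst_var prod.swap (zminor rs cs) = det (transpose_mat ?A)"
    unfolding subst_var_zminor[OF inj_swap]
    by (rule arg_cong[of _ _ det], rule eq_matI) (auto simp: assms zvar_def)
  also have "\<dots> = det ?A" by (rule det_transpose[of _ "length cs"]) auto
  finally show ?thesis by (simp add: zminor_def)
qed

lemma inj_map_prod_id: "inj f \<Longrightarrow> inj (map_prod f (id :: 'a \<Rightarrow> 'a))"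
  by (simp add: prod.inj_map)

lemma zminor_relabel:
  assumes "inj f"
  shows "subst_var (map_prod f id) (zminor rs cs) = zminor (map f rs) cs"
  by (subst subst_var_zminor[OF inj_map_prod_id[OF assms]], subst zminor_def, rule arg_cong[of _ _ det], rule eq_matI) (auto simp: zvar_def)

lemma length_tab_column: "map length P = map length Q \<Longrightarrow> length (tab_column P c) = length (tab_column Q c)"
proof (induction P arbitrary: Q)
  case (Cons r P)
  thus ?case by (cases Q) (auto simp: tab_column_def)
qed (auto simp: tab_column_def)

lemma num_columns_cong: "map length P = map length Q \<Longrightarrow> num_columns P = num_columns Q"
  by (cases P; cases Q) (auto simp: num_columns_def)

lemma bitableau_transpose:
  assumes "map length P = map length Q"
  shows "subst_var prod.swap (bitableau P Q) = bitableau Q P"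
proof -
  interpret comm_ring_hom "subst_var prod.swap" by (rule subst_var_hom) simp
  show ?thesis
    by (simp add: bitableau_def hom_prod zminor_transpose length_tab_column[OF assms] num_columns_cong[OF assms])
qed

lemma tab_column_map: "tab_column (map (map f) P) c = map f (tab_column P c)"
  by (induction P) (auto simp: tab_column_def)

lemma bitableau_relabel:
  assumes "inj f"
  shows "subst_var (map_prod f id) (bitableau P Q) = bitableau (map (map f) P) Q"
proof -
  interpret comm_ring_hom "subst_var (map_prod f id)"
    by (rule subst_var_hom[OF inj_map_prod_id[OF assms]])
  have "num_columns (map (map f) P) = num_columns P" by (cases P) (auto simp: num_columns_def)
  thus ?thesis by (simp add: bitableau_def hom_prod zminor_relabel[OF assms] tab_column_map)
qed

section \<open>Diagonal coefficients\<close>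

text \<open>A diagonal entry of the operator in the monomial basis; all traces become sums of
  these.\<close>

definition diag_coeff :: "nat \<Rightarrow> nat \<Rightarrow> expmat \<Rightarrow> complex" where
  "diag_coeff m n \<alpha> = Poly_Mapping.lookup (RSK_op m n (zmonom \<alpha>)) \<alpha>"

lemma diag_coeff_eq: "RSK m n \<alpha> = (P, Q) \<Longrightarrow> diag_coeff m n \<alpha> = Poly_Mapping.lookup (bitableau P Q) \<alpha>"
  by (simp add: diag_coeff_def RSK_op_zmonom)

lemma push_swap_expmats: "\<alpha> \<in> expmats m n \<Longrightarrow> push prod.swap \<alpha> \<in> expmats n m"
  by (auto simp: expmats_def keys_push)

lemma entry_push_swap: "entry (push prod.swap \<alpha>) j i = entry \<alpha> i j"
  using lookup_push[OF inj_swap, of \<alpha> "(i, j)"] by (simp add: entry_def)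

lemma diag_coeff_transpose:
  assumes "\<alpha> \<in> expmats m n"
  shows "diag_coeff n m (push prod.swap \<alpha>) = diag_coeff m n \<alpha>"
proof -
  obtain P Q where R: "RSK m n \<alpha> = (P, Q)" by fastforce
  have R': "RSK n m (push prod.swap \<alpha>) = (Q, P)"
    by (rule RSK_transpose[OF assms R push_swap_expmats[OF assms] entry_push_swap])
  have "map length P = map length Q" by (rule RSK_Q(4)[OF assms R])
  from bitableau_transpose[OF this] show ?thesis
    unfolding diag_coeff_eq[OF R] diag_coeff_eq[OF R']
    by (metis lookup_subst_var inj_swap)
qed

text \<open>The increasing map whose image misses only k; relabelling rows along it makes room for a
  zero row at k.\<close>

definition skip :: "nat \<Rightarrow> nat \<Rightarrow> nat" where
  "skip k i = (if i < k then i else Suc i)"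

lemma strict_mono_skip: "strict_mono (skip k)"
  by (auto simp: strict_mono_def skip_def)

lemma skip_ne: "skip k i \<noteq> k"
  by (auto simp: skip_def)

text \<open>Insertion depends on its letters only through comparisons, which a strictly increasing
  map preserves.\<close>

lemma row_insert_relabel:
  assumes f: "strict_mono f"
  shows "row_insert (map (map f) P) (f p) = map (map f) (row_insert P p)"
proof (induction P p rule: row_insert.induct)
  case (2 r P p)
  have le: "f x \<le> f y \<longleftrightarrow> x \<le> y" "f x < f y \<longleftrightarrow> x < y" "f x = f y \<longleftrightarrow> x = y" for x y
    using f by (auto simp: strict_mono_less_eq strict_mono_less strict_mono_eq)
  show ?case
  proof (cases "\<forall>x\<in>set r. x \<le> p")
    case True
    thus ?thesis by (simp add: le)
  next
    case False
    define S where "S = {x \<in> set r. p < x}"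
    define k where "k = (LEAST k. k < length r \<and> r ! k = Min S)"
    have S: "finite S" "S \<noteq> {}" using False by (auto simp: S_def not_le)
    have "{x \<in> set (map f r). f p < x} = f ` S" by (auto simp: S_def le)
    moreover have "Min (f ` S) = f (Min S)"
      by (rule mono_Min_commute[OF strict_mono_mono[OF f] S, symmetric])
    moreover have "(LEAST k. k < length (map f r) \<and> map f r ! k = f (Min S)) = k"
      unfolding k_def by (rule arg_cong[of _ _ Least]) (auto simp: le)
    moreover have "\<not> (\<forall>x\<in>set (map f r). x \<le> f p)" using False by (simp add: le)
    ultimately have "row_insert (map (map f) (r # P)) (f p)
        = (map f r)[k := f p] # row_insert (map (map f) P) (f (Min S))"
      by (simp only: list.map row_insert.simps if_False Let_def)
    also have "\<dots> = map (map f) (row_insert (r # P) p)"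
    proof -
      have "row_insert (r # P) p = r[k := p] # row_insert P (Min S)"
        by (simp only: row_insert.simps if_not_P[OF False] Let_def S_def k_def)
      moreover have "row_insert (map (map f) P) (f (Min S)) = map (map f) (row_insert P (Min S))"
        using 2[OF False refl refl] by (simp add: S_def)
      ultimately show ?thesis by (simp add: map_update)
    qed
    finally show ?thesis .
  qed
qed auto

lemma add_box_relabel: "add_box (map (map f) P) Q q = add_box P Q q"
  by (induction P Q q rule: add_box.induct) auto

lemma foldl_insert_biletter_relabel:
  assumes f: "strict_mono f"
  shows "foldl insert_biletter (map_prod (map (map f)) id S) (map (map_prod f id) bw)
    = map_prod (map (map f)) id (foldl insert_biletter S bw)"
proof (induction bw arbitrary: S)
  case (Cons x bw)
  obtain P Q p q where "S = (P, Q)" "x = (p, q)" by (cases S; cases x)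
  hence "insert_biletter (map_prod (map (map f)) id S) (map_prod f id x)
      = map_prod (map (map f)) id (insert_biletter S x)"
    by (simp add: row_insert_relabel[OF f] add_box_relabel)
  thus ?case by (simp only: list.map foldl.simps Cons.IH)
qed auto

lemma column_word_relabel:
  assumes "\<And>i. entry \<beta> (skip k i) j = entry \<alpha> i j" "entry \<beta> k j = 0" "1 \<le> k" "k \<le> Suc m"
  shows "column_word (Suc m) \<beta> j = map (skip k) (column_word m \<alpha> j)"
proof -
  have 1: "column_word l \<beta> j = map (skip k) (column_word l \<alpha> j)" if "l < k" for l
    using that
  proof (induction l)
    case (Suc l)
    thus ?case using assms(1)[of "Suc l"] by (simp add: column_word_Suc map_replicate_const skip_def)
  qed (simp add: column_word_def)
  have "column_word (Suc l) \<beta> j = map (skip k) (column_word l \<alpha> j)" if "k \<le> Suc l" for l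
    using that
  proof (induction l)
    case 0
    hence "k = 1" using assms by simp
    thus ?case using assms by (simp add: column_word_def)
  next
    case (Suc l)
    show ?case
    proof (cases "k = Suc (Suc l)")
      case True
      thus ?thesis using 1[of "Suc l"] assms by (simp add: column_word_Suc[of "Suc l" \<beta>])
    next
      case False
      thus ?thesis using Suc assms(1)[of "Suc l"]
        by (simp add: column_word_Suc[of "Suc l" \<beta>] column_word_Suc[of l \<alpha>] map_replicate_const skip_def)
    qed
  qed
  thus ?thesis using assms by simp
qed

text \<open>A zero row yields no biletters, so only the names of the letters change: P is relabelled
  and Q stays. On bitableaux this is an injective substitution of variables, which carries
  coefficients along.\<close>

lemma diag_coeff_insert_zero_row:
  assumes "1 \<le> k" "k \<le> Suc m"
  shows "diag_coeff (Suc m) n (push (map_prod (skip k) id) \<alpha>) = diag_coeff m n \<alpha>"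
proof -
  let ?e = "map_prod (skip k) (id :: nat \<Rightarrow> nat)" and ?\<beta> = "push (map_prod (skip k) id) \<alpha>"
  have i: "inj (skip k)" using strict_mono_skip by (rule strict_mono_imp_inj_on)
  hence e: "inj ?e" by (rule inj_map_prod_id)
  have b: "entry ?\<beta> (skip k i) j = entry \<alpha> i j" "entry ?\<beta> k j = 0" for i j
    using lookup_push[OF e, of \<alpha> "(i, j)"] lookup_push_notin[of "(k, j)" ?e \<alpha>] skip_ne[of k, symmetric]
    by (auto simp: entry_def) 
  obtain P Q where R: "RSK m n \<alpha> = (P, Q)" by fastforce
  have "biword (Suc m) n ?\<beta> = map ?e (biword m n \<alpha>)"
    using column_word_relabel[of ?\<beta> k _ \<alpha>, OF b assms]
    by (simp add: biword_eq map_concat o_def)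
  hence R': "RSK (Suc m) n ?\<beta> = (map (map (skip k)) P, Q)"
    using foldl_insert_biletter_relabel[OF strict_mono_skip[of k], of "([], [])" "biword m n \<alpha>"] R
    by (simp add: RSK_def)
  show ?thesis
    unfolding diag_coeff_eq[OF R] diag_coeff_eq[OF R'] bitableau_relabel[OF i, symmetric]
    by (rule lookup_subst_var[OF e])
qed

section \<open>Preservation of weight spaces\<close>

definition row_sum :: "nat \<Rightarrow> expmat \<Rightarrow> nat \<Rightarrow> nat" where
  "row_sum n \<alpha> i = (\<Sum>j=1..n. entry \<alpha> i j)"

definition col_sum :: "nat \<Rightarrow> expmat \<Rightarrow> nat \<Rightarrow> nat" where
  "col_sum m \<alpha> j = (\<Sum>i=1..m. entry \<alpha> i j)"

text \<open>The weights are functions on all indices, so that they simply add under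
  multiplication.\<close>

definition homogeneous :: "nat \<Rightarrow> nat \<Rightarrow> (nat \<Rightarrow> nat) \<Rightarrow> (nat \<Rightarrow> nat) \<Rightarrow> zpoly set" where
  "homogeneous m n \<mu> \<nu> = {f. \<forall>\<alpha>\<in>Poly_Mapping.keys f. \<alpha> \<in> expmats m n \<and> row_sum n \<alpha> = \<mu> \<and> col_sum m \<alpha> = \<nu>}"

lemma homogeneous_0: "0 \<in> homogeneous m n \<mu> \<nu>"
  by (simp add: homogeneous_def)

lemma homogeneous_add: "f \<in> homogeneous m n \<mu> \<nu> \<Longrightarrow> g \<in> homogeneous m n \<mu> \<nu> \<Longrightarrow> f + g \<in> homogeneous m n \<mu> \<nu>"
  using keys_add[of f g] by (auto simp: homogeneous_def)

lemma homogeneous_sum: "(\<And>x. x \<in> A \<Longrightarrow> f x \<in> homogeneous m n \<mu> \<nu>) \<Longrightarrow> sum f A \<in> homogeneous m n \<mu> \<nu>"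
  by (induction A rule: infinite_finite_induct) (auto intro: homogeneous_0 homogeneous_add)

lemma homogeneous_uminus: "f \<in> homogeneous m n \<mu> \<nu> \<Longrightarrow> - f \<in> homogeneous m n \<mu> \<nu>"
  by (simp add: homogeneous_def)

lemma entry_add: "entry (\<alpha> + \<beta>) i j = entry \<alpha> i j + entry \<beta> i j"
  by (simp add: entry_def lookup_add)

lemma expmats_add: "\<alpha> \<in> expmats m n \<Longrightarrow> \<beta> \<in> expmats m n \<Longrightarrow> \<alpha> + \<beta> \<in> expmats m n"
  using keys_add[of \<alpha> \<beta>] by (auto simp: expmats_def)

lemma row_sum_add: "row_sum n (\<alpha> + \<beta>) i = row_sum n \<alpha> i + row_sum n \<beta> i"
  by (simp add: row_sum_def entry_add sum.distrib)

lemma col_sum_add: "col_sum m (\<alpha> + \<beta>) j = col_sum m \<alpha> j + col_sum m \<beta> j"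
  by (simp add: col_sum_def entry_add sum.distrib)

lemma homogeneous_mult:
  assumes "f \<in> homogeneous m n \<mu> \<nu>" "g \<in> homogeneous m n \<mu>' \<nu>'"
  shows "f * g \<in> homogeneous m n (\<lambda>i. \<mu> i + \<mu>' i) (\<lambda>j. \<nu> j + \<nu>' j)"
  unfolding homogeneous_def
proof (intro CollectI ballI)
  fix \<alpha> assume "\<alpha> \<in> Poly_Mapping.keys (f * g)"
  then obtain \<beta> \<gamma> where "\<alpha> = \<beta> + \<gamma>" "\<beta> \<in> Poly_Mapping.keys f" "\<gamma> \<in> Poly_Mapping.keys g"
    using keys_mult[of f g] by blast
  thus "\<alpha> \<in> expmats m n \<and> row_sum n \<alpha> = (\<lambda>i. \<mu> i + \<mu>' i) \<and> col_sum m \<alpha> = (\<lambda>j. \<nu> j + \<nu>' j)"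
    using assms by (auto simp: homogeneous_def expmats_add row_sum_add col_sum_add)
qed

lemma homogeneous_1: "1 \<in> homogeneous m n (\<lambda>_. 0) (\<lambda>_. 0)"
  by (auto simp: homogeneous_def expmats_def row_sum_def col_sum_def entry_def)

lemma homogeneous_prod:
  "(\<And>x. x \<in> A \<Longrightarrow> f x \<in> homogeneous m n (\<mu> x) (\<nu> x)) \<Longrightarrow>
    prod f A \<in> homogeneous m n (\<lambda>i. \<Sum>x\<in>A. \<mu> x i) (\<lambda>j. \<Sum>x\<in>A. \<nu> x j)"
proof (induction A rule: infinite_finite_induct)
  case (insert x F)
  thus ?case using homogeneous_mult[of "f x" m n "\<mu> x" "\<nu> x" "prod f F"] by auto
qed (auto simp: homogeneous_1)

lemma zvar_homogeneous:
  assumes "i \<in> {1..m}" "j \<in> {1..n}"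
  shows "zvar i j \<in> homogeneous m n (\<lambda>x. if x = i then 1 else 0) (\<lambda>y. if y = j then 1 else 0)"
proof -
  have "entry (Poly_Mapping.single (i, j) 1) x y = (if x = i then if y = j then 1 else 0 else 0)" for x y
    by (auto simp: entry_def lookup_single when_def)
  hence "row_sum n (Poly_Mapping.single (i, j) 1) = (\<lambda>x. if x = i then 1 else 0)"
    "col_sum m (Poly_Mapping.single (i, j) 1) = (\<lambda>y. if y = j then 1 else 0)"
    using assms by (auto simp: row_sum_def col_sum_def fun_eq_iff sum.delta)
  thus ?thesis using assms by (auto simp: homogeneous_def zvar_def zmonom_def expmats_def)
qed

lemma count_list_conv_sum: "count_list xs x = (\<Sum>i<length xs. if x = xs ! i then 1 else 0)"
  by (induction xs) (auto simp: sum.lessThan_Suc_shift simp del: sum.lessThan_Suc)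

text \<open>Every term of the determinant uses each row label and each column label once; the
  permutation merely reorders the column labels.\<close>

lemma zminor_homogeneous:
  assumes "set rs \<subseteq> {1..m}" "set cs \<subseteq> {1..n}" "length rs = length cs"
  shows "zminor rs cs \<in> homogeneous m n (count_list rs) (count_list cs)"
proof -
  let ?l = "length rs"
  let ?A = "mat ?l ?l (\<lambda>(a, b). zvar (rs ! a) (cs ! b))"
  have "(\<Prod>i = 0..<?l. ?A $$ (i, p i)) \<in> homogeneous m n (count_list rs) (count_list cs)"
    if p: "p permutes {0..<?l}" for p
  proof -
    have pl: "p i < ?l" if "i < ?l" for i using permutes_in_image[OF p, of i] that by simp
    have "(\<Prod>i = 0..<?l. ?A $$ (i, p i)) = (\<Prod>i = 0..<?l. zvar (rs ! i) (cs ! p i))"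
      by (rule prod.cong) (auto simp: pl)
    also have "\<dots> \<in> homogeneous m n (\<lambda>x. \<Sum>i = 0..<?l. if x = rs ! i then 1 else 0)
        (\<lambda>y. \<Sum>i = 0..<?l. if y = cs ! p i then 1 else 0)"
      by (rule homogeneous_prod, rule zvar_homogeneous)
        (use assms pl in \<open>auto simp: subset_iff\<close>)
    also have "(\<lambda>x. \<Sum>i = 0..<?l. if x = rs ! i then 1 else 0) = count_list rs"
      by (simp add: count_list_conv_sum fun_eq_iff lessThan_atLeast0)
    also have "(\<lambda>y. \<Sum>i = 0..<?l. if y = cs ! p i then 1 else 0) = count_list cs"
    proof
      fix y
      show "(\<Sum>i = 0..<?l. if y = cs ! p i then 1 else 0) = count_list cs y"
        using sum.permute[OF p, of "\<lambda>i. if y = cs ! i then 1 else 0 :: nat"]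
        by (simp add: count_list_conv_sum lessThan_atLeast0 assms(3) o_def)
    qed
    finally show ?thesis .
  qed
  hence "signof p * (\<Prod>i = 0..<?l. ?A $$ (i, p i)) \<in> homogeneous m n (count_list rs) (count_list cs)"
    if "p permutes {0..<?l}" for p
    using that by (cases "evenperm p") (auto simp: sign_def homogeneous_uminus)
  thus ?thesis unfolding zminor_def det_def by (auto intro!: homogeneous_sum)
qed

lemma tab_column_Cons: "tab_column (r # T) c = (if c < length r then r ! c # tab_column T c else tab_column T c)"
  by (simp add: tab_column_def)

lemma count_columns:
  assumes "\<forall>r\<in>set T. length r \<le> N"
  shows "(\<Sum>c<N. count_list (tab_column T c) x) = count_list (concat T) x"
  using assms
proof (induction T)
  case (Cons r T)
  have "(\<Sum>c<N. count_list (tab_column (r # T) c) x)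
    = (\<Sum>c<N. (if c < length r \<and> x = r ! c then 1 else 0) + count_list (tab_column T c) x)"
    by (rule sum.cong) (auto simp: tab_column_Cons)
  also have "\<dots> = (\<Sum>c<N. if c < length r \<and> x = r ! c then 1 else 0) + count_list (concat T) x"
    using Cons by (simp add: sum.distrib)
  also have "(\<Sum>c<N. if c < length r \<and> x = r ! c then 1 else 0) = (\<Sum>c<length r. if x = r ! c then 1 else 0)"
    using Cons.prems by (intro sum.mono_neutral_cong_right) auto
  finally show ?case by (simp add: count_list_conv_sum[of r])
qed (simp add: tab_column_def)

lemma set_tab_column: "set (tab_column T c) \<subseteq> set (concat T)"
  by (auto simp: tab_column_def)

lemma bitableau_homogeneous:
  assumes "set (concat P) \<subseteq> {1..m}" "set (concat Q) \<subseteq> {1..n}" "map length P = map length Q"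
    "\<forall>r\<in>set P. length r \<le> num_columns P"
  shows "bitableau P Q \<in> homogeneous m n (count_list (concat P)) (count_list (concat Q))"
proof -
  have "length ` set P = length ` set Q" using assms(3) by (metis list.set_map)
  hence Q: "\<forall>r\<in>set Q. length r \<le> num_columns P" using assms(4) by (metis image_iff)
  have "bitableau P Q \<in> homogeneous m n (\<lambda>x. \<Sum>c<num_columns P. count_list (tab_column P c) x)
      (\<lambda>x. \<Sum>c<num_columns P. count_list (tab_column Q c) x)"
    unfolding bitableau_def
    by (intro homogeneous_prod zminor_homogeneous length_tab_column assms(3) order_trans[OF set_tab_column] assms(1,2))
  thus ?thesis by (simp only: count_columns[OF assms(4)] count_columns[OF Q])
qed

lemma lpp_bump_pow_le: "lpp ((bump ^^ r) b) i j \<le> lpp b i j"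
  by (induction r) (auto intro: order_trans[OF lpp_bump_le_lpp])

lemma length_trow_RSK:
  assumes "\<alpha> \<in> expmats m n" "RSK m n \<alpha> = (P, Q)"
  shows "length (trow P r) = lpp ((bump ^^ r) (entry \<alpha>)) m n"
  using RSK_P(1)[OF assms, of r m] RSK_P(4)[OF assms] set_trow[of P r] cnt_all[of "trow P r" m]
  by force

lemma num_columns_conv: "num_columns P = length (trow P 0)"
  by (cases P) (auto simp: num_columns_def)

text \<open>Insertion preserves letters, so the content of P is given by the row sums. The content
  of Q is then obtained from the transposed matrix, whose insertion tableau is Q.\<close>

lemma RSK_op_homogeneous:
  assumes "\<alpha> \<in> expmats m n"
  shows "RSK_op m n (zmonom \<alpha>) \<in> homogeneous m n (row_sum n \<alpha>) (col_sum m \<alpha>)"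
proof -
  have content: "count_list (concat P) = row_sum n \<alpha>" if "\<alpha> \<in> expmats m n" "RSK m n \<alpha> = (P, Q)" for m n \<alpha> P Q
  proof
    fix i
    have "count_list (concat P) i = count_list (word_upto (column_word m \<alpha>) n) i"
      using RSK_P(5)[OF that] by (metis count_mset)
    also have "\<dots> = (\<Sum>j=1..n. count_list (column_word m \<alpha> j) i)"
      by (induction n) auto
    also have "\<dots> = row_sum n \<alpha> i"
      unfolding row_sum_def
      by (rule sum.cong) (use entry_outside[OF that(1)] in \<open>auto simp: count_column_word\<close>)
    finally show "count_list (concat P) i = row_sum n \<alpha> i" .
  qed
  obtain P Q where R: "RSK m n \<alpha> = (P, Q)" by fastforce
  let ?\<beta> = "push prod.swap \<alpha>"
  have b: "?\<beta> \<in> expmats n m" by (rule push_swap_expmats[OF assms])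
  have R': "RSK n m ?\<beta> = (Q, P)"
    by (rule RSK_transpose[OF assms R b entry_push_swap])
  have "count_list (concat Q) = col_sum m \<alpha>"
    unfolding content[OF b R'] by (simp add: row_sum_def col_sum_def entry_push_swap fun_eq_iff)
  moreover have "count_list (concat P) = row_sum n \<alpha>" by (rule content[OF assms R])
  moreover have "\<forall>r\<in>set P. length r \<le> num_columns P"
  proof
    fix r assume "r \<in> set P"
    then obtain k where "k < length P" "r = P ! k" by (auto simp: in_set_conv_nth)
    hence "r = trow P k" by (simp add: trow_def)
    thus "length r \<le> num_columns P"
      using lpp_bump_pow_le length_trow_RSK[OF assms R, of k] length_trow_RSK[OF assms R, of 0]
      by (simp add: num_columns_conv)
  qed
  ultimately show ?thesis
    using bitableau_homogeneous[OF RSK_P(4)[OF assms R] RSK_P(4)[OF b R'] RSK_Q(4)[OF assms R]] R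
    by (simp add: RSK_op_zmonom)
qed

section \<open>Traces as sums of diagonal coefficients\<close>

lemma mult_indicator: "(c :: complex) * (if Q then 1 else 0) = (if Q then c else 0)"
  by simp

lemma span_zmonom_iff:
  "f \<in> zpoly.span (zmonom ` S) \<longleftrightarrow> Poly_Mapping.keys f \<subseteq> S"
proof
  assume "f \<in> zpoly.span (zmonom ` S)"
  thus "Poly_Mapping.keys f \<subseteq> S"
  proof (induction rule: zpoly.span_induct_alt)
    case (step c x y)
    have "Poly_Mapping.keys (zscale c x) \<subseteq> Poly_Mapping.keys x"
      by (auto simp: in_keys_iff lookup_zscale)
    moreover have "Poly_Mapping.keys x \<subseteq> S" using step(1) by (auto simp: zmonom_def)
    ultimately show ?case using step(2) keys_add[of "zscale c x" y] by blast
  qed simp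
next
  assume S: "Poly_Mapping.keys f \<subseteq> S"
  have "f = (\<Sum>\<alpha>\<in>Poly_Mapping.keys f. zscale (Poly_Mapping.lookup f \<alpha>) (zmonom \<alpha>))"
    by (rule poly_mapping_eqI)
      (simp add: lookup_sum lookup_zscale zmonom_def lookup_single when_def in_keys_iff mult_indicator)
  also have "\<dots> \<in> zpoly.span (zmonom ` S)"
    using S by (intro zpoly.span_sum zpoly.span_scale zpoly.span_base) auto
  finally show "f \<in> zpoly.span (zmonom ` S)" .
qed

lemma lookup_sum_zmonom:
  assumes "finite S"
  shows "Poly_Mapping.lookup (\<Sum>\<alpha>\<in>S. zscale (c \<alpha>) (zmonom \<alpha>)) \<beta> = (if \<beta> \<in> S then c \<beta> else 0)"
  using assms by (simp add: lookup_sum lookup_zscale zmonom_def lookup_single when_def mult_indicator)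

lemma inj_zmonom: "inj zmonom"
  by (rule injI) (metis lookup_single_eq lookup_single_not_eq zero_neq_one zmonom_def)

lemma independent_zmonom:
  assumes "finite S"
  shows "zpoly.independent (zmonom ` S)"
proof (rule zpoly.independent_if_scalars_zero)
  fix c x assume *: "(\<Sum>x\<in>zmonom ` S. zscale (c x) x) = 0" and "x \<in> zmonom ` S"
  then obtain \<beta> where \<beta>: "\<beta> \<in> S" "x = zmonom \<beta>" by auto
  have "(\<Sum>\<alpha>\<in>S. zscale (c (zmonom \<alpha>)) (zmonom \<alpha>)) = 0"
    using * by (simp add: sum.reindex[OF inj_on_subset[OF inj_zmonom]])
  thus "c x = 0" using lookup_sum_zmonom[OF assms, of "\<lambda>\<alpha>. c (zmonom \<alpha>)" \<beta>] \<beta> by simp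
qed (use assms in simp)

lemma representation_zmonom:
  assumes "finite S" "Poly_Mapping.keys f \<subseteq> S" "\<beta> \<in> S"
  shows "zpoly.representation (zmonom ` S) f (zmonom \<beta>) = Poly_Mapping.lookup f \<beta>"
proof -
  let ?r = "zpoly.representation (zmonom ` S) f"
  have "f \<in> zpoly.span (zmonom ` S)" using assms by (simp add: span_zmonom_iff)
  hence "(\<Sum>x\<in>zmonom ` S. zscale (?r x) x) = f"
    using assms by (intro zpoly.sum_representation_eq independent_zmonom) auto
  hence "(\<Sum>\<alpha>\<in>S. zscale (?r (zmonom \<alpha>)) (zmonom \<alpha>)) = f"
    by (simp add: sum.reindex[OF inj_on_subset[OF inj_zmonom]])
  thus ?thesis using lookup_sum_zmonom[OF assms(1), of "\<lambda>\<alpha>. ?r (zmonom \<alpha>)" \<beta>] assms(3) by simp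
qed

text \<open>The monomials in \<open>S\<close> form a basis of an invariant subspace, and the
  coordinates in this basis are the coefficients of the polynomial.\<close>

lemma trace_on_zmonom:
  assumes S: "finite S" and f: "module_hom zscale zscale f"
    and pres: "\<And>\<alpha>. \<alpha> \<in> S \<Longrightarrow> Poly_Mapping.keys (f (zmonom \<alpha>)) \<subseteq> S"
  shows "trace_on zscale (zpoly.span (zmonom ` S)) f
    = (\<Sum>\<alpha>\<in>S. Poly_Mapping.lookup (f (zmonom \<alpha>)) \<alpha>)"
proof -
  interpret module_hom zscale zscale f by (rule f)
  have "f ` zpoly.span (zmonom ` S) = zpoly.span (f ` zmonom ` S)" by (rule span_image[symmetric])
  also have "\<dots> \<subseteq> zpoly.span (zmonom ` S)"
    by (rule zpoly.span_minimal) (use pres span_zmonom_iff in auto)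
  finally have "trace_on zscale (zpoly.span (zmonom ` S)) f
      = (\<Sum>c\<in>zmonom ` S. zpoly.representation (zmonom ` S) (f c) c)"
    by (intro zpoly.trace_on_eq[OF f] independent_zmonom[OF S]) (use S in auto)
  also have "\<dots> = (\<Sum>\<alpha>\<in>S. zpoly.representation (zmonom ` S) (f (zmonom \<alpha>)) (zmonom \<alpha>))"
    by (simp add: sum.reindex[OF inj_on_subset[OF inj_zmonom]])
  also have "\<dots> = (\<Sum>\<alpha>\<in>S. Poly_Mapping.lookup (f (zmonom \<alpha>)) \<alpha>)"
    by (rule sum.cong) (use pres representation_zmonom[OF S] in auto)
  finally show ?thesis .
qed

section \<open>Adding a unit at a dominant position\<close>

definition block_sum :: "(nat \<Rightarrow> nat \<Rightarrow> nat) \<Rightarrow> nat \<Rightarrow> nat \<Rightarrow> nat" where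
  "block_sum b i j = (\<Sum>x=1..i. \<Sum>y=1..j. b x y)"

lemma block_sum_Suc1: "block_sum b (Suc i) j = block_sum b i j + (\<Sum>y=1..j. b (Suc i) y)"
  by (simp add: block_sum_def)

lemma block_sum_Suc2: "block_sum b i (Suc j) = block_sum b i j + (\<Sum>x=1..i. b x (Suc j))"
  by (simp add: block_sum_def sum.distrib)

lemma lpp_Suc1_le: "lpp b (Suc i) j \<le> lpp b i j + (\<Sum>y=1..j. b (Suc i) y)"
proof (induction j)
  case (Suc j)
  thus ?case using lpp_mono2[of b i j] by simp
qed simp

lemma lpp_Suc2_le: "lpp b i (Suc j) \<le> lpp b i j + (\<Sum>x=1..i. b x (Suc j))"
proof (induction i)
  case (Suc i)
  thus ?case using lpp_mono1[of b i j] by simp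
qed simp

lemma lpp_le_block_sum: "lpp b i j \<le> block_sum b i j"
proof (induction i)
  case (Suc i)
  thus ?case using lpp_Suc1_le[of b i j] by (simp add: block_sum_Suc1)
qed simp

lemma row_le_lpp: "1 \<le> i \<Longrightarrow> (\<Sum>y=1..j. b i y) \<le> lpp b i j"
  by (induction j; cases i) auto

lemma column_le_lpp: "1 \<le> j \<Longrightarrow> (\<Sum>x=1..i. b x j) \<le> lpp b i j"
  by (induction i; cases j) auto

text \<open>The first two rows of a tableau contain at most all letters. With
  \<open>max + min = sum\<close> the left side becomes a passage time of \<open>bump b\<close>, the
  larger of two, plus both neighbouring passage times of \<open>b\<close>, minus the diagonal one,
  plus the entry. Induction handles the larger one with the \<open>b\<close> value at the same
  position; the growth of the other \<open>b\<close> value from the diagonal is at most a row or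
  column sum.\<close>

lemma lpp_add_lpp_bump_le: "lpp (bump b) i j + lpp b i j \<le> block_sum b i j"
proof (induction "i + j" arbitrary: i j rule: less_induct)
  case less
  show ?case
  proof (cases i; cases j)
    fix i' j' assume ij [simp]: "i = Suc i'" "j = Suc j'"
    have 1: "lpp (bump b) (Suc i') j' + lpp b (Suc i') j' \<le> block_sum b (Suc i') j'"
      and 2: "lpp (bump b) i' (Suc j') + lpp b i' (Suc j') \<le> block_sum b i' (Suc j')"
      using less by auto
    have 3: "lpp (bump b) (Suc i') (Suc j') = max (lpp (bump b) i' (Suc j')) (lpp (bump b) (Suc i') j')
        + (min (lpp b i' (Suc j')) (lpp b (Suc i') j') - lpp b i' j')"
      and 4: "lpp b (Suc i') (Suc j') = max (lpp b i' (Suc j')) (lpp b (Suc i') j') + b (Suc i') (Suc j')"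
      by simp_all
    have 5: "(\<Sum>y=1..Suc j'. b (Suc i') y) = (\<Sum>y=1..j'. b (Suc i') y) + b (Suc i') (Suc j')"
      "(\<Sum>x=1..Suc i'. b x (Suc j')) = (\<Sum>x=1..i'. b x (Suc j')) + b (Suc i') (Suc j')"
      by simp_all
    show ?thesis
      using 1 2 5 lpp_Suc1_le[of b i' j'] lpp_Suc2_le[of b i' j']
        lpp_mono1[of b i' j'] lpp_mono2[of b i' j']
        block_sum_Suc1[of b i' "Suc j'"] block_sum_Suc2[of b "Suc i'" j']
      unfolding ij 3 4 by linarith
  qed simp_all
qed

definition dominant :: "(nat \<Rightarrow> nat \<Rightarrow> nat) \<Rightarrow> nat \<Rightarrow> nat \<Rightarrow> bool" where
  "dominant b k l \<longleftrightarrow> (\<forall>M N. (\<Sum>x\<in>{1..M}-{k}. \<Sum>y\<in>{1..N}-{l}. b x y) \<le> b k l)"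

lemma dominant_transpose: "dominant b k l \<Longrightarrow> dominant (\<lambda>i j. b j i) l k"
  unfolding dominant_def by (subst sum.swap) blast

text \<open>Going from row k down to row i in the columns before l adds at most the entries of a
  block outside row k and column l, hence at most \<open>b k l\<close>. A path that ends at (k, l)
  collects that entry instead.\<close>

lemma lpp_le_of_dominant:
  assumes "dominant b k l" "1 \<le> k" "k < i" "1 \<le> l"
  shows "lpp b i (l - 1) \<le> lpp b (i - 1) l"
proof -
  have "lpp b i' (l - 1) \<le> lpp b k (l - 1) + (\<Sum>x\<in>{k<..i'}. \<Sum>y=1..l-1. b x y)" if "k \<le> i'" for i'
    using that
  proof (induction i' rule: dec_induct)
    case (step i')
    have "{k<..Suc i'} = insert (Suc i') {k<..i'}" using step by auto
    thus ?case using step lpp_Suc1_le[of b i' "l - 1"] by simp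
  qed simp
  hence "lpp b i (l - 1) \<le> lpp b k (l - 1) + (\<Sum>x\<in>{k<..i}. \<Sum>y=1..l-1. b x y)"
    using assms by simp
  also have "(\<Sum>x\<in>{k<..i}. \<Sum>y=1..l-1. b x y) \<le> (\<Sum>x\<in>{1..i}-{k}. \<Sum>y\<in>{1..l}-{l}. b x y)"
    by (rule order_trans[OF sum_mono sum_mono2]) (auto intro!: sum_mono2)
  also have "\<dots> \<le> b k l" using assms by (auto simp: dominant_def)
  also have "lpp b k (l - 1) + b k l \<le> lpp b k l" using assms by (cases k; cases l) auto
  also have "\<dots> \<le> lpp b (i - 1) l" using assms by (intro lpp_mono) auto
  finally show ?thesis by simp
qed

context
  fixes b b' :: "nat \<Rightarrow> nat \<Rightarrow> nat" and k l :: nat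
  assumes dom: "dominant b k l" and kl: "1 \<le> k" "1 \<le> l"
    and b': "\<And>i j. b' i j = b i j + (if i = k \<and> j = l then 1 else 0)"
begin

text \<open>In column l below row k the upper predecessor gains the unit and the left one does not;
  in row k to the right of column l it is the reverse. In both cases the gaining predecessor is the
  larger one, so the unit passes on through the maximum.\<close>

lemma dominant_lpp_le:
  "k < Suc i \<Longrightarrow> l = Suc j \<Longrightarrow> k \<noteq> Suc i \<Longrightarrow> lpp b (Suc i) j \<le> lpp b i (Suc j)"
  "l < Suc j \<Longrightarrow> k = Suc i \<Longrightarrow> l \<noteq> Suc j \<Longrightarrow> lpp b i (Suc j) \<le> lpp b (Suc i) j"
  using lpp_le_of_dominant[OF dom, of "Suc i"] kl
    lpp_le_of_dominant[OF dominant_transpose[OF dom], of "Suc j"]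
    lpp_transpose[of b "Suc j" i] lpp_transpose[of b j "Suc i"] lpp_transpose[of b i "Suc j"] lpp_transpose[of b "Suc i" j]
  by auto

lemma lpp_add_unit: "lpp b' i j = lpp b i j + (if k \<le> i \<and> l \<le> j then 1 else 0)"
proof (induction "i + j" arbitrary: i j rule: less_induct)
  case less
  show ?case
  proof (cases i; cases j)
    fix i' j' assume [simp]: "i = Suc i'" "j = Suc j'"
    have IH: "lpp b' i' (Suc j') = lpp b i' (Suc j') + (if k \<le> i' \<and> l \<le> Suc j' then 1 else 0)"
      "lpp b' (Suc i') j' = lpp b (Suc i') j' + (if k \<le> Suc i' \<and> l \<le> j' then 1 else 0)"
      using less by auto
    show ?thesis using dominant_lpp_le(1)[of i' j'] dominant_lpp_le(2)[of j' i'] by (auto simp: IH b' max_def)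
  qed (use kl in auto)
qed

text \<open>If only one of the two neighbours gains the unit, the minimum is attained by the other
  one and the diagonal value is unchanged. If both gain it, so does the diagonal value, and the
  difference is the same.\<close>

lemma bump_add_unit: "bump b' = bump b"
proof (intro ext)
  fix i j show "bump b' i j = bump b i j"
  proof (cases i; cases j)
    fix i' j' assume "i = Suc i'" "j = Suc j'"
    thus ?thesis using dominant_lpp_le(1)[of i' j'] dominant_lpp_le(2)[of j' i']
        lpp_mono1[of b i' j'] lpp_mono2[of b i' j']
      by (auto simp: lpp_add_unit min_def)
  qed auto
qed

lemma bump_pow_add_unit: "0 < r \<Longrightarrow> (bump ^^ r) b' = (bump ^^ r) b"
  by (cases r) (simp_all add: funpow_Suc_right bump_add_unit del: funpow.simps)

end

text \<open>The letter k may be placed anywhere before, inside or after the block of letters k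
  already present. This freedom allows one cut to serve both first rows.\<close>

lemma sorted_insert_at:
  assumes "sorted xs" "\<And>i. i < k \<Longrightarrow> cnt xs i \<le> c" "c \<le> cnt xs k"
  shows "sorted (take c xs @ k # drop c xs)"
  using assms
proof (induction xs arbitrary: c)
  case (Cons x xs)
  show ?case
  proof (cases c)
    case 0
    have "k \<le> x" using Cons.prems(2)[of x] 0 by (cases "x < k") auto
    thus ?thesis using Cons.prems 0 by (auto intro: order_trans)
  next
    case (Suc c')
    have "x \<le> k"
    proof (rule ccontr)
      assume "\<not> x \<le> k"
      hence "cnt (x # xs) k = 0" using Cons.prems(1) by (intro cnt_none) auto
      thus False using Cons.prems Suc by simp
    qed
    moreover have "sorted (take c' xs @ k # drop c' xs)"
      using Cons.prems \<open>x \<le> k\<close> Suc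
    proof (intro Cons.IH)
      fix i assume "i < k"
      show "cnt xs i \<le> c'"
      proof (cases "x \<le> i")
        case True thus ?thesis using Cons.prems(2)[OF \<open>i < k\<close>] Suc by simp
      next
        case False
        hence "cnt xs i = 0" using Cons.prems(1) by (intro cnt_none) auto
        thus ?thesis by simp
      qed
    qed auto
    moreover have "\<forall>y\<in>set (take c' xs) \<union> set (drop c' xs). x \<le> y"
      using Cons.prems(1) by (auto dest: in_set_takeD in_set_dropD)
    ultimately show ?thesis by (auto simp: Suc)
  qed
qed auto

lemma cnt_insert_at: "cnt (take c xs @ k # drop c xs) i = cnt xs i + (if k \<le> i then 1 else 0)"
proof -
  have "cnt xs i = cnt (take c xs) i + cnt (drop c xs) i"
    by (metis append_take_drop_id cnt_simps(3))
  thus ?thesis by simp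
qed

lemma prod_insert_at:
  fixes f :: "nat \<Rightarrow> 'a::comm_monoid_mult"
  assumes "c \<le> N"
  shows "(\<Prod>x<Suc N. if x < c then f x else if x = c then z else f (x - 1)) = z * (\<Prod>x<N. f x)"
  using assms
proof (induction N)
  case (Suc N)
  show ?case
  proof (cases "c = Suc N")
    case True
    thus ?thesis by (simp add: mult.commute)
  next
    case False
    hence "c \<le> N" using Suc.prems by simp
    thus ?thesis using Suc.IH by (subst prod.lessThan_Suc) (auto simp: mult_ac)
  qed
qed auto

lemma zminor_single: "zminor [i] [j] = zvar i j"
  by (simp add: zminor_def det_single)

text \<open>All lower rows end before the cut, so the new column is a single box and contributes the
  variable; the columns to its left stay and those to its right move by one.\<close>

lemma bitableau_insert_at:
  assumes len: "length p = length q" "c \<le> length p"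
    and T: "\<forall>r\<in>set T. length r \<le> c" and U: "\<forall>r\<in>set U. length r \<le> c"
  shows "bitableau ((take c p @ k # drop c p) # T) ((take c q @ l # drop c q) # U)
    = zvar k l * bitableau (p # T) (q # U)"
proof -
  have short: "tab_column V x = []" if "\<forall>r\<in>set V. length r \<le> c" "c \<le> x" for V x
    using that by (auto simp: tab_column_def filter_empty_conv)
  have col: "tab_column ((take c p @ k # drop c p) # T) x =
      (if x < c then tab_column (p # T) x else if x = c then [k] else tab_column (p # T) (x - 1))"
    if "\<forall>r\<in>set T. length r \<le> c" "c \<le> length p" "x < Suc (length p)" for p :: "nat list" and T x k
    using that short[OF that(1), of x] short[OF that(1), of "x - 1"]
    by (auto simp: tab_column_Cons nth_append nth_Cons')
  have "bitableau ((take c p @ k # drop c p) # T) ((take c q @ l # drop c q) # U)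
    = (\<Prod>x<Suc (length p). if x < c then zminor (tab_column (p # T) x) (tab_column (q # U) x)
        else if x = c then zvar k l
        else zminor (tab_column (p # T) (x - 1)) (tab_column (q # U) (x - 1)))"
    unfolding bitableau_def
    by (rule prod.cong) (use col[OF T] col[OF U] len in \<open>auto simp: num_columns_def zminor_single\<close>)
  also have "\<dots> = zvar k l * (\<Prod>x<length p. zminor (tab_column (p # T) x) (tab_column (q # U) x))"
    by (rule prod_insert_at[OF len(2)])
  also have "\<dots> = zvar k l * bitableau (p # T) (q # U)"
    by (simp add: bitableau_def num_columns_def)
  finally show ?thesis .
qed

lemma bitableau_trow_tl: "map length P = map length Q \<Longrightarrow>
    bitableau (trow P 0 # tl P) (trow Q 0 # tl Q) = bitableau P Q"
  by (cases P; cases Q) (auto simp: bitableau_def num_columns_def)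

lemma in_set_trow: "x \<in> set T \<Longrightarrow> \<exists>r. x = trow T r"
  by (metis in_set_conv_nth trow_def)

lemma trow_tl: "trow (tl P) r = trow P (Suc r)"
  by (cases P) auto

lemma lookup_zvar_mult:
  "Poly_Mapping.lookup (zvar k l * f) (\<alpha> + Poly_Mapping.single (k, l) 1) = Poly_Mapping.lookup f \<alpha>"
proof (induction f rule: poly_mapping_add_induct)
  case (single x c)
  show ?case by (auto simp: zvar_def zmonom_def mult_single lookup_single when_def add.commute)
qed (auto simp: distrib_left lookup_add)

lemma block_sum_entry: "block_sum (entry \<alpha>) m n = (\<Sum>i=1..m. row_sum n \<alpha> i)"
  by (simp add: block_sum_def row_sum_def)

lemma block_sum_cross:
  assumes "k \<in> {1..m}" "l \<in> {1..n}"
  shows "block_sum b m n + b k l = (\<Sum>y=1..n. b k y) + (\<Sum>x=1..m. b x l)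
    + (\<Sum>x\<in>{1..m}-{k}. \<Sum>y\<in>{1..n}-{l}. b x y)"
proof -
  have "block_sum b m n = (\<Sum>y=1..n. b k y) + (\<Sum>x\<in>{1..m}-{k}. \<Sum>y=1..n. b x y)"
    unfolding block_sum_def using assms by (subst sum.remove[of _ k]) auto
  also have "(\<Sum>x\<in>{1..m}-{k}. \<Sum>y=1..n. b x y) = (\<Sum>x\<in>{1..m}-{k}. b x l + (\<Sum>y\<in>{1..n}-{l}. b x y))"
    using assms by (intro sum.cong refl sum.remove) auto
  moreover have "(\<Sum>x=1..m. b x l) = b k l + (\<Sum>x\<in>{1..m}-{k}. b x l)"
    using assms by (subst sum.remove[of _ k]) auto
  ultimately show ?thesis by (simp add: sum.distrib)
qed

text \<open>Row k and column l overlap in one entry, so by \<open>block_sum_cross\<close> the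
  hypothesis bounds the entries outside them by that entry. Larger blocks only add zeros.\<close>

lemma dominant_entry:
  assumes \<alpha>: "\<alpha> \<in> expmats m n" and kl: "k \<in> {1..m}" "l \<in> {1..n}"
    and big: "block_sum (entry \<alpha>) m n \<le> row_sum n \<alpha> k + col_sum m \<alpha> l"
  shows "dominant (entry \<alpha>) k l"
  unfolding dominant_def
proof (intro allI)
  fix M N
  have "(\<Sum>x\<in>{1..M}-{k}. \<Sum>y\<in>{1..N}-{l}. entry \<alpha> x y)
      = (\<Sum>(x, y)\<in>({1..M}-{k}) \<times> ({1..N}-{l}). entry \<alpha> x y)"
    by (rule sum.cartesian_product)
  also have "\<dots> = (\<Sum>(x, y)\<in>({1..M}-{k}) \<times> ({1..N}-{l}) \<inter> {1..m} \<times> {1..n}. entry \<alpha> x y)"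
    by (rule sum.mono_neutral_right) (auto intro!: entry_outside[OF \<alpha>] simp del: atLeastAtMost_iff)
  also have "\<dots> \<le> (\<Sum>(x, y)\<in>({1..m}-{k}) \<times> ({1..n}-{l}). entry \<alpha> x y)"
    by (rule sum_mono2) auto
  also have "\<dots> = (\<Sum>x\<in>{1..m}-{k}. \<Sum>y\<in>{1..n}-{l}. entry \<alpha> x y)"
    by (rule sum.cartesian_product[symmetric])
  also have "\<dots> \<le> entry \<alpha> k l"
    using block_sum_cross[OF kl, of "entry \<alpha>"] big by (simp add: row_sum_def col_sum_def)
  finally show "(\<Sum>x\<in>{1..M}-{k}. \<Sum>y\<in>{1..N}-{l}. entry \<alpha> x y) \<le> entry \<alpha> k l" .
qed

text \<open>
  At a dominant position the first rows of both tableaux can be cut at a common place, to the right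
  of all columns of length greater than 1; the new letters form a column of their own there.
\<close>

lemma diag_coeff_add_unit:
  assumes \<alpha>: "\<alpha> \<in> expmats m n" and kl: "k \<in> {1..m}" "l \<in> {1..n}"
    and big: "block_sum (entry \<alpha>) m n \<le> row_sum n \<alpha> k + col_sum m \<alpha> l"
  shows "diag_coeff m n (\<alpha> + Poly_Mapping.single (k, l) 1) = diag_coeff m n \<alpha>"
proof -
  define b where "b = entry \<alpha>"
  define \<alpha>' where "\<alpha>' = \<alpha> + Poly_Mapping.single (k, l) 1"
  have \<alpha>': "\<alpha>' \<in> expmats m n" unfolding \<alpha>'_def
    by (intro expmats_add \<alpha>) (use kl in \<open>auto simp: expmats_def\<close>)
  have b': "entry \<alpha>' i j = b i j + (if i = k \<and> j = l then 1 else 0)" for i j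
    by (auto simp: b_def \<alpha>'_def entry_add) (auto simp: entry_def lookup_single when_def)
  have dom: "dominant b k l" unfolding b_def by (rule dominant_entry[OF assms])
  have kl': "1 \<le> k" "1 \<le> l" using kl by auto
  note shift = lpp_add_unit[OF dom kl' b'] bump_pow_add_unit[OF dom kl' b']
  obtain P Q P' Q' where R: "RSK m n \<alpha> = (P, Q)" "RSK m n \<alpha>' = (P', Q')" by fastforce
  note P = RSK_P[OF \<alpha> R(1), folded b_def] and P' = RSK_P[OF \<alpha>' R(2)]
    and Q = RSK_Q[OF \<alpha> R(1), folded b_def] and Q' = RSK_Q[OF \<alpha>' R(2)]
  have len: "length (trow P r) = lpp ((bump ^^ r) b) m n" for r
    unfolding b_def by (rule length_trow_RSK[OF \<alpha> R(1)])
  have lenQ: "length (trow Q r) = length (trow P r)" for r using length_trow[OF Q(4)] by simp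
  let ?L = "lpp b" and ?s = "lpp (bump b) m n"
  let ?d = "block_sum b m n" and ?row = "\<Sum>y=1..n. b k y" and ?col = "\<Sum>x=1..m. b x l"
  have d: "?d \<le> ?row + ?col" using big by (simp add: b_def row_sum_def col_sum_def)
  have row: "?row \<le> ?L k n" and col: "?col \<le> ?L m l"
    using row_le_lpp column_le_lpp kl' by auto
  \<comment> \<open>The rows above k contain at most d minus the sum of row k, hence at most the sum
    of column l, which is at most \<open>?L m l\<close>. For the columns before l the argument is
    symmetric.\<close>
  have "?L (k - 1) n \<le> block_sum b (k - 1) n" by (rule lpp_le_block_sum)
  moreover have "block_sum b (k - 1) n + ?row = block_sum b k n"
    using block_sum_Suc1[of b "k - 1" n] kl' by simp
  moreover have "block_sum b k n \<le> ?d" unfolding block_sum_def using kl by (intro sum_mono2) auto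
  ultimately have c1: "?L (k - 1) n \<le> ?L m l" using d col by linarith
  have "?L m (l - 1) \<le> block_sum b m (l - 1)" by (rule lpp_le_block_sum)
  moreover have "block_sum b m (l - 1) + ?col = block_sum b m l"
    using block_sum_Suc2[of b m "l - 1"] kl' by simp
  moreover have "block_sum b m l \<le> ?d" unfolding block_sum_def using kl
    by (intro sum_mono sum_mono2) auto
  ultimately have c2: "?L m (l - 1) \<le> ?L k n" using d row by linarith
  have mono: "?L k n \<le> ?L m n" "?L m l \<le> ?L m n" "?L (k - 1) n \<le> ?L k n" "?L m (l - 1) \<le> ?L m l"
    using kl by (auto intro!: lpp_mono)
  \<comment> \<open>The first two rows together have at most d letters and the first has at least
    the sum of column l, so the second has at most the sum of row k; likewise with row and column
    exchanged.\<close>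
  have c3: "?s \<le> ?L k n" "?s \<le> ?L m l"
    using lpp_add_lpp_bump_le[of b m n] d row col mono by linarith+
  \<comment> \<open>The least cut that clears the second row, the letters below k in P and the
    letters below l in Q.\<close>
  define c where "c = max ?s (max (?L (k - 1) n) (?L m (l - 1)))"
  have c: "?s \<le> c" "?L (k - 1) n \<le> c" "c \<le> ?L k n" "?L m (l - 1) \<le> c" "c \<le> ?L m l" "c \<le> ?L m n"
    using c1 c2 c3 mono by (auto simp: c_def le_max_iff_disj)
  have restP: "trow P' (Suc r) = trow P (Suc r)" for r
    by (rule sorted_eq_of_cnt)
      (simp_all only: trow_sorted[OF P(2)] trow_sorted[OF P'(2)] P(1) P'(1) shift(2)[OF zero_less_Suc])
  have restQ: "trow Q' (Suc r) = trow Q (Suc r)" for r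
    by (rule sorted_eq_of_cnt)
      (simp_all only: Q Q'(2) Q'(1) shift(2)[OF zero_less_Suc])
  note rest = restP restQ
  let ?p = "trow P 0" and ?q = "trow Q 0"
  have p: "trow P' 0 = take c ?p @ k # drop c ?p"
  proof (rule sorted_eq_of_cnt)
    show "sorted (take c ?p @ k # drop c ?p)"
    proof (rule sorted_insert_at)
      fix i assume "i < k"
      hence "?L i n \<le> ?L (k - 1) n" by (intro lpp_mono) auto
      thus "cnt ?p i \<le> c" using c by (simp add: P(1))
    qed (use P(2) c in \<open>auto simp: trow_sorted P(1)\<close>)
    show "cnt (trow P' 0) i = cnt (take c ?p @ k # drop c ?p) i" for i
      using kl by (simp add: cnt_insert_at P(1) P'(1) shift(1) del: cnt_simps)
  qed (use P'(2) trow_sorted in auto)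
  have q: "trow Q' 0 = take c ?q @ l # drop c ?q"
  proof (rule sorted_eq_of_cnt)
    show "sorted (take c ?q @ l # drop c ?q)"
    proof (rule sorted_insert_at)
      fix i assume "i < l"
      hence "?L m (min i n) \<le> ?L m (l - 1)" by (intro lpp_mono) auto
      thus "cnt ?q i \<le> c" using c by (simp add: Q(1))
    qed (use Q(2) c kl in \<open>auto simp: trow_sorted Q(1)\<close>)
    show "cnt (trow Q' 0) i = cnt (take c ?q @ l # drop c ?q) i" for i
      using kl by (simp add: cnt_insert_at Q(1) Q'(1) shift(1) del: cnt_simps)
  qed (use Q'(2) in auto)
  have ne: "[] \<notin> set (tl P)" "[] \<notin> set (tl Q)" using P(3) Q(3) by (cases P; cases Q; simp)+
  have P'eq: "P' = (take c ?p @ k # drop c ?p) # tl P"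
  proof (rule trow_eqI)
    show "trow P' r = trow ((take c ?p @ k # drop c ?p) # tl P) r" for r
      using p rest by (cases r) (auto simp: trow_tl)
  qed (use P'(3) ne in auto)
  have Q'eq: "Q' = (take c ?q @ l # drop c ?q) # tl Q"
  proof (rule trow_eqI)
    show "trow Q' r = trow ((take c ?q @ l # drop c ?q) # tl Q) r" for r
      using q rest by (cases r) (auto simp: trow_tl)
  qed (use Q'(3) ne in auto)
  have short: "length (trow P (Suc r)) \<le> c" for r
    using lpp_bump_pow_le[of r "bump b" m n] c(1) by (simp add: len funpow_swap1)
  have tlP: "\<forall>r\<in>set (tl P). length r \<le> c" "\<forall>r\<in>set (tl Q). length r \<le> c"
    using short lenQ in_set_trow by (fastforce simp: trow_tl)+
  have "bitableau P' Q' = zvar k l * bitableau P Q"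
    unfolding P'eq Q'eq
    by (subst bitableau_insert_at) (use lenQ c len[of 0] tlP bitableau_trow_tl[OF Q(4)] in auto)
  thus ?thesis using lookup_zvar_mult[of k l "bitableau P Q" \<alpha>]
    by (simp only: diag_coeff_eq[OF R(1)] \<alpha>'_def[symmetric] diag_coeff_eq[OF R(2)])
qed

section \<open>Traces on weight spaces\<close>

definition weight_mats :: "nat list \<Rightarrow> nat list \<Rightarrow> expmat set" where
  "weight_mats \<sigma> \<pi> = {\<alpha> \<in> expmats (length \<sigma>) (length \<pi>).
     (\<forall>i\<in>{1..length \<sigma>}. row_sum (length \<pi>) \<alpha> i = \<sigma> ! (i - 1)) \<and>
     (\<forall>j\<in>{1..length \<pi>}. col_sum (length \<sigma>) \<alpha> j = \<pi> ! (j - 1))}"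

definition deg_mats :: "nat \<Rightarrow> nat \<Rightarrow> nat \<Rightarrow> expmat set" where
  "deg_mats m n d = {\<alpha> \<in> expmats m n. block_sum (entry \<alpha>) m n = d}"

lemma expmats_eqI:
  assumes "\<alpha> \<in> expmats m n" "\<beta> \<in> expmats m n"
    "\<And>i j. i \<in> {1..m} \<Longrightarrow> j \<in> {1..n} \<Longrightarrow> entry \<alpha> i j = entry \<beta> i j"
  shows "\<alpha> = \<beta>"
proof (rule poly_mapping_eqI)
  fix x :: "nat \<times> nat"
  obtain i j where x: "x = (i, j)" by fastforce
  show "Poly_Mapping.lookup \<alpha> x = Poly_Mapping.lookup \<beta> x"
    using assms(3)[of i j] entry_outside[OF assms(1), of i j] entry_outside[OF assms(2), of i j]
    by (cases "(i, j) \<in> {1..m} \<times> {1..n}") (auto simp: x entry_def)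
qed

lemma entry_le_block_sum: "i \<in> {1..m} \<Longrightarrow> j \<in> {1..n} \<Longrightarrow> b i j \<le> block_sum b m n"
  unfolding block_sum_def
  by (meson finite_atLeastAtMost member_le_sum order_trans zero_le)

lemma finite_deg_mats: "finite (deg_mats m n d)"
proof -
  let ?I = "{1..m} \<times> {1..n}"
  let ?g = "\<lambda>\<alpha> :: expmat. restrict (Poly_Mapping.lookup \<alpha>) ?I"
  have "?g ` deg_mats m n d \<subseteq> ?I \<rightarrow>\<^sub>E {..d}"
  proof -
    have "Poly_Mapping.lookup \<alpha> (i, j) \<le> d" if "\<alpha> \<in> deg_mats m n d" "(i, j) \<in> ?I" for \<alpha> i j
      using entry_le_block_sum[of i m j n "entry \<alpha>"] that by (auto simp: deg_mats_def entry_def)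
    thus ?thesis unfolding image_subset_iff restrict_PiE_iff by auto
  qed
  hence "finite (?g ` deg_mats m n d)" by (rule finite_subset) (auto intro: finite_PiE)
  moreover have "inj_on ?g (deg_mats m n d)"
  proof (rule inj_onI)
    fix \<alpha> \<beta> assume *: "\<alpha> \<in> deg_mats m n d" "\<beta> \<in> deg_mats m n d" "?g \<alpha> = ?g \<beta>"
    show "\<alpha> = \<beta>"
    proof (rule expmats_eqI)
      fix i j assume "i \<in> {1..m}" "j \<in> {1..n}"
      thus "entry \<alpha> i j = entry \<beta> i j"
        using fun_cong[OF *(3), of "(i, j)"] by (simp add: entry_def)
    qed (use * in \<open>auto simp: deg_mats_def\<close>)
  qed
  ultimately show ?thesis by (rule finite_imageD)
qed

lemma sum_list_conv_sum1: "sum_list xs = (\<Sum>i=1..length xs. xs ! (i - 1))"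
proof -
  have "sum_list xs = (\<Sum>i<length xs. xs ! i)" by (simp add: sum_list_sum_nth lessThan_atLeast0)
  also have "\<dots> = (\<Sum>i=1..length xs. xs ! (i - 1))"
    by (rule sum.reindex_bij_witness[of _ "\<lambda>i. i - 1" Suc]) auto
  finally show ?thesis .
qed

lemma weight_mats_expmats: "\<alpha> \<in> weight_mats \<sigma> \<pi> \<Longrightarrow> \<alpha> \<in> expmats (length \<sigma>) (length \<pi>)"
  by (simp add: weight_mats_def)

lemma weight_mats_deg: "\<alpha> \<in> weight_mats \<sigma> \<pi> \<Longrightarrow> \<alpha> \<in> deg_mats (length \<sigma>) (length \<pi>) (sum_list \<sigma>)"
  by (auto simp: weight_mats_def deg_mats_def block_sum_entry sum_list_conv_sum1[of \<sigma>])

lemma finite_weight_mats: "finite (weight_mats \<sigma> \<pi>)"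
  using weight_mats_deg finite_deg_mats by (metis finite_subset subsetI)

lemma keys_RSK_op:
  assumes "\<alpha> \<in> expmats m n" "\<beta> \<in> Poly_Mapping.keys (RSK_op m n (zmonom \<alpha>))"
  shows "\<beta> \<in> expmats m n" "row_sum n \<beta> = row_sum n \<alpha>" "col_sum m \<beta> = col_sum m \<alpha>"
  using RSK_op_homogeneous[OF assms(1)] assms(2) by (auto simp: homogeneous_def)

lemma Tr_RSK_weight_eq:
  "Tr_RSK_weight \<sigma> \<pi> = (\<Sum>\<alpha>\<in>weight_mats \<sigma> \<pi>. diag_coeff (length \<sigma>) (length \<pi>) \<alpha>)"
proof -
  have "R_weight \<sigma> \<pi> = zpoly.span (zmonom ` weight_mats \<sigma> \<pi>)"
    by (simp add: R_weight_def weight_mats_def row_sum_def col_sum_def entry_def)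
  moreover have "Poly_Mapping.keys (RSK_op (length \<sigma>) (length \<pi>) (zmonom \<alpha>)) \<subseteq> weight_mats \<sigma> \<pi>"
    if "\<alpha> \<in> weight_mats \<sigma> \<pi>" for \<alpha>
  proof
    fix \<beta> assume "\<beta> \<in> Poly_Mapping.keys (RSK_op (length \<sigma>) (length \<pi>) (zmonom \<alpha>))"
    moreover have "\<alpha> \<in> expmats (length \<sigma>) (length \<pi>)" using that by (simp add: weight_mats_def)
    ultimately show "\<beta> \<in> weight_mats \<sigma> \<pi>" using keys_RSK_op that by (auto simp: weight_mats_def)
  qed
  ultimately show ?thesis
    unfolding Tr_RSK_weight_def diag_coeff_def
    by (simp add: trace_on_zmonom[OF finite_weight_mats RSK_op_linear])
qed

lemma Tr_RSK_eq: "Tr_RSK m n d = (\<Sum>\<alpha>\<in>deg_mats m n d. diag_coeff m n \<alpha>)"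
proof -
  have "R_deg m n d = zpoly.span (zmonom ` deg_mats m n d)"
    by (simp add: R_deg_def deg_mats_def block_sum_def entry_def)
  moreover have "Poly_Mapping.keys (RSK_op m n (zmonom \<alpha>)) \<subseteq> deg_mats m n d"
    if "\<alpha> \<in> deg_mats m n d" for \<alpha>
  proof
    fix \<beta> assume \<beta>: "\<beta> \<in> Poly_Mapping.keys (RSK_op m n (zmonom \<alpha>))"
    have "\<alpha> \<in> expmats m n" using that by (simp add: deg_mats_def)
    from keys_RSK_op[OF this \<beta>] show "\<beta> \<in> deg_mats m n d"
      using that by (simp add: deg_mats_def block_sum_entry)
  qed
  ultimately show ?thesis
    unfolding Tr_RSK_def diag_coeff_def
    by (simp add: trace_on_zmonom[OF finite_deg_mats RSK_op_linear])
qed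

definition weight_pairs :: "nat \<Rightarrow> nat \<Rightarrow> nat \<Rightarrow> wpair set" where
  "weight_pairs m n d = {(\<sigma>, \<pi>). length \<sigma> = m \<and> length \<pi> = n \<and> sum_list \<sigma> = d \<and> sum_list \<pi> = d}"

lemma finite_compositions: "finite {l :: nat list. length l = n \<and> sum_list l = d}"
proof (rule finite_subset)
  show "{l :: nat list. length l = n \<and> sum_list l = d} \<subseteq> {l. set l \<subseteq> {..d} \<and> length l = n}"
    using member_le_sum_list by (auto simp: subset_iff)
qed (rule finite_lists_length_eq, simp)

lemma weight_pairs_Times:
  "weight_pairs m n d = {l. length l = m \<and> sum_list l = d} \<times> {l. length l = n \<and> sum_list l = d}"
  by (auto simp: weight_pairs_def)

lemma finite_weight_pairs: "finite (weight_pairs m n d)"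
  unfolding weight_pairs_Times by (intro finite_SigmaI finite_compositions)

lemma block_sum_col: "block_sum (entry \<alpha>) m n = (\<Sum>j=1..n. col_sum m \<alpha> j)"
  unfolding block_sum_def col_sum_def by (rule sum.swap)

lemma map_upt_eq_iff:
  "map f [1..<m+1] = l \<longleftrightarrow> length l = m \<and> (\<forall>i\<in>{1..m}. f i = l ! (i - 1))"
proof
  assume *: "length l = m \<and> (\<forall>i\<in>{1..m}. f i = l ! (i - 1))"
  show "map f [1..<m+1] = l"
  proof (rule nth_equalityI)
    fix i assume "i < length (map f [1..<m+1])"
    thus "map f [1..<m+1] ! i = l ! i" using * bspec[of "{1..m}" _ "Suc i"] by (simp del: upt_Suc)
  qed (use * in simp)
qed (auto simp del: upt_Suc)

lemma Tr_RSK_weights: "Tr_RSK m n d = (\<Sum>(\<sigma>, \<pi>)\<in>weight_pairs m n d. Tr_RSK_weight \<sigma> \<pi>)"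
proof -
  let ?g = "\<lambda>\<alpha>. (map (row_sum n \<alpha>) [1..<m+1], map (col_sum m \<alpha>) [1..<n+1])"
  have fib: "{\<alpha> \<in> deg_mats m n d. ?g \<alpha> = (\<sigma>, \<pi>)} = weight_mats \<sigma> \<pi>" if "(\<sigma>, \<pi>) \<in> weight_pairs m n d" for \<sigma> \<pi>
    using that weight_mats_deg
    by (auto simp: weight_pairs_def weight_mats_def map_upt_eq_iff deg_mats_def simp del: upt_Suc One_nat_def)
  have "?g ` deg_mats m n d \<subseteq> weight_pairs m n d"
  proof
    fix v assume "v \<in> ?g ` deg_mats m n d"
    then obtain \<alpha> where \<alpha>: "\<alpha> \<in> deg_mats m n d" and v: "v = ?g \<alpha>" by blast
    have "sum_list (map f [1..<k+1]) = (\<Sum>i=1..k. f i)" for f :: "nat \<Rightarrow> nat" and k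
      by (induction k) auto
    thus "v \<in> weight_pairs m n d" using \<alpha> block_sum_entry[of \<alpha> m n] block_sum_col[of \<alpha> m n]
      by (simp add: v weight_pairs_def deg_mats_def del: upt_Suc)
  qed
  from sum.group[OF finite_deg_mats finite_weight_pairs this, of "diag_coeff m n"]
  have "Tr_RSK m n d = (\<Sum>v\<in>weight_pairs m n d. \<Sum>\<alpha>\<in>{\<alpha> \<in> deg_mats m n d. ?g \<alpha> = v}. diag_coeff m n \<alpha>)"
    by (simp add: Tr_RSK_eq)
  also have "\<dots> = (\<Sum>(\<sigma>, \<pi>)\<in>weight_pairs m n d. Tr_RSK_weight \<sigma> \<pi>)"
  proof (rule sum.cong[OF refl], safe)
    fix \<sigma> \<pi> assume *: "(\<sigma>, \<pi>) \<in> weight_pairs m n d"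
    hence "length \<sigma> = m" "length \<pi> = n" by (auto simp: weight_pairs_def)
    thus "(\<Sum>\<alpha>\<in>{\<alpha> \<in> deg_mats m n d. ?g \<alpha> = (\<sigma>, \<pi>)}. diag_coeff m n \<alpha>) = Tr_RSK_weight \<sigma> \<pi>"
      unfolding fib[OF *] Tr_RSK_weight_eq by simp
  qed
  finally show ?thesis .
qed

lemma push_swap_swap: "push prod.swap (push prod.swap \<alpha>) = (\<alpha> :: expmat)"
proof (rule poly_mapping_eqI)
  fix x :: "nat \<times> nat"
  obtain i j where "x = (i, j)" by fastforce
  thus "Poly_Mapping.lookup (push prod.swap (push prod.swap \<alpha>)) x = Poly_Mapping.lookup \<alpha> x"
    using entry_push_swap by (simp add: entry_def)
qed

lemma weight_mats_swap: "\<alpha> \<in> weight_mats \<sigma> \<pi> \<Longrightarrow> push prod.swap \<alpha> \<in> weight_mats \<pi> \<sigma>"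
  by (auto simp: weight_mats_def push_swap_expmats row_sum_def col_sum_def entry_push_swap)

lemma Tr_RSK_weight_swap: "Tr_RSK_weight \<pi> \<sigma> = Tr_RSK_weight \<sigma> \<pi>"
  unfolding Tr_RSK_weight_eq
  by (rule sum.reindex_bij_witness[of _ "push prod.swap" "push prod.swap"])
    (auto simp: push_swap_swap weight_mats_swap diag_coeff_transpose[OF weight_mats_expmats])

text \<open>Deleting a row that the weight forces to vanish is a bijection between the two sets of
  matrices, and it preserves diagonal coefficients.\<close>

lemma Tr_RSK_weight_zero_row: "Tr_RSK_weight (\<sigma>1 @ 0 # \<sigma>2) \<pi> = Tr_RSK_weight (\<sigma>1 @ \<sigma>2) \<pi>"
proof -
  define k where "k = Suc (length \<sigma>1)"
  define m where "m = length (\<sigma>1 @ \<sigma>2)"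
  define n where "n = length \<pi>"
  let ?\<sigma> = "\<sigma>1 @ \<sigma>2" and ?\<sigma>' = "\<sigma>1 @ 0 # \<sigma>2"
  define e where "e = map_prod (skip k) (id :: nat \<Rightarrow> nat)"
  have inj: "inj (skip k)" using strict_mono_skip by (rule strict_mono_imp_inj_on)
  hence e: "inj e" unfolding e_def by (rule inj_map_prod_id)
  have k: "1 \<le> k" "k \<le> Suc m" by (auto simp: k_def m_def)
  have rows: "{1..Suc m} = insert k (skip k ` {1..m})"
  proof -
    have "i \<in> skip k ` {1..m}" if "i \<in> {1..Suc m}" "i \<noteq> k" for i
      by (rule image_eqI[of _ _ "if i < k then i else i - 1"]) (use that k in \<open>auto simp: skip_def\<close>)
    moreover have "insert k (skip k ` {1..m}) \<subseteq> {1..Suc m}" using k by (auto simp: skip_def)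
    ultimately show ?thesis by blast
  qed
  have knot: "k \<notin> skip k ` A" for A using skip_ne[of k] by (auto simp: eq_commute)
  have nth: "?\<sigma>' ! (skip k i - Suc 0) = ?\<sigma> ! (i - Suc 0)" if "i \<ge> 1" for i
    using that by (auto simp: k_def skip_def nth_append nth_Cons')
  have nthk: "?\<sigma>' ! (k - Suc 0) = 0" by (simp add: k_def nth_append)
  have push: "entry (push e \<alpha>) (skip k i) j = entry \<alpha> i j" "entry (push e \<alpha>) k j = 0" for \<alpha> :: expmat and i j
    using lookup_push[OF e, of \<alpha> "(i, j)"] lookup_push_notin[of "(k, j)" e \<alpha>] skip_ne[of k, symmetric]
    by (auto simp: entry_def e_def)
  have iff: "push e \<alpha> \<in> weight_mats ?\<sigma>' \<pi> \<longleftrightarrow> \<alpha> \<in> weight_mats ?\<sigma> \<pi>" for \<alpha> :: expmat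
  proof -
    have len: "length ?\<sigma>' = Suc m" "length ?\<sigma> = m" "length \<pi> = n" by (auto simp: m_def n_def)
    have "push e \<alpha> \<in> expmats (Suc m) n \<longleftrightarrow> \<alpha> \<in> expmats m n"
    proof -
      have "skip k i \<in> {1..Suc m} \<longleftrightarrow> i \<in> {1..m}" for i
        unfolding rows using knot skip_ne[of k] inj by (auto simp: inj_image_mem_iff)
      hence "e ` A \<subseteq> {1..Suc m} \<times> {1..n} \<longleftrightarrow> A \<subseteq> {1..m} \<times> {1..n}" for A
        unfolding e_def image_subset_iff by (simp add: subset_iff Ball_def split_paired_All)
      thus ?thesis by (simp add: expmats_def keys_push[OF e])
    qed
    moreover have "row_sum n (push e \<alpha>) k = 0" "row_sum n (push e \<alpha>) (skip k i) = row_sum n \<alpha> i" for i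
      by (simp_all add: row_sum_def push)
    moreover have "col_sum (Suc m) (push e \<alpha>) j = col_sum m \<alpha> j" for j
      unfolding col_sum_def rows using knot inj
      by (subst sum.insert) (auto simp: push sum.reindex inj_on_subset[OF inj])
    ultimately show ?thesis unfolding weight_mats_def len rows
      by (auto simp: nth nthk)
  qed
  have pull: "Poly_Mapping.map_key e (push e \<alpha>) = \<alpha>" for \<alpha> :: expmat
    by (rule poly_mapping_eqI) (simp add: map_key.rep_eq[OF e] lookup_push[OF e])
  \<comment> \<open>Nothing is lost by forgetting row k, because its sum is 0.\<close>
  have push_pull: "push e (Poly_Mapping.map_key e \<beta>) = \<beta>" if "\<beta> \<in> weight_mats ?\<sigma>' \<pi>" for \<beta>
  proof (rule poly_mapping_eqI)
    fix x :: "nat \<times> nat"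
    obtain i j where x: "x = (i, j)" by fastforce
    have \<beta>: "\<beta> \<in> expmats (Suc m) n" "row_sum n \<beta> k = 0"
      using that k nthk by (auto simp: weight_mats_def m_def n_def)
    have zero: "entry \<beta> k j = 0" using \<beta>(2) entry_outside[OF \<beta>(1), of k j]
      by (cases "j \<in> {1..n}") (auto simp: row_sum_def)
    show "Poly_Mapping.lookup (push e (Poly_Mapping.map_key e \<beta>)) x = Poly_Mapping.lookup \<beta> x"
    proof (cases "i = k")
      case True
      thus ?thesis using zero push(2)[of "Poly_Mapping.map_key e \<beta>" j] by (simp add: x entry_def)
    next
      case False
      have "x = e ((if i < k then i else i - 1), j)" using False by (auto simp: x e_def skip_def)
      thus ?thesis by (simp only: lookup_push[OF e] map_key.rep_eq[OF e] o_apply)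
    qed
  qed
  have "length ?\<sigma>' = Suc m" "length ?\<sigma> = m" by (auto simp: m_def)
  thus ?thesis unfolding Tr_RSK_weight_eq
    by (intro sum.reindex_bij_witness[of _ "push e" "Poly_Mapping.map_key e"])
      (use push_pull iff pull diag_coeff_insert_zero_row[OF k, folded e_def] in \<open>auto, metis+\<close>)
qed

abbreviation strip :: "nat list \<Rightarrow> nat list" where
  "strip \<equiv> filter ((<) 0)"

lemma Tr_RSK_weight_strip_rows: "Tr_RSK_weight \<sigma> \<pi> = Tr_RSK_weight (strip \<sigma>) \<pi>"
proof (induction "length \<sigma>" arbitrary: \<sigma> rule: less_induct)
  case less
  show ?case
  proof (cases "0 \<in> set \<sigma>")
    case True
    then obtain \<sigma>1 \<sigma>2 where \<sigma>: "\<sigma> = \<sigma>1 @ 0 # \<sigma>2" by (auto simp: in_set_conv_decomp)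
    thus ?thesis using less[of "\<sigma>1 @ \<sigma>2"] by (simp add: Tr_RSK_weight_zero_row)
  next
    case False
    hence "strip \<sigma> = \<sigma>" by (intro filter_True) (metis gr0I)
    thus ?thesis by simp
  qed
qed

lemma Tr_RSK_weight_strip: "Tr_RSK_weight \<sigma> \<pi> = Tr_RSK_weight (strip \<sigma>) (strip \<pi>)"
  by (metis Tr_RSK_weight_strip_rows Tr_RSK_weight_swap)

text \<open>Adding a unit at the dominant position is a bijection between the matrices of the two
  weights. It is onto since in the larger weight the chosen row and column sums add up to more than
  the degree, which forces the entry to be positive.\<close>

lemma Tr_RSK_weight_covers:
  assumes "wp_covers (\<sigma>, \<pi>) (\<sigma>', \<pi>')"
  shows "Tr_RSK_weight \<sigma>' \<pi>' = Tr_RSK_weight \<sigma> \<pi>"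
proof -
  obtain d k l where d: "sum_list \<sigma> = d" "sum_list \<pi> = d" and kl: "k < length \<sigma>" "l < length \<pi>"
    and big: "\<sigma> ! k + \<pi> ! l \<ge> d" and \<sigma>': "\<sigma>' = \<sigma>[k := \<sigma> ! k + 1]" and \<pi>': "\<pi>' = \<pi>[l := \<pi> ! l + 1]"
    using assms by (auto simp: wp_covers_def weight_pair_def)
  define m n where "m = length \<sigma>" and "n = length \<pi>"
  define E where "E = Poly_Mapping.single (Suc k, Suc l) (1::nat)"
  have kl': "Suc k \<in> {1..m}" "Suc l \<in> {1..n}" using kl by (auto simp: m_def n_def)
  have len: "length \<sigma> = m" "length \<sigma>' = m" "length \<pi> = n" "length \<pi>' = n"
    by (auto simp: m_def n_def \<sigma>' \<pi>')
  have E: "E \<in> expmats m n" using kl' by (auto simp: E_def expmats_def)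
  have Eentry: "entry E i j = (if i = Suc k then if j = Suc l then 1 else 0 else 0)" for i j
    by (auto simp: E_def entry_def lookup_single when_def)
  have Erow: "row_sum n E i = (if i = Suc k then 1 else 0)"
    and Ecol: "col_sum m E j = (if j = Suc l then 1 else 0)" for i j
    using kl' by (auto simp: row_sum_def col_sum_def Eentry)
  have s': "\<sigma>' ! (i - Suc 0) = \<sigma> ! (i - Suc 0) + (if i = Suc k then 1 else 0)" if "i \<in> {1..m}" for i
    using that kl by (auto simp: \<sigma>' m_def nth_list_update)
  have p': "\<pi>' ! (i - Suc 0) = \<pi> ! (i - Suc 0) + (if i = Suc l then 1 else 0)" if "i \<in> {1..n}" for i
    using that kl by (auto simp: \<pi>' n_def nth_list_update)
  have iff: "\<alpha> + E \<in> weight_mats \<sigma>' \<pi>' \<longleftrightarrow> \<alpha> \<in> weight_mats \<sigma> \<pi>" for \<alpha>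
  proof -
    have "\<alpha> + E \<in> expmats m n \<longleftrightarrow> \<alpha> \<in> expmats m n"
    proof
      assume "\<alpha> + E \<in> expmats m n"
      thus "\<alpha> \<in> expmats m n" by (auto simp: expmats_def in_keys_iff lookup_add subset_iff)
    qed (use E expmats_add in blast)
    thus ?thesis unfolding weight_mats_def len
      by (auto simp: row_sum_add col_sum_add Erow Ecol s' p')
  qed
  have minus: "\<beta> - E + E = \<beta>" if \<beta>: "\<beta> \<in> weight_mats \<sigma>' \<pi>'" for \<beta>
  proof (rule poly_mapping_eqI)
    fix x
    have "block_sum (entry \<beta>) m n = sum_list \<sigma>'"
      using weight_mats_deg[OF \<beta>] by (simp add: deg_mats_def len)
    also have "\<dots> = Suc d" using sum_list_update[OF kl(1), of "\<sigma> ! k + 1"] d elem_le_sum_list[OF kl(1)]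
      by (simp add: \<sigma>')
    finally have "block_sum (entry \<beta>) m n = Suc d" .
    moreover have "row_sum n \<beta> (Suc k) = \<sigma> ! k + 1" "col_sum m \<beta> (Suc l) = \<pi> ! l + 1"
      using \<beta> kl' s'[of "Suc k"] p'[of "Suc l"] by (auto simp: weight_mats_def len)
    ultimately have "1 \<le> entry \<beta> (Suc k) (Suc l)"
      using block_sum_cross[OF kl', of "entry \<beta>"] big by (simp add: row_sum_def col_sum_def)
    thus "Poly_Mapping.lookup (\<beta> - E + E) x = Poly_Mapping.lookup \<beta> x"
      by (auto simp: lookup_add lookup_minus E_def lookup_single when_def entry_def)
  qed
  have diag: "diag_coeff m n (\<alpha> + E) = diag_coeff m n \<alpha>" if \<alpha>: "\<alpha> \<in> weight_mats \<sigma> \<pi>" for \<alpha>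
    unfolding E_def
  proof (rule diag_coeff_add_unit[OF _ kl'])
    have "block_sum (entry \<alpha>) m n = d" using weight_mats_deg[OF \<alpha>] d by (simp add: deg_mats_def len)
    moreover have "row_sum n \<alpha> (Suc k) = \<sigma> ! k" "col_sum m \<alpha> (Suc l) = \<pi> ! l"
      using \<alpha> kl' by (auto simp: weight_mats_def len)
    ultimately show "block_sum (entry \<alpha>) m n \<le> row_sum n \<alpha> (Suc k) + col_sum m \<alpha> (Suc l)"
      using big by simp
  qed (use \<alpha> in \<open>simp add: weight_mats_def len\<close>)
  show ?thesis unfolding Tr_RSK_weight_eq len
    by (rule sum.reindex_bij_witness[of _ "\<lambda>\<alpha>. \<alpha> + E" "\<lambda>\<beta>. \<beta> - E"])
      (use minus iff diag in \<open>auto, metis+\<close>)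
qed

section \<open>The reduction poset\<close>

lemma nth_add_nth_le_sum_list:
  fixes xs :: "nat list"
  assumes "i < length xs" "j < length xs" "i \<noteq> j"
  shows "xs ! i + xs ! j \<le> sum_list xs"
proof -
  have "xs ! i + xs ! j = (\<Sum>k\<in>{i, j}. xs ! k)" using assms by simp
  also have "\<dots> \<le> sum_list xs"
    unfolding sum_list_sum_nth using assms by (intro sum_mono2) auto
  finally show ?thesis .
qed

lemma sum_list_decr:
  fixes xs :: "nat list"
  assumes "i < length xs" "1 \<le> xs ! i"
  shows "Suc (sum_list (xs[i := xs ! i - 1])) = sum_list xs"
  using sum_list_update[OF assms(1), of "xs ! i - 1"] elem_le_sum_list[OF assms(1)] assms(2) by linarith

text \<open>The covering relation read downwards, with d the degree of the upper pair: two entries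
  grow by 1 each while the degree grows by 1, which makes the inequality strict. It forces both
  entries to be positive, so the subtractions are genuine.\<close>

lemma wp_covers_iff:
  "wp_covers u (\<sigma>, \<pi>) \<longleftrightarrow> (\<exists>d k l. weight_pair d (\<sigma>, \<pi>) \<and> k < length \<sigma> \<and> l < length \<pi> \<and>
     d < \<sigma> ! k + \<pi> ! l \<and> u = (\<sigma>[k := \<sigma> ! k - 1], \<pi>[l := \<pi> ! l - 1]))"
proof
  assume "wp_covers u (\<sigma>, \<pi>)"
  then obtain \<sigma>0 \<pi>0 d k l where u: "u = (\<sigma>0, \<pi>0)" and w: "weight_pair d (\<sigma>0, \<pi>0)"
    and kl: "k < length \<sigma>0" "l < length \<pi>0" "d \<le> \<sigma>0 ! k + \<pi>0 ! l"
    and \<sigma>: "\<sigma> = \<sigma>0[k := \<sigma>0 ! k + 1]" and \<pi>: "\<pi> = \<pi>0[l := \<pi>0 ! l + 1]"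
    by (cases u) (auto simp: wp_covers_def)
  have "weight_pair (Suc d) (\<sigma>, \<pi>)"
    using sum_list_decr[of k \<sigma>] sum_list_decr[of l \<pi>] kl w by (simp add: \<sigma> \<pi> weight_pair_def)
  thus "\<exists>d k l. weight_pair d (\<sigma>, \<pi>) \<and> k < length \<sigma> \<and> l < length \<pi> \<and>
     d < \<sigma> ! k + \<pi> ! l \<and> u = (\<sigma>[k := \<sigma> ! k - 1], \<pi>[l := \<pi> ! l - 1])"
    using kl by - (rule exI[of _ "Suc d"], rule exI[of _ k], rule exI[of _ l], auto simp: \<sigma> \<pi> u)
next
  assume "\<exists>d k l. weight_pair d (\<sigma>, \<pi>) \<and> k < length \<sigma> \<and> l < length \<pi> \<and>
     d < \<sigma> ! k + \<pi> ! l \<and> u = (\<sigma>[k := \<sigma> ! k - 1], \<pi>[l := \<pi> ! l - 1])"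
  then obtain d k l where w: "weight_pair d (\<sigma>, \<pi>)" and kl: "k < length \<sigma>" "l < length \<pi>"
    and big: "d < \<sigma> ! k + \<pi> ! l" and u: "u = (\<sigma>[k := \<sigma> ! k - 1], \<pi>[l := \<pi> ! l - 1])" by blast
  have pos: "1 \<le> \<sigma> ! k" "1 \<le> \<pi> ! l"
    using w big elem_le_sum_list[OF kl(1)] elem_le_sum_list[OF kl(2)] by (auto simp: weight_pair_def)
  have "weight_pair (d - 1) u"
    using sum_list_decr[OF kl(1) pos(1)] sum_list_decr[OF kl(2) pos(2)] w by (auto simp: weight_pair_def u)
  thus "wp_covers u (\<sigma>, \<pi>)" unfolding wp_covers_def u prod.case
    using kl pos big by - (rule exI[of _ "d - 1"], rule exI[of _ k], rule exI[of _ l], auto)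
qed

lemma wp_covers_swapI:
  assumes "wp_covers u v"
  shows "wp_covers (prod.swap u) (prod.swap v)"
proof -
  obtain \<sigma> \<pi> where v: "v = (\<sigma>, \<pi>)" by (cases v)
  obtain d k l where "weight_pair d (\<sigma>, \<pi>)" "k < length \<sigma>" "l < length \<pi>" "d < \<sigma> ! k + \<pi> ! l"
    "u = (\<sigma>[k := \<sigma> ! k - 1], \<pi>[l := \<pi> ! l - 1])" using assms by (auto simp: v wp_covers_iff)
  thus ?thesis unfolding v swap_simp wp_covers_iff
    by - (rule exI[of _ d], rule exI[of _ l], rule exI[of _ k], auto simp: weight_pair_def)
qed

lemma wp_covers_swap: "wp_covers (prod.swap u) (prod.swap v) \<longleftrightarrow> wp_covers u v"
  using wp_covers_swapI[of u v] wp_covers_swapI[of "prod.swap u" "prod.swap v"] by auto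

text \<open>Two steps that differ in both positions cannot coexist: two entries of
  \<open>\<sigma>\<close> sum to at most d, as do two of \<open>\<pi>\<close>, but together the four
  would exceed 2d. Distinct steps thus share one position, and each remains possible after the
  other.\<close>

lemma wp_covers_diamond:
  assumes "wp_covers u v" "wp_covers u' v" "u \<noteq> u'"
  shows "\<exists>w. wp_covers w u \<and> wp_covers w u'"
proof -
  have aux: "\<exists>w. wp_covers w (\<sigma>[k := \<sigma> ! k - 1], \<pi>[l := \<pi> ! l - 1]) \<and>
      wp_covers w (\<sigma>[k' := \<sigma> ! k' - 1], \<pi>[l := \<pi> ! l - 1])"
    if w: "weight_pair d (\<sigma>, \<pi>)" and kl: "k < length \<sigma>" "k' < length \<sigma>" "l < length \<pi>" "k \<noteq> k'"
      and big: "d < \<sigma> ! k + \<pi> ! l" "d < \<sigma> ! k' + \<pi> ! l" for \<sigma> \<pi> k k' l d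
  proof -
    have pos: "1 \<le> \<sigma> ! k" "1 \<le> \<sigma> ! k'" "1 \<le> \<pi> ! l"
      using w big elem_le_sum_list[OF kl(1)] elem_le_sum_list[OF kl(2)] elem_le_sum_list[OF kl(3)]
      by (auto simp: weight_pair_def)
    have wt: "weight_pair (d - 1) (\<sigma>[j := \<sigma> ! j - 1], \<pi>[l := \<pi> ! l - 1])"
      if "j < length \<sigma>" "1 \<le> \<sigma> ! j" for j
      using sum_list_decr[OF that] sum_list_decr[OF kl(3) pos(3)] w by (auto simp: weight_pair_def)
    \<comment> \<open>Both steps lower the same entry of \<open>\<pi>\<close>, which therefore drops
      by 2.\<close>
    let ?w = "(\<sigma>[k := \<sigma> ! k - 1, k' := \<sigma> ! k' - 1], \<pi>[l := \<pi> ! l - 2])"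
    have "wp_covers ?w (\<sigma>[k := \<sigma> ! k - 1], \<pi>[l := \<pi> ! l - 1])"
      unfolding wp_covers_iff using wt[OF kl(1) pos(1)] kl pos big
      by - (rule exI[of _ "d - 1"], rule exI[of _ k'], rule exI[of _ l], auto simp: numeral_2_eq_2)
    moreover have "wp_covers ?w (\<sigma>[k' := \<sigma> ! k' - 1], \<pi>[l := \<pi> ! l - 1])"
      unfolding wp_covers_iff using wt[OF kl(2) pos(2)] kl pos big
      by - (rule exI[of _ "d - 1"], rule exI[of _ k], rule exI[of _ l], auto simp: list_update_swap numeral_2_eq_2)
    ultimately show ?thesis by blast
  qed
  obtain \<sigma> \<pi> where v: "v = (\<sigma>, \<pi>)" by (cases v)
  obtain d k l where 1: "weight_pair d (\<sigma>, \<pi>)" "k < length \<sigma>" "l < length \<pi>" "d < \<sigma> ! k + \<pi> ! l"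
    "u = (\<sigma>[k := \<sigma> ! k - 1], \<pi>[l := \<pi> ! l - 1])" using assms(1) by (auto simp: v wp_covers_iff)
  obtain d' k' l' where 2: "weight_pair d' (\<sigma>, \<pi>)" "k' < length \<sigma>" "l' < length \<pi>" "d' < \<sigma> ! k' + \<pi> ! l'"
    "u' = (\<sigma>[k' := \<sigma> ! k' - 1], \<pi>[l' := \<pi> ! l' - 1])" using assms(2) by (auto simp: v wp_covers_iff)
  have d: "d' = d" "sum_list \<sigma> = d" "sum_list \<pi> = d" using 1 2 by (auto simp: weight_pair_def)
  consider "k \<noteq> k'" "l = l'" | "k = k'" "l \<noteq> l'" | "k \<noteq> k'" "l \<noteq> l'" | "k = k'" "l = l'" by blast
  thus ?thesis
  proof cases
    case 1
    thus ?thesis using aux[OF \<open>weight_pair d (\<sigma>, \<pi>)\<close>, of k k' l] \<open>k < length \<sigma>\<close> 2 1 d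
        \<open>u = _\<close> \<open>d < \<sigma> ! k + \<pi> ! l\<close> \<open>l < length \<pi>\<close> by auto
  next
    case 2
    have "weight_pair d (\<pi>, \<sigma>)" using d by (simp add: weight_pair_def)
    from aux[OF this \<open>l < length \<pi>\<close> \<open>l' < length \<pi>\<close> \<open>k < length \<sigma>\<close> \<open>l \<noteq> l'\<close>]
    obtain w where "wp_covers w (prod.swap u)" "wp_covers w (prod.swap u')"
      using \<open>d < \<sigma> ! k + \<pi> ! l\<close> \<open>d' < \<sigma> ! k' + \<pi> ! l'\<close> d \<open>u = _\<close> \<open>u' = _\<close> \<open>k = k'\<close>
      by (auto simp: add.commute)
    thus ?thesis using wp_covers_swap[of "prod.swap w"] by (intro exI[of _ "prod.swap w"]) auto
  next
    case 3
    thus ?thesis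
      using nth_add_nth_le_sum_list[of k \<sigma> k'] nth_add_nth_le_sum_list[of l \<pi> l']
        \<open>k < length \<sigma>\<close> \<open>l < length \<pi>\<close> \<open>k' < length \<sigma>\<close> \<open>l' < length \<pi>\<close>
        \<open>d < \<sigma> ! k + \<pi> ! l\<close> \<open>d' < \<sigma> ! k' + \<pi> ! l'\<close> d by linarith
  next
    case 4
    thus ?thesis using assms(3) \<open>u = _\<close> \<open>u' = _\<close> by simp
  qed
qed

lemma wp_covers_sum: "wp_covers u v \<Longrightarrow> sum_list (fst v) = Suc (sum_list (fst u))"
proof -
  assume *: "wp_covers u v"
  obtain \<sigma> \<pi> where v: "v = (\<sigma>, \<pi>)" by (cases v)
  obtain d k l where 1: "weight_pair d (\<sigma>, \<pi>)" "k < length \<sigma>" "l < length \<pi>" "d < \<sigma> ! k + \<pi> ! l"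
    "u = (\<sigma>[k := \<sigma> ! k - 1], \<pi>[l := \<pi> ! l - 1])" using * by (auto simp: v wp_covers_iff)
  have "1 \<le> \<sigma> ! k" using 1 elem_le_sum_list[OF 1(3)] by (auto simp: weight_pair_def)
  thus ?thesis using sum_list_decr[OF 1(2)] 1 by (simp add: v)
qed

definition wp_minimal :: "wpair \<Rightarrow> bool" where
  "wp_minimal w \<longleftrightarrow> (\<nexists>u. wp_covers u w)"

lemma wp_minimal_iff: "(\<forall>u. wp_le u w \<longrightarrow> u = w) \<longleftrightarrow> wp_minimal w"
proof
  assume *: "\<forall>u. wp_le u w \<longrightarrow> u = w"
  show "wp_minimal w" unfolding wp_minimal_def
  proof
    assume "\<exists>u. wp_covers u w"
    then obtain u where u: "wp_covers u w" by blast
    hence "wp_le u w" by (simp add: wp_le_def r_into_rtranclp)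
    hence "u = w" using * by blast
    thus False using wp_covers_sum[OF u] by simp
  qed
next
  assume *: "wp_minimal w"
  show "\<forall>u. wp_le u w \<longrightarrow> u = w"
    using * by (auto simp: wp_le_def wp_minimal_def elim: rtranclp.cases)
qed

text \<open>The diamond makes downward steps strongly confluent, so connected pairs have a common
  lower bound. Below a minimal pair this can only be the pair itself.\<close>

lemma equivclp_wp_covers:
  assumes "equivclp wp_covers v w" "wp_minimal w"
  shows "wp_le w v"
proof -
  have down: "(wp_covers\<inverse>\<inverse>)\<^sup>*\<^sup>* = wp_covers\<^sup>*\<^sup>*\<inverse>\<inverse>" by (rule rtranclp_conversep)
  have "strong_confluentp (wp_covers\<inverse>\<inverse>)"
  proof
    fix v u u' assume "wp_covers\<inverse>\<inverse> v u" "wp_covers\<inverse>\<inverse> v u'"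
    thus "\<exists>w. (wp_covers\<inverse>\<inverse>)\<^sup>*\<^sup>* u w \<and> (wp_covers\<inverse>\<inverse>)\<^sup>=\<^sup>= u' w"
    proof (cases "u = u'")
      case True
      thus ?thesis by blast
    next
      case False
      then obtain w where "wp_covers w u" "wp_covers w u'"
        using wp_covers_diamond[of u v u'] \<open>wp_covers\<inverse>\<inverse> v u\<close> \<open>wp_covers\<inverse>\<inverse> v u'\<close> by blast
      hence "(wp_covers\<inverse>\<inverse>)\<^sup>*\<^sup>* u w" "(wp_covers\<inverse>\<inverse>)\<^sup>=\<^sup>= u' w" by (auto intro: r_into_rtranclp)
      thus ?thesis by blast
    qed
  qed
  from semiconfluentp_equivclp[OF strong_confluentp_into_semiconfluentp[OF this]]
  have "equivclp wp_covers = (wp_covers\<inverse>\<inverse>)\<^sup>*\<^sup>* OO wp_covers\<^sup>*\<^sup>*" by simp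
  then obtain x where "wp_le x v" "wp_le x w"
    using assms(1) by (auto simp: down wp_le_def)
  thus ?thesis using assms(2) wp_minimal_iff by metis
qed

lemma reduces_to_iff: "reduces_to v w \<longleftrightarrow> wp_le w v \<and> wp_minimal w"
proof -
  have "wp_le w v \<Longrightarrow> equivclp wp_covers v w"
    unfolding wp_le_def using rtranlcp_le_equivclp by (metis equivclp_sym predicate2D)
  thus ?thesis unfolding reduces_to_def wp_minimal_iff using equivclp_wp_covers by blast
qed

lemma reduces_to_unique:
  assumes "reduces_to v w" "reduces_to v w'"
  shows "w = w'"
proof -
  have "equivclp wp_covers w w'"
    using assms unfolding reduces_to_def by (metis equivclp_sym equivclp_trans)
  hence "wp_le w' w" using assms equivclp_wp_covers by (simp add: reduces_to_iff)
  thus ?thesis using assms unfolding reduces_to_def by blast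
qed

lemma reduces_to_exists: "\<exists>w. reduces_to v w"
proof (induction "sum_list (fst v)" arbitrary: v rule: less_induct)
  case less
  show ?case
  proof (cases "wp_minimal v")
    case True
    hence "reduces_to v v" by (simp add: reduces_to_iff wp_le_def)
    thus ?thesis by blast
  next
    case False
    then obtain u where u: "wp_covers u v" by (auto simp: wp_minimal_def)
    then obtain w where "reduces_to u w" using less[of u] wp_covers_sum[OF u] by auto
    hence "reduces_to v w"
      using u by (auto simp: reduces_to_iff wp_le_def intro: rtranclp.rtrancl_into_rtrancl)
    thus ?thesis by blast
  qed
qed

lemma wp_le_swap: "wp_le u v \<Longrightarrow> wp_le (prod.swap u) (prod.swap v)"
  unfolding wp_le_def
proof (induction rule: rtranclp_induct)
  case (step v v')
  from step.IH wp_covers_swapI[OF step.hyps(2)] show ?case by (rule rtranclp.rtrancl_into_rtrancl)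
qed simp

lemma wp_minimal_swap: "wp_minimal (prod.swap w) \<longleftrightarrow> wp_minimal w"
  unfolding wp_minimal_def by (metis swap_swap wp_covers_swap)

lemma reduces_to_swap: "reduces_to (prod.swap v) (prod.swap w) \<longleftrightarrow> reduces_to v w"
  unfolding reduces_to_iff wp_minimal_swap by (metis swap_swap wp_le_swap)

lemma wp_le_trace: "wp_le u v \<Longrightarrow> Tr_RSK_weight (fst v) (snd v) = Tr_RSK_weight (fst u) (snd u)"
  unfolding wp_le_def
proof (induction rule: rtranclp_induct)
  case (step v v')
  thus ?case using Tr_RSK_weight_covers[of "fst v" "snd v" "fst v'" "snd v'"] by simp
qed simp

definition big_pair :: "nat \<Rightarrow> wpair \<Rightarrow> bool" where
  "big_pair d v \<longleftrightarrow> weight_pair d v \<and> nonzero_entries v \<and> 2 \<le> length (fst v) \<and> 2 \<le> length (snd v)"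

lemma nth_less_sum_list:
  fixes xs :: "nat list"
  assumes "0 \<notin> set xs" "2 \<le> length xs" "i < length xs"
  shows "xs ! i < sum_list xs"
proof -
  define j where "j = (if i = 0 then 1 else 0 :: nat)"
  have j: "j < length xs" "j \<noteq> i" using assms by (auto simp: j_def)
  hence "0 < xs ! j" using assms(1) by (metis gr0I nth_mem)
  thus ?thesis using nth_add_nth_le_sum_list[of i xs j] assms j by simp
qed

text \<open>With at least two nonzero parts on each side every entry is below d. Two entries that
  sum to more than d are then both at least 2 and remain nonzero after a downward step.\<close>

lemma big_pair_covers:
  assumes "big_pair d v" "wp_covers u v"
  shows "big_pair (d - 1) u \<and> length (fst u) = length (fst v) \<and> length (snd u) = length (snd v)"
proof -
  obtain \<sigma> \<pi> where v: "v = (\<sigma>, \<pi>)" by (cases v)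
  obtain d' k l where 1: "weight_pair d' (\<sigma>, \<pi>)" "k < length \<sigma>" "l < length \<pi>" "d' < \<sigma> ! k + \<pi> ! l"
    "u = (\<sigma>[k := \<sigma> ! k - 1], \<pi>[l := \<pi> ! l - 1])" using assms(2) by (auto simp: v wp_covers_iff)
  have b: "0 \<notin> set \<sigma>" "0 \<notin> set \<pi>" "2 \<le> length \<sigma>" "2 \<le> length \<pi>" "sum_list \<sigma> = d" "sum_list \<pi> = d" "d' = d"
    using assms(1) 1 by (auto simp: big_pair_def v nonzero_entries_def weight_pair_def)
  have pos: "2 \<le> \<sigma> ! k" "2 \<le> \<pi> ! l"
    using nth_less_sum_list[OF b(1,3) 1(2)] nth_less_sum_list[OF b(2,4) 1(3)] 1(4) b by auto
  have "weight_pair (d - 1) u"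
    using sum_list_decr[OF 1(2)] sum_list_decr[OF 1(3)] pos b by (auto simp: 1(5) weight_pair_def)
  moreover have "nonzero_entries u"
    using b pos set_update_subset_insert[of \<sigma> k "\<sigma> ! k - 1"] set_update_subset_insert[of \<pi> l "\<pi> ! l - 1"]
    by (auto simp: 1(5) nonzero_entries_def)
  ultimately show ?thesis using b by (auto simp: big_pair_def 1(5) v)
qed

lemma big_pair_le:
  assumes "wp_le u v" "big_pair d v"
  shows "\<exists>d'\<le>d. big_pair d' u \<and> length (fst u) = length (fst v) \<and> length (snd u) = length (snd v)"
  using assms(1) unfolding wp_le_def
proof (induction rule: converse_rtranclp_induct)
  case base
  show ?case using assms(2) by auto
next
  case (step u u')
  then obtain d' where d': "d' \<le> d" "big_pair d' u'" "length (fst u') = length (fst v)" "length (snd u') = length (snd v)"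
    by blast
  thus ?case using big_pair_covers[OF d'(2) step(1)] by (intro exI[of _ "d' - 1"]) auto
qed

lemma wp_minimal_iff_reduced:
  assumes "big_pair d w"
  shows "wp_minimal w \<longleftrightarrow> reduced d w"
proof -
  obtain \<sigma> \<pi> where w: "w = (\<sigma>, \<pi>)" by (cases w)
  have wt: "weight_pair d' (\<sigma>, \<pi>) \<longleftrightarrow> d' = d" and ne: "\<sigma> \<noteq> []" "\<pi> \<noteq> []" for d'
    using assms by (auto simp: big_pair_def w weight_pair_def)
  have "reduced d w \<longleftrightarrow> (\<forall>x\<in>set \<sigma>. \<forall>y\<in>set \<pi>. x + y \<le> d)"
  proof
    assume *: "reduced d w"
    show "\<forall>x\<in>set \<sigma>. \<forall>y\<in>set \<pi>. x + y \<le> d"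
    proof (intro ballI)
      fix x y assume "x \<in> set \<sigma>" "y \<in> set \<pi>"
      hence "x \<le> Max (set \<sigma>)" "y \<le> Max (set \<pi>)" by auto
      thus "x + y \<le> d" using * by (auto simp: reduced_def w)
    qed
  next
    assume "\<forall>x\<in>set \<sigma>. \<forall>y\<in>set \<pi>. x + y \<le> d"
    moreover have "Max (set \<sigma>) \<in> set \<sigma>" "Max (set \<pi>) \<in> set \<pi>" using ne by (auto intro!: Max_in)
    ultimately show "reduced d w" using assms by (auto simp: reduced_def w big_pair_def)
  qed
  also have "\<dots> \<longleftrightarrow> wp_minimal w"
  proof -
    have e: "(\<exists>u. wp_covers u w) \<longleftrightarrow> (\<exists>k<length \<sigma>. \<exists>l<length \<pi>. d < \<sigma> ! k + \<pi> ! l)"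
      unfolding w wp_covers_iff wt by blast
    show ?thesis unfolding wp_minimal_def e all_set_conv_all_nth by (meson linorder_not_le)
  qed
  finally show ?thesis by simp
qed

text \<open>A tuple with a single part has maximum d, which leaves no room for a positive entry on
  the other side.\<close>

lemma reduced_big_pair:
  assumes "reduced d w" "0 < d" "nonzero_entries w"
  shows "big_pair d w"
proof -
  obtain \<sigma> \<pi> where w: "w = (\<sigma>, \<pi>)" by (cases w)
  have *: "sum_list \<sigma> = d" "sum_list \<pi> = d" "Max (set \<sigma>) + Max (set \<pi>) \<le> d" "0 \<notin> set \<sigma>" "0 \<notin> set \<pi>"
    using assms by (auto simp: reduced_def w weight_pair_def nonzero_entries_def)
  have ne: "\<sigma> \<noteq> []" "\<pi> \<noteq> []" using *(1,2) assms(2) by (metis sum_list.Nil less_irrefl)+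
  hence M: "Max (set \<sigma>) \<in> set \<sigma>" "Max (set \<pi>) \<in> set \<pi>" by (auto intro!: Max_in)
  hence pos: "0 < Max (set \<sigma>)" "0 < Max (set \<pi>)" using * by (metis gr0I)+
  have single: "2 \<le> length xs" if "xs \<noteq> []" "Max (set xs) < sum_list xs" for xs :: "nat list"
    using that by (cases xs; cases "tl xs") auto
  have "Max (set \<sigma>) < sum_list \<sigma>" "Max (set \<pi>) < sum_list \<pi>" using pos * by linarith+
  hence "2 \<le> length \<sigma>" "2 \<le> length \<pi>" using single ne by blast+
  thus ?thesis using assms by (auto simp: big_pair_def w reduced_def)
qed

section \<open>Counting\<close>

definition comps :: "nat \<Rightarrow> nat list set" where
  "comps d = {l. 0 \<notin> set l \<and> sum_list l = d}"

lemma length_le_sum_list: "0 \<notin> set (l :: nat list) \<Longrightarrow> length l \<le> sum_list l"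
  by (induction l) auto

lemma comps_length: "l \<in> comps d \<Longrightarrow> length l \<le> d"
  using length_le_sum_list by (auto simp: comps_def)

lemma finite_comps: "finite (comps d)"
proof (rule finite_subset)
  show "comps d \<subseteq> {l. set l \<subseteq> {..d} \<and> length l \<le> d}"
    using comps_length member_le_sum_list by (fastforce simp: comps_def)
qed (rule finite_lists_length_le, simp)

lemma comps_length_eq: "l \<in> comps d \<Longrightarrow> length l = d \<Longrightarrow> l = replicate d 1"
proof (induction l arbitrary: d)
  case (Cons x l)
  have "length l \<le> sum_list l" using Cons.prems by (intro length_le_sum_list) (auto simp: comps_def)
  moreover have "x \<noteq> 0" using Cons.prems by (auto simp: comps_def)
  ultimately have x: "x = 1" "sum_list l = length l" using Cons.prems by (auto simp: comps_def)
  have "l \<in> comps (length l)" using Cons.prems x by (auto simp: comps_def)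
  from Cons.IH[OF this refl] show ?case using Cons.prems x by auto
qed simp

lemma replicate_comps: "replicate d 1 \<in> comps d"
  by (auto simp: comps_def sum_list_replicate)

lemma sum_list_strip: "sum_list (strip l) = sum_list l"
  by (induction l) auto

text \<open>Only the positions of the nonzero parts are free; splitting by the first entry gives
  Pascal's rule.\<close>

lemma card_strip:
  assumes "0 \<notin> set s"
  shows "finite {l. length l = m \<and> strip l = s} \<and> card {l. length l = m \<and> strip l = s} = m choose length s"
  using assms
proof (induction m arbitrary: s)
  case 0
  have "{l. length l = 0 \<and> strip l = s} = (if s = [] then {[]} else {})" by auto
  thus ?case by (cases s) auto
next
  case (Suc m)
  let ?F = "\<lambda>s. {l. length l = m \<and> strip l = s}"
  show ?case
  proof (cases s)
    case Nil
    have "{l. length l = Suc m \<and> strip l = s} = (#) 0 ` ?F []"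
      by (auto simp: Nil length_Suc_conv split: if_splits)
    thus ?thesis using Suc.IH[of "[]"] by (simp add: Nil card_image)
  next
    case (Cons x s')
    have "{l. length l = Suc m \<and> strip l = s} = (#) 0 ` ?F s \<union> (#) x ` ?F s'"
      using Suc.prems by (auto simp: Cons length_Suc_conv split: if_splits)
    moreover have "((#) 0 ` ?F s) \<inter> ((#) x ` ?F s') = {}" using Suc.prems by (auto simp: Cons)
    ultimately show ?thesis using Suc.IH[of s] Suc.IH[of s'] Suc.prems
      by (simp add: card_Un_disjoint card_image Cons)
  qed
qed

lemma sum_over_strip:
  fixes g :: "nat list \<Rightarrow> nat list \<Rightarrow> 'a::comm_semiring_1"
  shows "(\<Sum>(\<sigma>, \<pi>)\<in>weight_pairs m n d. g (strip \<sigma>) (strip \<pi>))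
    = (\<Sum>(\<sigma>, \<pi>)\<in>comps d \<times> comps d. of_nat (m choose length \<sigma>) * of_nat (n choose length \<pi>) * g \<sigma> \<pi>)"
proof -
  let ?s = "\<lambda>v. (strip (fst v), strip (snd v))"
  have "?s ` weight_pairs m n d \<subseteq> comps d \<times> comps d"
    by (auto simp: weight_pairs_def comps_def sum_list_strip)
  from sum.group[OF finite_weight_pairs finite_cartesian_product[OF finite_comps finite_comps] this,
      of "\<lambda>v. g (strip (fst v)) (strip (snd v))"]
  have "(\<Sum>(\<sigma>, \<pi>)\<in>weight_pairs m n d. g (strip \<sigma>) (strip \<pi>))
      = (\<Sum>w\<in>comps d \<times> comps d. \<Sum>v\<in>{v \<in> weight_pairs m n d. ?s v = w}. g (strip (fst v)) (strip (snd v)))"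
    by (simp add: case_prod_beta)
  also have "\<dots> = (\<Sum>(\<sigma>, \<pi>)\<in>comps d \<times> comps d. of_nat (m choose length \<sigma>) * of_nat (n choose length \<pi>) * g \<sigma> \<pi>)"
  proof (rule sum.cong[OF refl], safe)
    fix \<sigma> \<pi> assume *: "\<sigma> \<in> comps d" "\<pi> \<in> comps d"
    have "{v \<in> weight_pairs m n d. ?s v = (\<sigma>, \<pi>)}
        = {l. length l = m \<and> strip l = \<sigma>} \<times> {l. length l = n \<and> strip l = \<pi>}"
      using * sum_list_strip by (fastforce simp: weight_pairs_def comps_def)
    moreover have "(\<Sum>v\<in>{v \<in> weight_pairs m n d. ?s v = (\<sigma>, \<pi>)}. g (strip (fst v)) (strip (snd v)))
        = (\<Sum>v\<in>{v \<in> weight_pairs m n d. ?s v = (\<sigma>, \<pi>)}. g \<sigma> \<pi>)"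
      by (rule sum.cong) auto
    ultimately show "(\<Sum>v\<in>{v \<in> weight_pairs m n d. ?s v = (\<sigma>, \<pi>)}. g (strip (fst v)) (strip (snd v)))
        = of_nat (m choose length \<sigma>) * of_nat (n choose length \<pi>) * g \<sigma> \<pi>"
      using card_strip[of \<sigma> m] card_strip[of \<pi> n] * by (simp add: comps_def card_cartesian_product)
  qed
  finally show ?thesis .
qed

text \<open>The common source of the polynomial, of the growth bound and of the sum over reduced
  pairs.\<close>

lemma Tr_RSK_comps:
  "Tr_RSK m n d = (\<Sum>(\<sigma>, \<pi>)\<in>comps d \<times> comps d.
     of_nat (m choose length \<sigma>) * of_nat (n choose length \<pi>) * Tr_RSK_weight \<sigma> \<pi>)"
proof -
  have "Tr_RSK m n d = (\<Sum>(\<sigma>, \<pi>)\<in>weight_pairs m n d. Tr_RSK_weight (strip \<sigma>) (strip \<pi>))"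
    unfolding Tr_RSK_weights by (rule sum.cong) (auto simp: Tr_RSK_weight_strip[symmetric])
  thus ?thesis by (simp only: sum_over_strip)
qed

text \<open>Double counting of the lists of length n with sum d, grouped by their nonzero
  parts.\<close>

lemma sum_choose_comps: "(\<Sum>l\<in>comps d. n choose length l) = (d + n - 1) choose d"
proof -
  let ?A = "{l :: nat list. length l = n \<and> sum_list l = d}"
  have "strip ` ?A \<subseteq> comps d" by (auto simp: comps_def sum_list_strip)
  from sum.group[OF finite_compositions finite_comps this, of "\<lambda>_. 1 :: nat"]
  have "(\<Sum>s\<in>comps d. card {l \<in> ?A. strip l = s}) = card ?A" by simp
  moreover have "card {l \<in> ?A. strip l = s} = n choose length s" if "s \<in> comps d" for s
  proof -
    have "{l \<in> ?A. strip l = s} = {l. length l = n \<and> strip l = s}"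
      using that sum_list_strip by (auto simp: comps_def)
    thus ?thesis using card_strip[of s n] that by (simp add: comps_def)
  qed
  ultimately show ?thesis by (simp add: card_length_sum_list)
qed

lemma Tr_RSK_weight_Nil: "Tr_RSK_weight [] [] = 1"
proof -
  have "weight_mats [] [] = {0}" by (auto simp: weight_mats_def expmats_def)
  moreover have "diag_coeff 0 0 0 = 1"
    by (simp add: diag_coeff_def RSK_op_zmonom RSK_def biword_def bitableau_def num_columns_def)
  ultimately show ?thesis by (simp add: Tr_RSK_weight_eq)
qed

text \<open>A positive entry of \<open>\<pi>\<close> together with the single part of the other side
  exceeds the degree, so downward steps continue to degree 0. There all zeros can be deleted, and
  the empty pair has trace 1.\<close>

lemma Tr_RSK_weight_single: "Tr_RSK_weight [sum_list \<pi>] \<pi> = 1"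
proof (induction "sum_list \<pi>" arbitrary: \<pi>)
  case 0
  hence s: "sum_list \<pi> = 0" by simp
  hence "strip \<pi> = []" by (simp add: filter_empty_conv)
  hence "Tr_RSK_weight [0] \<pi> = 1" using Tr_RSK_weight_strip[of "[0]" \<pi>] by (simp add: Tr_RSK_weight_Nil)
  thus ?case by (simp only: s)
next
  case (Suc d)
  have "\<exists>x\<in>set \<pi>. x \<noteq> 0" using Suc(2) by (metis sum_list_eq_0_iff nat.distinct(1))
  then obtain l where l: "l < length \<pi>" "1 \<le> \<pi> ! l" by (auto simp: in_set_conv_nth)
  let ?\<pi> = "\<pi>[l := \<pi> ! l - 1]"
  have d: "sum_list ?\<pi> = d" using sum_list_decr[OF l] Suc(2) by simp
  have "weight_pair (Suc d) ([Suc d], \<pi>)" using Suc(2) by (simp add: weight_pair_def)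
  hence "wp_covers ([d], ?\<pi>) ([Suc d], \<pi>)"
    unfolding wp_covers_iff using l
    by - (rule exI[of _ "Suc d"], rule exI[of _ 0], rule exI[of _ l], auto)
  from Tr_RSK_weight_covers[OF this] show ?case using Suc(1)[of ?\<pi>] d Suc(2)[symmetric] by simp
qed

text \<open>Admits a reduced pair in either order, to match \<open>A_num\<close>, whose fibres of
  reduction contain pairs in both orders.\<close>

definition unordered_index :: "nat \<Rightarrow> wpair set" where
  "unordered_index d = {w. nonzero_entries w \<and> (\<exists>d'. 0 < d' \<and> d' \<le> d \<and> reduced d' w)}"

lemma unordered_index_big: "w \<in> unordered_index d \<Longrightarrow> \<exists>d'\<le>d. big_pair d' w \<and> wp_minimal w"
  unfolding unordered_index_def using reduced_big_pair wp_minimal_iff_reduced by blast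

lemma big_minimal_index:
  assumes "big_pair d' w" "wp_minimal w" "d' \<le> d"
  shows "w \<in> unordered_index d"
proof -
  have "length (fst w) \<le> sum_list (fst w)"
    using assms by (intro length_le_sum_list) (auto simp: big_pair_def nonzero_entries_def)
  hence "0 < d'" using assms by (auto simp: big_pair_def weight_pair_def)
  thus ?thesis using assms wp_minimal_iff_reduced[OF assms(1)] by (auto simp: unordered_index_def big_pair_def)
qed

lemma finite_unordered_index: "finite (unordered_index d)"
proof (rule finite_subset)
  show "unordered_index d \<subseteq> (\<Union>d'\<le>d. comps d' \<times> comps d')"
    by (fastforce simp: unordered_index_def reduced_def weight_pair_def nonzero_entries_def comps_def)
qed (simp add: finite_comps)

lemma unordered_index_swap: "prod.swap w \<in> unordered_index d \<longleftrightarrow> w \<in> unordered_index d"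
  by (cases w) (auto simp: unordered_index_def nonzero_entries_def reduced_def weight_pair_def add.commute)

lemma big_pair_comps: "{v. big_pair d v} = {v \<in> comps d \<times> comps d. 2 \<le> length (fst v) \<and> 2 \<le> length (snd v)}"
  by (auto simp: big_pair_def comps_def weight_pair_def nonzero_entries_def)

lemma A_num_fibre:
  assumes "w \<in> unordered_index d"
  shows "A_num w d = card {v. big_pair d v \<and> reduces_to v w}"
proof -
  have "big_pair d v" if v: "weight_pair d v" "nonzero_entries v" "reduces_to v w" for v
  proof -
    have "wp_le w v" using v by (simp add: reduces_to_iff)
    hence "length (fst w) = length (fst v) \<and> length (snd w) = length (snd v)"
      unfolding wp_le_def
      by (induction rule: rtranclp_induct) (auto simp: wp_covers_def)
    thus ?thesis using unordered_index_big[OF assms] v by (auto simp: big_pair_def)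
  qed
  hence "{v. weight_pair d v \<and> nonzero_entries v \<and> reduces_to v w} = {v. big_pair d v \<and> reduces_to v w}"
    by (auto simp: big_pair_def)
  thus ?thesis by (simp add: A_num_def)
qed

lemma A_num_swap: "A_num (prod.swap w) d = A_num w d"
proof -
  let ?V = "\<lambda>w. {v. weight_pair d v \<and> nonzero_entries v \<and> reduces_to v w}"
  have "prod.swap v \<in> ?V (prod.swap w) \<longleftrightarrow> v \<in> ?V w" for v
    using reduces_to_swap[of v w] by (cases v) (auto simp: weight_pair_def nonzero_entries_def)
  hence "?V (prod.swap w) = prod.swap ` ?V w"
    by (auto simp: image_iff) (metis swap_swap)+
  thus ?thesis by (simp add: A_num_def card_image)
qed

abbreviation choose_pair :: "nat \<Rightarrow> nat \<Rightarrow> wpair \<Rightarrow> complex" where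
  "choose_pair m n v \<equiv> of_nat (m choose length (fst v)) * of_nat (n choose length (snd v))"

abbreviation trace_pair :: "wpair \<Rightarrow> complex" where
  "trace_pair v \<equiv> Tr_RSK_weight (fst v) (snd v)"

text \<open>Lengths and trace are constant along reduction, so every fibre contributes one value
  multiplied by its size.\<close>

lemma sum_big_pairs:
  "(\<Sum>v | big_pair d v. choose_pair m n v * trace_pair v)
    = (\<Sum>w\<in>unordered_index d. of_nat (A_num w d) * (choose_pair m n w * trace_pair w))"
proof -
  define red where "red v = (THE w. reduces_to v w)" for v
  have red: "red v = w \<longleftrightarrow> reduces_to v w" for v w
    unfolding red_def using reduces_to_exists[of v] reduces_to_unique by (metis the_equality)
  have fin: "finite {v. big_pair d v}" unfolding big_pair_comps by (simp add: finite_comps)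
  have "red ` {v. big_pair d v} \<subseteq> unordered_index d"
  proof (rule image_subsetI)
    fix v assume "v \<in> {v. big_pair d v}"
    hence v: "big_pair d v" by simp
    have *: "wp_le (red v) v" "wp_minimal (red v)"
      using red[of v "red v"] by (auto simp: reduces_to_iff)
    show "red v \<in> unordered_index d" using big_pair_le[OF *(1) v] big_minimal_index *(2) by blast
  qed
  from sum.group[OF fin finite_unordered_index this, of "\<lambda>v. choose_pair m n v * trace_pair v"]
  have "(\<Sum>v | big_pair d v. choose_pair m n v * trace_pair v)
    = (\<Sum>w\<in>unordered_index d. \<Sum>v\<in>{v \<in> {v. big_pair d v}. red v = w}. choose_pair m n v * trace_pair v)"
    by (rule sym)
  also have "\<dots> = (\<Sum>w\<in>unordered_index d. of_nat (A_num w d) * (choose_pair m n w * trace_pair w))"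
  proof (rule sum.cong[OF refl])
    fix w assume w: "w \<in> unordered_index d"
    have "(\<Sum>v\<in>{v \<in> {v. big_pair d v}. red v = w}. choose_pair m n v * trace_pair v)
      = (\<Sum>v\<in>{v. big_pair d v \<and> reduces_to v w}. choose_pair m n w * trace_pair w)"
    proof (rule sum.cong)
      fix v assume "v \<in> {v. big_pair d v \<and> reduces_to v w}"
      hence v: "big_pair d v" "wp_le w v" by (auto simp: reduces_to_iff)
      show "choose_pair m n v * trace_pair v = choose_pair m n w * trace_pair w"
        using big_pair_le[OF v(2,1)] wp_le_trace[OF v(2)] by auto
    qed (auto simp: red)
    thus "(\<Sum>v\<in>{v \<in> {v. big_pair d v}. red v = w}. choose_pair m n v * trace_pair v)
      = of_nat (A_num w d) * (choose_pair m n w * trace_pair w)"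
      by (simp add: A_num_fibre[OF w])
  qed
  finally show ?thesis .
qed

lemma normalized_total:
  assumes "nonzero_entries (\<sigma>, \<pi>)"
  shows "normalized (\<sigma>, \<pi>) \<or> normalized (\<pi>, \<sigma>)"
proof -
  have nz: "nonzero_entries (\<pi>, \<sigma>)" using assms by (simp add: nonzero_entries_def)
  consider "length \<sigma> < length \<pi>" | "length \<pi> < length \<sigma>" | "length \<sigma> = length \<pi>" "\<sigma> = \<pi>"
    | "length \<sigma> = length \<pi>" "\<sigma> \<noteq> \<pi>" by linarith
  thus ?thesis
  proof cases
    case 4
    define i where "i = (LEAST i. \<sigma> ! i \<noteq> \<pi> ! i)"
    obtain k where k: "k < length \<sigma>" "\<sigma> ! k \<noteq> \<pi> ! k" using 4 nth_equalityI by blast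
    have i: "\<sigma> ! i \<noteq> \<pi> ! i" "i \<le> k" 
      using LeastI[of "\<lambda>i. \<sigma> ! i \<noteq> \<pi> ! i" k] Least_le[of "\<lambda>i. \<sigma> ! i \<noteq> \<pi> ! i" k] k
      unfolding i_def by blast+
    have "\<forall>j<i. \<sigma> ! j = \<pi> ! j" unfolding i_def using not_less_Least by blast
    thus ?thesis using 4 i k nz assms
      by (cases "\<sigma> ! i > \<pi> ! i") (auto simp: normalized_def intro!: exI[of _ i])
  qed (use assms nz in \<open>auto simp: normalized_def\<close>)
qed

lemma normalized_antisym:
  assumes "normalized (\<sigma>, \<pi>)" "normalized (\<pi>, \<sigma>)"
  shows "\<sigma> = \<pi>"
proof (rule ccontr)
  assume ne: "\<sigma> \<noteq> \<pi>"
  have "length \<sigma> = length \<pi>" using assms by (auto simp: normalized_def)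
  then obtain i j where ij: "\<sigma> ! i > \<pi> ! i" "\<forall>k<i. \<sigma> ! k = \<pi> ! k" "\<pi> ! j > \<sigma> ! j" "\<forall>k<j. \<pi> ! k = \<sigma> ! k"
    using assms ne by (auto simp: normalized_def)
  show False using ij by (cases i j rule: linorder_cases) auto
qed

text \<open>Of a pair with distinct components and its exchange exactly one is normalized, and the
  index set is closed under exchange.\<close>

lemma sum_normalized:
  fixes h :: "wpair \<Rightarrow> 'a::comm_monoid_add"
  shows "(\<Sum>w\<in>unordered_index d. h w)
    = (\<Sum>w\<in>reduced_index d. if fst w \<noteq> snd w then h w + h (prod.swap w) else h w)"
proof -
  let ?N = "reduced_index d" and ?D = "{w \<in> reduced_index d. fst w \<noteq> snd w}"
  have N: "?N = {w \<in> unordered_index d. normalized w}"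
    by (auto simp: reduced_index_def unordered_index_def normalized_def)
  have fin: "finite ?N" unfolding N using finite_unordered_index by simp
  have "unordered_index d = ?N \<union> prod.swap ` ?D"
  proof (intro equalityI subsetI)
    fix w assume w: "w \<in> unordered_index d"
    obtain \<sigma> \<pi> where [simp]: "w = (\<sigma>, \<pi>)" by (cases w)
    have "normalized (\<sigma>, \<pi>) \<or> normalized (\<pi>, \<sigma>)"
      using w by (intro normalized_total) (auto simp: unordered_index_def)
    thus "w \<in> ?N \<union> prod.swap ` ?D"
      using w unordered_index_swap[of w d] by (cases "\<sigma> = \<pi>") (auto simp: N image_iff)
  next
    fix w assume "w \<in> ?N \<union> prod.swap ` ?D"
    thus "w \<in> unordered_index d" using unordered_index_swap by (auto simp: N)
  qed
  moreover have "?N \<inter> prod.swap ` ?D = {}"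
    using normalized_antisym by (fastforce simp: N)
  ultimately have "(\<Sum>w\<in>unordered_index d. h w) = sum h ?N + sum h (prod.swap ` ?D)"
    using fin by (simp add: sum.union_disjoint)
  also have "sum h (prod.swap ` ?D) = (\<Sum>w\<in>?D. h (prod.swap w))"
    by (simp add: sum.reindex)
  also have "\<dots> = (\<Sum>w\<in>?N. if fst w \<noteq> snd w then h (prod.swap w) else 0)"
    using fin by (simp add: sum.inter_filter)
  also have "sum h ?N + \<dots> = (\<Sum>w\<in>?N. if fst w \<noteq> snd w then h w + h (prod.swap w) else h w)"
    unfolding sum.distrib[symmetric] by (rule sum.cong) auto
  finally show ?thesis .
qed

text \<open>Exchanging the tuples preserves \<open>A_num\<close> and the trace and only exchanges
  the roles of the two binomials; this is the origin of the two terms in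
  \<open>N_num\<close>.\<close>

lemma sum_N_num:
  "(\<Sum>w\<in>unordered_index d. of_nat (A_num w d) * (choose_pair m n w * trace_pair w))
    = (\<Sum>(\<sigma>, \<pi>)\<in>reduced_index d. of_nat (N_num (\<sigma>, \<pi>) m n d) * Tr_RSK_weight \<sigma> \<pi>)"
  unfolding sum_normalized
proof (rule sum.cong[OF refl], clarify)
  fix \<sigma> \<pi>
  show "(if fst (\<sigma>, \<pi>) \<noteq> snd (\<sigma>, \<pi>)
       then of_nat (A_num (\<sigma>, \<pi>) d) * (choose_pair m n (\<sigma>, \<pi>) * trace_pair (\<sigma>, \<pi>)) +
         of_nat (A_num (prod.swap (\<sigma>, \<pi>)) d) * (choose_pair m n (prod.swap (\<sigma>, \<pi>)) * trace_pair (prod.swap (\<sigma>, \<pi>)))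
       else of_nat (A_num (\<sigma>, \<pi>) d) * (choose_pair m n (\<sigma>, \<pi>) * trace_pair (\<sigma>, \<pi>)))
    = of_nat (N_num (\<sigma>, \<pi>) m n d) * Tr_RSK_weight \<sigma> \<pi>"
    unfolding A_num_swap by (simp add: N_num_def Tr_RSK_weight_swap[of \<pi> \<sigma>] algebra_simps)
qed

text \<open>Every trace here is 1, so this is inclusion-exclusion over the pairs with
  \<open>[d]\<close> on the left and those with \<open>[d]\<close> on the right. Their common
  element contributes the subtracted product of m and n.\<close>

lemma sum_single_pairs:
  assumes "0 < d"
  shows "(\<Sum>v\<in>{v \<in> comps d \<times> comps d. \<not> big_pair d v}. choose_pair m n v * trace_pair v) = of_int (N_zero m n d)"
proof -
  have d: "[d] \<in> comps d" using assms by (simp add: comps_def)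
  have short: "l = [d]" if l: "l \<in> comps d" "\<not> 2 \<le> length l" for l
  proof -
    have "l \<noteq> []" using l assms by (auto simp: comps_def)
    then obtain x where "l = [x]" using l(2) by (cases l; cases "tl l") auto
    thus ?thesis using l(1) by (simp add: comps_def)
  qed
  have S: "(\<Sum>l\<in>comps d. of_nat (k choose length l)) = (of_nat ((d + k - 1) choose d) :: complex)" for k
    unfolding sum_choose_comps[symmetric] by simp
  let ?A = "{[d]} \<times> comps d" and ?B = "comps d \<times> {[d]}"
  let ?f = "\<lambda>v. choose_pair m n v"
  have eq: "{v \<in> comps d \<times> comps d. \<not> big_pair d v} = ?A \<union> ?B"
  proof (rule Set.set_eqI)
    fix v :: wpair
    obtain \<sigma> \<pi> where v: "v = (\<sigma>, \<pi>)" by (cases v)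
    have "big_pair d v \<longleftrightarrow> v \<in> comps d \<times> comps d \<and> 2 \<le> length \<sigma> \<and> 2 \<le> length \<pi>"
      using big_pair_comps[of d] by (auto simp: v set_eq_iff)
    thus "v \<in> {v \<in> comps d \<times> comps d. \<not> big_pair d v} \<longleftrightarrow> v \<in> ?A \<union> ?B"
      using short[of \<sigma>] short[of \<pi>] d by (auto simp: v)
  qed
  have int: "?A \<inter> ?B = {([d], [d])}" using d by auto
  have "(\<Sum>v\<in>?A \<union> ?B. ?f v * trace_pair v) = sum ?f (?A \<union> ?B)"
  proof (rule sum.cong[OF refl])
    fix v assume "v \<in> ?A \<union> ?B"
    then obtain l where l: "l \<in> comps d" "v = ([d], l) \<or> v = (l, [d])" by auto
    have "Tr_RSK_weight [d] l = 1" using Tr_RSK_weight_single[of l] l(1) by (simp add: comps_def)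
    hence "trace_pair v = 1" using l(2) Tr_RSK_weight_swap[of "[d]" l] by auto
    thus "?f v * trace_pair v = ?f v" by simp
  qed
  moreover have "sum ?f (?A \<union> ?B) + sum ?f (?A \<inter> ?B) = sum ?f ?A + sum ?f ?B"
    by (rule sum.union_inter) (auto simp: finite_comps)
  moreover have "sum ?f ?A = of_nat m * of_nat ((d + n - 1) choose d)"
  proof -
    have "sum ?f ?A = (\<Sum>l\<in>comps d. of_nat m * of_nat (n choose length l))"
      by (rule sum.reindex_bij_witness[of _ "Pair [d]" snd]) auto
    thus ?thesis by (simp only: sum_distrib_left[symmetric] S)
  qed
  moreover have "sum ?f ?B = of_nat n * of_nat ((d + m - 1) choose d)"
  proof -
    have "sum ?f ?B = (\<Sum>l\<in>comps d. of_nat n * of_nat (m choose length l))"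
      by (rule sum.reindex_bij_witness[of _ "\<lambda>l. (l, [d])" fst]) auto
    thus ?thesis by (simp only: sum_distrib_left[symmetric] S)
  qed
  ultimately show ?thesis unfolding eq int by (simp add: N_zero_def algebra_simps)
qed

text \<open>In degree 0 the only composition is empty and the trace is 1, whereas
  \<open>N_zero\<close> is m + n - mn and the index set is empty; hence the assumption.\<close>

lemma Tr_RSK_formula:
  assumes "0 < d"
  shows "Tr_RSK m n d = of_int (N_zero m n d) +
    (\<Sum>(\<sigma>, \<pi>)\<in>reduced_index d. of_nat (N_num (\<sigma>, \<pi>) m n d) * Tr_RSK_weight \<sigma> \<pi>)"
proof -
  let ?C = "comps d \<times> comps d" and ?f = "\<lambda>v. choose_pair m n v * trace_pair v"
  have "Tr_RSK m n d = sum ?f ?C" by (simp add: Tr_RSK_comps case_prod_beta)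
  also have "\<dots> = sum ?f {v \<in> ?C. \<not> big_pair d v} + sum ?f {v \<in> ?C. big_pair d v}"
    by (subst sum.union_disjoint[symmetric]) (auto intro!: sum.cong simp: finite_comps)
  also have "{v \<in> ?C. big_pair d v} = {v. big_pair d v}" using big_pair_comps[of d] by auto
  finally show ?thesis by (simp only: sum_single_pairs[OF assms] sum_big_pairs sum_N_num)
qed

section \<open>Polynomiality\<close>

definition choose_poly :: "nat \<Rightarrow> complex poly" where
  "choose_poly k = smult (1 / fact k) (\<Prod>i<k. [:- of_nat i, 1:])"

lemma poly_choose_poly: "poly (choose_poly k) (of_nat m) = of_nat (m choose k)"
  by (simp add: choose_poly_def poly_prod binomial_gbinomial gbinomial_prod_rev lessThan_atLeast0)

lemma degree_choose_poly: "degree (choose_poly k) = k"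
  by (simp add: choose_poly_def degree_prod_eq_sum_degree)

lemma coeff_choose_poly: "coeff (choose_poly k) k = 1 / fact k"
proof -
  have "degree (\<Prod>i<k. [:- of_nat i, 1 :: complex:]) = k" by (simp add: degree_prod_eq_sum_degree)
  moreover have "lead_coeff (\<Prod>i<k. [:- of_nat i, 1 :: complex:]) = 1" by (simp add: lead_coeff_prod)
  ultimately show ?thesis by (simp add: choose_poly_def)
qed

text \<open>In \<open>eval2\<close> the outer variable is m; this lifts a polynomial to the outer
  variable with coefficients that do not involve n.\<close>

definition const_poly :: "complex poly \<Rightarrow> complex poly poly" where
  "const_poly = map_poly (\<lambda>c. [:c:])"

lemma poly_const_poly: "poly (const_poly q) [:x:] = [:poly q x:]"
  by (induction q) (simp_all add: const_poly_def map_poly_pCons)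

lemma coeff_const_poly: "coeff (const_poly q) i = [:coeff q i:]"
  by (simp add: const_poly_def coeff_map_poly)

definition trace_poly :: "nat \<Rightarrow> complex poly poly" where
  "trace_poly d = (\<Sum>v\<in>comps d \<times> comps d. smult (smult (trace_pair v) (choose_poly (length (snd v))))
     (const_poly (choose_poly (length (fst v)))))"

lemma eval2_trace_poly: "eval2 (trace_poly d) m n = Tr_RSK m n d"
  by (simp add: trace_poly_def eval2_def Tr_RSK_comps poly_sum poly_const_poly poly_choose_poly
      case_prod_beta mult_ac)

lemma coeff_trace_poly: "coeff (coeff (trace_poly d) i) j = (\<Sum>v\<in>comps d \<times> comps d.
    trace_pair v * coeff (choose_poly (length (snd v))) j * coeff (choose_poly (length (fst v))) i)"
  by (simp add: trace_poly_def coeff_sum coeff_const_poly mult_ac)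

lemma coeff_trace_poly_zero:
  assumes "d < i \<or> d < j"
  shows "coeff (coeff (trace_poly d) i) j = 0"
proof -
  have "coeff (choose_poly (length l)) k = 0" if "l \<in> comps d" "d < k" for l k
    using comps_length[OF that(1)] that(2) by (intro coeff_eq_0) (simp add: degree_choose_poly)
  thus ?thesis unfolding coeff_trace_poly using assms by (intro sum.neutral) auto
qed

text \<open>The binomial polynomials have the number of parts as degree, and the only composition of
  d with d parts is the one of all ones. Its two leading coefficients are each 1 / d!.\<close>

lemma coeff_trace_poly_lead:
  "coeff (coeff (trace_poly d) d) d = Tr_RSK_weight (replicate d 1) (replicate d 1) / (fact d)\<^sup>2"
proof -
  let ?r = "(replicate d 1, replicate d 1) :: wpair"
  let ?f = "\<lambda>v :: wpair. trace_pair v * coeff (choose_poly (length (snd v))) d * coeff (choose_poly (length (fst v))) d"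
  have "?f v = 0" if v: "v \<in> comps d \<times> comps d - {?r}" for v
  proof -
    have "length (fst v) \<noteq> d \<or> length (snd v) \<noteq> d" using v comps_length_eq
      by (metis DiffD1 DiffD2 insertI1 mem_Times_iff prod.collapse)
    hence "length (fst v) < d \<or> length (snd v) < d"
      using v comps_length by (cases v) (auto simp: le_less)
    thus ?thesis using coeff_eq_0[of "choose_poly _" d] by (auto simp: degree_choose_poly)
  qed
  hence "sum ?f (comps d \<times> comps d) = ?f ?r"
    by (intro sum.remove[THEN trans, of _ ?r]) 
      (auto simp: finite_comps replicate_comps[unfolded One_nat_def] sum.neutral)
  thus ?thesis by (simp add: coeff_trace_poly coeff_choose_poly power2_eq_square)
qed

lemma choose_le_power:
  assumes "1 \<le> m" "k \<le> d"
  shows "m choose k \<le> m ^ d"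
proof -
  have "m choose k \<le> m ^ k" using binomial_le_pow[of k m] by (cases "k \<le> m") (auto simp: binomial_eq_0)
  also have "\<dots> \<le> m ^ d" using assms by (intro power_increasing) auto
  finally show ?thesis .
qed

lemma Tr_RSK_bigo:
  "(\<lambda>(m, n). Tr_RSK m n d) \<in> O[at_top \<times>\<^sub>F at_top](\<lambda>(m, n). of_nat m ^ d * of_nat n ^ d)"
proof (rule bigoI)
  define c where "c = (\<Sum>v\<in>comps d \<times> comps d. norm (trace_pair v))"
  \<comment> \<open>Positive m and n are needed to pass from smaller powers to the power d.\<close>
  have bound: "norm (Tr_RSK m n d) \<le> c * (real m ^ d * real n ^ d)" if mn: "1 \<le> m" "1 \<le> n" for m n
  proof -
    have "norm (choose_pair m n v * trace_pair v) \<le> norm (trace_pair v) * (real m ^ d * real n ^ d)"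
      if v: "v \<in> comps d \<times> comps d" for v
    proof -
      have "length (fst v) \<le> d" "length (snd v) \<le> d" using v comps_length by auto
      hence "(m choose length (fst v)) \<le> m ^ d" "(n choose length (snd v)) \<le> n ^ d"
        using choose_le_power mn by auto
      hence "real (m choose length (fst v)) * real (n choose length (snd v)) \<le> real m ^ d * real n ^ d"
        by (intro mult_mono) (simp_all flip: of_nat_power)
      from mult_left_mono[OF this norm_ge_zero[of "trace_pair v"]] show ?thesis
        by (simp add: norm_mult mult_ac)
    qed
    hence "norm (sum (\<lambda>v. choose_pair m n v * trace_pair v) (comps d \<times> comps d)) \<le> c * (real m ^ d * real n ^ d)"
      unfolding c_def sum_distrib_right by (intro sum_norm_le) auto
    thus ?thesis by (simp add: Tr_RSK_comps case_prod_beta)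
  qed
  have "\<forall>\<^sub>F x in at_top \<times>\<^sub>F at_top. 1 \<le> (fst x :: nat) \<and> 1 \<le> (snd x :: nat)"
    by (rule eventually_prodI[OF eventually_ge_at_top eventually_ge_at_top])
  thus "\<forall>\<^sub>F x in at_top \<times>\<^sub>F at_top. norm (case x of (m, n) \<Rightarrow> Tr_RSK m n d)
      \<le> c * norm ((case x of (m, n) \<Rightarrow> of_nat m ^ d * of_nat n ^ d) :: complex)"
    by (rule eventually_mono) (use bound in \<open>auto simp: norm_mult norm_power\<close>)
qed

theorem theorem8p1:
  fixes d :: nat
  shows "(\<exists>p :: complex poly poly.
            (\<forall>m n. Tr_RSK m n d = eval2 p m n) \<and>
            (Tr_RSK_weight (replicate d 1) (replicate d 1) \<noteq> 0 \<longrightarrow>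
               lead_term p (Tr_RSK_weight (replicate d 1) (replicate d 1) / (fact d)\<^sup>2) d d)) \<and>
         (\<lambda>(m, n). Tr_RSK m n d) \<in>
            O[at_top \<times>\<^sub>F at_top](\<lambda>(m, n). of_nat m ^ d * of_nat n ^ d) \<and>
         (d > 0 \<longrightarrow> (\<forall>m n. Tr_RSK m n d =
            of_int (N_zero m n d) +
            (\<Sum>(\<sigma>, \<pi>)\<in>reduced_index d.
               of_nat (N_num (\<sigma>, \<pi>) m n d) * Tr_RSK_weight \<sigma> \<pi>)))"
proof (intro conjI exI[of _ "trace_poly d"] allI impI Tr_RSK_bigo Tr_RSK_formula)
  show "Tr_RSK m n d = eval2 (trace_poly d) m n" for m n by (rule eval2_trace_poly[symmetric])
  assume "Tr_RSK_weight (replicate d 1) (replicate d 1) \<noteq> 0"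
  moreover have "i + j < d + d" if "coeff (coeff (trace_poly d) i) j \<noteq> 0" "(i, j) \<noteq> (d, d)" for i j
  proof -
    have "i \<le> d" "j \<le> d" using coeff_trace_poly_zero[of d i j] that(1) by (auto simp: not_less[symmetric])
    thus ?thesis using that(2) by (auto simp: le_less)
  qed
  ultimately show "lead_term (trace_poly d) (Tr_RSK_weight (replicate d 1) (replicate d 1) / (fact d)\<^sup>2) d d"
    by (auto simp: lead_term_def coeff_trace_poly_lead)
qed

end
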